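(* Let $m\ge 1$ be an integer, $\rho>0$, $\eta>0$, and let $n_0\ge m$ be an integer. Let $N(t)$ be the Erlang A birth–death process with $N(0)=n_0$, $p_n(t)=\mathrm{Prob}[N(t)=n\mid N(0)=n_0]$, and $\widehat P_n(\theta)=\int_0^\infty e^{-\theta t}p_n(t)\,dt$ for $\mathrm{Re}(\theta)>0$. Then, writing $F_n=F_n(\theta)$, $H_n=H_n(\theta;m)$, $I_n=I_n(\theta;m)$, $$\widehat P_n(\theta)=\frac1\rho e^{-\rho/\eta}\left(\frac{\eta}{\rho}\right)^{n_0-m-1+\frac{\theta+m}{\eta}}\Gamma\!\left(\frac\theta\eta\right)\Gamma\!\left(n_0-m+1+\frac m\eta\right)\left[I_{n_0}+\frac{I_mF_{m-1}-I_{m-1}F_m}{F_mH_{m-1}-H_mF_{m-1}}H_{n_0}\right]H_n,\qquad n\ge n_0;$$ $$\widehat P_n(\theta)=\frac1\rho e^{-\rho/\eta}\left(\frac{\eta}{\rho}\right)^{n_0-m-1+\frac{\theta+m}{\eta}}\Gamma\!\left(\frac\theta\eta\right)\Gamma\!\left(n_0-m+1+\frac m\eta\right)\left[I_{n}+\frac{I_mF_{m-1}-I_{m-1}F_m}{F_mH_{m-1}-H_mF_{m-1}}H_{n}\right]H_{n_0},\qquad m\le n\le n_0;$$ $$\widehat P_n(\theta)=\frac1\rho\left(\frac\rho\eta\right)^{m-n_0}\frac{\Gamma\!\left(n_0-m+1+\frac m\eta\right)}{\Gamma\!\left(1+\frac m\eta\right)}\,\frac{H_{n_0}F_n}{F_mH_{m-1}-H_mF_{m-1}},\qquad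 0\le n\le m.$$
   Context: Erlang A model ($M/M/m+M$ queue) with service rate $\mu=1$: $N(t)$ is the birth–death process on $\{0,1,2,\dots\}$ with birth rate $\rho$ in every state, and death rate $n$ in state $n$ for $0\le n\le m$ and $m+(n-m)\eta$ in state $n$ for $n\ge m$. Special functions (for integer $n$): $$F_n(\theta)=\frac{1}{2\pi i}\int_{C_0}\frac{e^{\rho z}}{z^{n+1}(1-z)^\theta}\,dz,\qquad H_n(\theta;m)=\frac{1}{2\pi i}\int_{C_1}\frac{e^{\rho z/\eta}}{(z-1)^{\theta/\eta}\,z^{n+1-m}\,z^{m/\eta}}\,dz,$$ $$I_n(\theta;m)=\frac{1}{2\pi i}\int_{C_2}\frac{e^{\rho z/\eta}}{(1-z)^{\theta/\eta}\,z^{n+1-m}\,z^{m/\eta}}\,dz.$$ Contours: $C_0$ is a small counterclockwise circle about $0$ inside $|z|<1$; $C_1$ goes from $-\infty-i\varepsilon$ to $-\infty+i\varepsilon$ ($\varepsilon>0$), encircling $z=1$ counterclockwise and avoiding $\{\mathrm{Im}(z)=0,\mathrm{Re}(z)\le 1\}$; $C_2$ goes from $-\infty-i\varepsilon$ to $-\infty+i\varepsilon$, encircling $z=0$ counterclockwise and avoiding $\{\mathrm{Im}(z)=0,\mathrm{Re}(z)\le 0\}$ and $\{\mathrm{Im}(z)=0,\mathrm{Re}(z)\ge 1\}$ (so it crosses the real axis in $(0,1)$). Branches: $(1-z)^a=|1-z|^ae^{ia\arg(1-z)}$ with $|\arg(1-z)|<\pi$; $(z-1)^a=|z-1|^ae^{ia\arg(z-1)}$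 with $|\arg(z-1)|<\pi$; $z^{m/\eta}=|z|^{m/\eta}e^{i(m/\eta)\arg z}$ with $|\arg z|<\pi$. Here $\Gamma$ is the Gamma function. *)

theory Defs
  imports "HOL-Complex_Analysis.Complex_Analysis" "HOL-Probability.Probability"
    "HOL-Library.Landau_Symbols"
begin

section \<open>Birth-death processes and the Erlang A model\<close>

text \<open>
  \<open>P h i j\<close> is the probability of being in state \<open>j\<close> at time \<open>h\<close> after being in state \<open>i\<close>;
  it is constrained only for states \<open>i\<close> that the process visits with positive probability.
\<close>

definition homogeneous_markov_process ::
    "'a measure \<Rightarrow> (real \<Rightarrow> 'a \<Rightarrow> nat) \<Rightarrow> (real \<Rightarrow> nat \<Rightarrow> nat \<Rightarrow> real) \<Rightarrow> bool" where
  "homogeneous_markov_process M X P \<longleftrightarrow>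
     prob_space M \<and>
     (\<forall>t\<ge>0. X t \<in> measurable M (count_space UNIV)) \<and>
     (\<forall>s\<ge>0. \<forall>h\<ge>0. \<forall>T f i j.
        finite T \<longrightarrow> T \<subseteq> {0..<s} \<longrightarrow>
        \<P>(\<omega> in M. X s \<omega> = i \<and> (\<forall>u\<in>T. X u \<omega> = f u)) > 0 \<longrightarrow>
        \<P>(\<omega> in M. X (s + h) \<omega> = j \<bar> X s \<omega> = i \<and> (\<forall>u\<in>T. X u \<omega> = f u)) = P h i j)"

text \<open>
  The death rate in state \<open>0\<close> is ignored by the third clause below but enters the last one, so
  \<open>\<delta> 0 = 0\<close> is required.  That jumps to non-adjacent states have probability \<open>o(h)\<close> follows
  from these clauses, since the transition probabilities out of a visited state sum to \<open>1\<close>.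
\<close>

definition birth_death_process ::
    "(nat \<Rightarrow> real) \<Rightarrow> (nat \<Rightarrow> real) \<Rightarrow> 'a measure \<Rightarrow> (real \<Rightarrow> 'a \<Rightarrow> nat) \<Rightarrow> bool" where
  "birth_death_process \<beta> \<delta> M X \<longleftrightarrow>
     \<delta> 0 = 0 \<and>
     (\<exists>P. homogeneous_markov_process M X P \<and>
        (\<forall>i. (\<lambda>h. P h i (Suc i) - \<beta> i * h) \<in> o[at_right 0](\<lambda>h. h)) \<and>
        (\<forall>i. (\<lambda>h. P h (Suc i) i - \<delta> (Suc i) * h) \<in> o[at_right 0](\<lambda>h. h)) \<and>
        (\<forall>i. (\<lambda>h. P h i i - (1 - (\<beta> i + \<delta> i) * h)) \<in> o[at_right 0](\<lambda>h. h)))"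

definition erlang_A_death_rate :: "nat \<Rightarrow> real \<Rightarrow> nat \<Rightarrow> real" where
  "erlang_A_death_rate m \<eta> n = (if n \<le> m then real n else real m + (real n - real m) * \<eta>)"

definition erlang_A_process ::
    "nat \<Rightarrow> real \<Rightarrow> real \<Rightarrow> 'a measure \<Rightarrow> (real \<Rightarrow> 'a \<Rightarrow> nat) \<Rightarrow> bool" where
  "erlang_A_process m \<rho> \<eta> M N \<longleftrightarrow>
     birth_death_process (\<lambda>n. \<rho>) (erlang_A_death_rate m \<eta>) M N"

definition transition_prob :: "'a measure \<Rightarrow> (real \<Rightarrow> 'a \<Rightarrow> nat) \<Rightarrow> nat \<Rightarrow> nat \<Rightarrow> real \<Rightarrow> real" where
  "transition_prob M N n\<^sub>0 n t = \<P>(\<omega> in M. N t \<omega> = n \<bar> N 0 \<omega> = n\<^sub>0)"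

definition laplace_transform :: "(real \<Rightarrow> real) \<Rightarrow> complex \<Rightarrow> complex" where
  "laplace_transform f \<theta> =
     (LINT t:{0..}|lborel. exp (- \<theta> * complex_of_real t) * complex_of_real (f t))"


section \<open>Contours from \<open>-\<infinity> - i\<epsilon>\<close> to \<open>-\<infinity> + i\<epsilon>\<close>\<close>

text \<open>
  Such an infinite contour is represented by a path \<open>g\<close> from \<open>-a - i\<epsilon>\<close> to \<open>-a + i\<epsilon>\<close> with
  \<open>a, \<epsilon> > 0\<close>, understood to be extended by the two horizontal half-lines running to the left.
  It has to avoid the set \<open>S\<close> and to encircle the point \<open>w\<close> once counterclockwise; since both
  half-lines lie to the left of \<open>g\<close>'s end points, winding is measured after closing \<open>g\<close> by the
  vertical segment, for points \<open>w\<close> with nonnegative real part.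
\<close>

definition hankel_contour :: "complex set \<Rightarrow> complex \<Rightarrow> (real \<Rightarrow> complex) \<Rightarrow> bool" where
  "hankel_contour S w g \<longleftrightarrow>
     valid_path g \<and>
     Re (pathstart g) < 0 \<and> Im (pathstart g) < 0 \<and> pathfinish g = cnj (pathstart g) \<and>
     path_image g \<inter> S = {} \<and>
     winding_number (g +++ linepath (pathfinish g) (pathstart g)) w = 1"

definition hankel_integral :: "(real \<Rightarrow> complex) \<Rightarrow> (complex \<Rightarrow> complex) \<Rightarrow> complex" where
  "hankel_integral g f =
     (LINT x:{..Re (pathstart g)}|lborel. f (Complex x (Im (pathstart g))))
     + contour_integral g f
     - (LINT x:{..Re (pathfinish g)}|lborel. f (Complex x (Im (pathfinish g))))"

definition contour_C1 :: "(real \<Rightarrow> complex) \<Rightarrow> bool" where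
  "contour_C1 = hankel_contour {z. Im z = 0 \<and> Re z \<le> 1} 1"

definition contour_C2 :: "(real \<Rightarrow> complex) \<Rightarrow> bool" where
  "contour_C2 = hankel_contour ({z. Im z = 0 \<and> Re z \<le> 0} \<union> {z. Im z = 0 \<and> Re z \<ge> 1}) 0"


section \<open>The special functions\<close>

text \<open>
  The complex \<open>powr\<close> is the principal branch, with argument in \<open>]-\<pi>, \<pi>]\<close>; its cuts are avoided
  by the contours.
\<close>

definition erlang_F :: "real \<Rightarrow> real \<Rightarrow> int \<Rightarrow> complex \<Rightarrow> complex" where
  "erlang_F r \<rho> n \<theta> = 1 / (2 * of_real pi * \<i>) *
     contour_integral (circlepath 0 r)
       (\<lambda>z. exp (of_real \<rho> * z) / (z powi (n + 1) * (1 - z) powr \<theta>))"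

definition erlang_H ::
    "(real \<Rightarrow> complex) \<Rightarrow> real \<Rightarrow> real \<Rightarrow> nat \<Rightarrow> int \<Rightarrow> complex \<Rightarrow> complex" where
  "erlang_H g \<rho> \<eta> m n \<theta> = 1 / (2 * of_real pi * \<i>) *
     hankel_integral g
       (\<lambda>z. exp (of_real \<rho> * z / of_real \<eta>) /
            ((z - 1) powr (\<theta> / of_real \<eta>) * z powi (n + 1 - int m)
              * z powr of_real (real m / \<eta>)))"

definition erlang_I ::
    "(real \<Rightarrow> complex) \<Rightarrow> real \<Rightarrow> real \<Rightarrow> nat \<Rightarrow> int \<Rightarrow> complex \<Rightarrow> complex" where
  "erlang_I g \<rho> \<eta> m n \<theta> = 1 / (2 * of_real pi * \<i>) *
     hankel_integral g
       (\<lambda>z. exp (of_real \<rho> * z / of_real \<eta>) /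
            ((1 - z) powr (\<theta> / of_real \<eta>) * z powi (n + 1 - int m)
              * z powr of_real (real m / \<eta>)))"

end

theory Submission
  imports Defs "HOL-Real_Asymp.Real_Asymp"
begin

text \<open>
  The Laplace transforms \<open>R i j\<close> of the transition probabilities satisfy the backward equation
  \<open>(\<theta> + \<rho> + \<delta> i) R i j = \<rho> R (i + 1) j + \<delta> i R (i - 1) j + [i = j]\<close>, which (unlike the forward
  equation) follows from the infinitesimal conditions with an error that is uniform in time.
  Because the birth rate is constant, it has only one bounded solution, and summation by parts
  shows that \<open>R\<close> is symmetric with respect to the reversing weights.  So the row \<open>R n\<^sub>0\<close> is the
  solution of the forward equation, with source at \<open>n\<^sub>0\<close>, that is bounded relative to the weights.

  With \<open>a = \<theta> / \<eta>\<close>, \<open>x = \<rho> / \<eta>\<close> and \<open>b = n - m + 1 + m / \<eta>\<close>, the Hankel integrals are evaluated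
  by means of \<open>1 / \<Gamma>(s) = 1 / (2 \<pi> i) \<integral> exp z z powr (- s) dz\<close>: \<open>H n\<close> is a confluent hypergeometric
  series of the first kind (expand the integrand for large \<open>\<bar>z\<bar>\<close>) and \<open>I n\<close> is the Laplace-type
  integral of the second kind (write \<open>(1 - z) powr (- a)\<close> as a Gamma integral).  These satisfy the
  forward recurrence, \<open>H\<close> is bounded relative to the weights, and their Casoratian, which is a
  Wronskian in \<open>x\<close>, gives the normalising constant.
\<close>

section \<open>Integration on the line\<close>

text \<open>Conditioning on the first short interval involves only the jump probabilities out of the
  single state \<open>i\<close>, so their errors do not see the remaining time. The forward equation
  would need errors that are uniform over the states, whereas the o(h) conditions are imposed state
  by state. Uniqueness also gives the nonvanishing of the denominator: if it were zero,
  \<open>F\<close> and \<open>H\<close> would glue to a nonzero source-free solution that is bounded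
  relative to the weights. The parameter b is chosen so that the death rate in state n + 1 is \<eta>
  b for all n \<ge> m - 1. Division by \<eta> turns the recurrence of both \<open>H\<close> and
  \<open>I\<close> into (a + b - 1 + x) u(b) = x u(b - 1) + b u(b + 1). The prefactor is the
  reciprocal of the death rate in state \<open>n\<^sub>0 + 1\<close> times the Casoratian at
  \<open>n\<^sub>0\<close>, that is, of \<eta> b x^(a+b-1) e^x / (\<Gamma>(a) \<Gamma>(b+1)); this
  is the origin of the two Gamma factors, of e^(-\<rho>/\<eta>) and of the power of \<eta>/\<rho>.
  Below \<open>m\<close> only a ratio of two Casoratians survives, in which everything depending on
  \<theta> cancels.\<close>

lemma set_integrable_continuous_bound:
  fixes f :: "real \<Rightarrow> 'b :: {banach, second_countable_topology}"
  assumes "continuous_on S f" "S \<in> sets borel" "set_integrable lborel S w"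
    and "\<And>x. x \<in> S \<Longrightarrow> norm (f x) \<le> (w x :: real)"
  shows "set_integrable lborel S f"
proof (rule set_integrable_bound[OF assms(3)])
  show "set_borel_measurable lborel S f"
    unfolding set_borel_measurable_def using borel_measurable_continuous_on_indicator[OF assms(2,1)] by simp
  show "AE x in lborel. x \<in> S \<longrightarrow> norm (f x) \<le> norm (w x)"
    using assms(4) by (auto intro!: AE_I2) (meson abs_ge_self order_trans)
qed

lemma set_integrable_exp_Ici:
  assumes "a > 0" shows "set_integrable lborel {c..} (\<lambda>x::real. exp (- a * x))"
proof -
  have "(\<lambda>x. exp (- a * x)) absolutely_integrable_on {c..}"
    using integrable_on_exp_minus_to_infinity[OF assms, of c]
    by (intro nonnegative_absolutely_integrable_1) auto
  thus ?thesis unfolding set_integrable_def by (subst (asm) integrable_completion) auto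
qed

lemma set_integrable_exp_Iic:
  assumes "a > 0" shows "set_integrable lborel {..c} (\<lambda>x::real. exp (a * x))"
proof -
  have "integrable lborel (\<lambda>x. indicator {-c..} (0 + (-1) * x) *\<^sub>R exp (- a * (0 + (-1) * x)))"
    using set_integrable_exp_Ici[OF assms, of "-c"] unfolding set_integrable_def
    by (rule lborel_integrable_real_affine) auto
  also have "(\<lambda>x. indicator {-c..} (0 + (-1) * x) *\<^sub>R exp (- a * (0 + (-1) * x))) = (\<lambda>x. indicator {..c} x *\<^sub>R exp (a * x))"
    by (auto simp: fun_eq_iff indicator_def)
  finally show ?thesis unfolding set_integrable_def .
qed

lemma set_integral_dominated_convergence:
  fixes u :: "nat \<Rightarrow> real \<Rightarrow> 'b :: {banach, second_countable_topology}"
  assumes S: "S \<in> sets borel" and u: "\<And>n. continuous_on S (u n)" and l: "continuous_on S l"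
    and w: "set_integrable lborel S w"
    and lim: "\<And>x. x \<in> S \<Longrightarrow> (\<lambda>n. u n x) \<longlonglongrightarrow> l x"
    and bd: "\<And>n x. x \<in> S \<Longrightarrow> norm (u n x) \<le> (w x :: real)"
  shows "(\<lambda>n. LINT x:S|lborel. u n x) \<longlonglongrightarrow> (LINT x:S|lborel. l x)"
  unfolding set_lebesgue_integral_def
proof (rule integral_dominated_convergence[where w = "\<lambda>x. indicator S x *\<^sub>R w x"])
  show "(\<lambda>x. indicator S x *\<^sub>R l x) \<in> borel_measurable lborel"
    using borel_measurable_continuous_on_indicator[OF S l] by simp
  show "(\<lambda>x. indicator S x *\<^sub>R u n x) \<in> borel_measurable lborel" for n
    using borel_measurable_continuous_on_indicator[OF S u] by simp
  show "integrable lborel (\<lambda>x. indicator S x *\<^sub>R w x)"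
    using w unfolding set_integrable_def .
  show "AE x in lborel. (\<lambda>n. indicat_real S x *\<^sub>R u n x) \<longlonglongrightarrow> indicat_real S x *\<^sub>R l x"
    using lim by (intro AE_I2) (auto simp: indicator_def)
  show "AE x in lborel. norm (indicat_real S x *\<^sub>R u n x) \<le> indicat_real S x *\<^sub>R w x" for n
    using bd by (intro AE_I2) (auto simp: indicator_def)
qed

lemma Gamma_set_integral:
  assumes "Re z > 0"
  shows "set_integrable lborel {0<..} (\<lambda>t. of_real t powr (z - 1) * exp (- complex_of_real t))"
    and "(LINT t:{0<..}|lborel. of_real t powr (z - 1) * exp (- complex_of_real t)) = Gamma z"
proof -
  have eq: "complex_of_real t powr (z - 1) / of_real (exp t) = of_real t powr (z - 1) * exp (- complex_of_real t)" for t
    by (simp add: exp_minus field_simps exp_of_real)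
  have c: "continuous_on {0<..} (\<lambda>t. complex_of_real t powr (z - 1) * exp (- complex_of_real t))"
    by (intro continuous_intros) (auto simp: complex_nonpos_Reals_iff)
  have m: "(\<lambda>t. indicator {0<..} t *\<^sub>R (complex_of_real t powr (z - 1) * exp (- complex_of_real t))) \<in> borel_measurable lborel"
    using borel_measurable_continuous_on_indicator[OF _ c] by simp
  have "(\<lambda>t. complex_of_real t powr (z - 1) * exp (- complex_of_real t)) absolutely_integrable_on {0<..}"
    using absolutely_integrable_Gamma_integral'[OF assms] by (simp add: eq)
  \<comment> \<open>Borel measurability, recorded in \<open>m\<close>, permits the passage from the
    completed measure to \<open>lborel\<close>.\<close>
  thus i: "set_integrable lborel {0<..} (\<lambda>t. of_real t powr (z - 1) * exp (- complex_of_real t))"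
    unfolding set_integrable_def by (subst (asm) integrable_completion[OF m])
  show "(LINT t:{0<..}|lborel. of_real t powr (z - 1) * exp (- complex_of_real t)) = Gamma z"
    using Gamma_integral_complex'[OF assms] set_borel_integral_eq_integral(2)[OF i] by (simp add: eq integral_unique)
qed

text \<open>The majorant factors into a summable sequence and an integrable function, so the
  integrals of the norms are summable and summation commutes with integration.\<close>

lemma set_integral_sums:
  fixes f :: "nat \<Rightarrow> real \<Rightarrow> 'b :: {banach, second_countable_topology}"
  assumes S: "S \<in> sets borel" and f: "\<And>k. continuous_on S (f k)"
    and w: "set_integrable lborel S w" and B: "summable B"
    and bd: "\<And>k x. x \<in> S \<Longrightarrow> norm (f k x) \<le> B k * (w x :: real)"
    and F: "\<And>x. x \<in> S \<Longrightarrow> (\<lambda>k. f k x) sums F x"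
  shows "(\<lambda>k. LINT x:S|lborel. f k x) sums (LINT x:S|lborel. F x)"
proof -
  have int: "set_integrable lborel S (f k)" for k
    by (rule set_integrable_continuous_bound[OF f S set_integrable_mult_right[OF w] bd])
  have "(\<lambda>k. LINT x|lborel. indicator S x *\<^sub>R f k x) sums (LINT x|lborel. (\<Sum>k. indicator S x *\<^sub>R f k x))"
  proof (rule sums_integral)
    show "integrable lborel (\<lambda>x. indicator S x *\<^sub>R f k x)" for k using int unfolding set_integrable_def .
    show "AE x in lborel. summable (\<lambda>k. norm (indicat_real S x *\<^sub>R f k x))"
    proof (rule AE_I2)
      fix x
      show "summable (\<lambda>k. norm (indicat_real S x *\<^sub>R f k x))"
        using bd[of x] summable_mult2[OF B, of "w x"]
        by (cases "x \<in> S") (auto intro!: summable_comparison_test'[where N = 0 and g = "\<lambda>k. B k * w x"])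
    qed
    show "summable (\<lambda>k. LINT x|lborel. norm (indicat_real S x *\<^sub>R f k x))"
    proof (rule summable_comparison_test'[where N = 0])
      show "summable (\<lambda>k. B k * (LINT x:S|lborel. w x))" by (rule summable_mult2[OF B])
      fix k
      have "(LINT x|lborel. norm (indicat_real S x *\<^sub>R f k x)) = (LINT x:S|lborel. norm (f k x))"
        unfolding set_lebesgue_integral_def by (intro Bochner_Integration.integral_cong) (auto simp: indicator_def)
      also have "\<dots> \<le> (LINT x:S|lborel. B k * w x)"
        by (intro set_integral_mono set_integrable_norm int set_integrable_mult_right w bd)
      also have "\<dots> = B k * (LINT x:S|lborel. w x)" by (rule set_integral_mult_right)
      finally show "norm (LINT x|lborel. norm (indicat_real S x *\<^sub>R f k x)) \<le> B k * (LINT x:S|lborel. w x)"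
        by simp
    qed
  qed
  also have "(LINT x|lborel. (\<Sum>k. indicator S x *\<^sub>R f k x)) = (LINT x:S|lborel. F x)"
    unfolding set_lebesgue_integral_def using F
    by (intro Bochner_Integration.integral_cong) (auto simp: indicator_def sums_iff)
  finally show ?thesis unfolding set_lebesgue_integral_def .
qed

section \<open>Laplace transforms of birth-death transition probabilities\<close>

text \<open>\<open>f\<close> need not be differentiable. The transform of \<open>f (h + t)\<close>
  in \<open>t\<close> is an explicit function \<open>q h\<close>, whose difference quotient at 0 is
  evaluated twice: from the estimate uniform in \<open>t\<close>, which survives integration against
  the exponential, and by differentiating \<open>q\<close>.\<close>

lemma laplace_transform_derivative:
  fixes f G e :: "real \<Rightarrow> real"
  assumes cont: "continuous_on {0..} f" "continuous_on {0..} G"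
    and bdd: "\<And>t. t \<ge> 0 \<Longrightarrow> \<bar>f t\<bar> \<le> B" "\<And>t. t \<ge> 0 \<Longrightarrow> \<bar>G t\<bar> \<le> K"
    and e: "e \<in> o[at_right 0](\<lambda>h. h)"
    and est: "\<And>h t. h > 0 \<Longrightarrow> t \<ge> 0 \<Longrightarrow> \<bar>f (h + t) - f t - h * G t\<bar> \<le> e h"
    and theta: "Re \<theta> > 0"
  shows "\<theta> * laplace_transform f \<theta> - of_real (f 0) = laplace_transform G \<theta>"
proof -
  define E where "E = (\<lambda>t::real. exp (- \<theta> * complex_of_real t))"
  have normE: "norm (E t) = exp (- Re \<theta> * t)" for t by (simp add: E_def)
  have contE: "continuous_on S E" for S unfolding E_def by (intro continuous_intros)
  have int: "set_integrable lborel {0..} (\<lambda>t. E t * complex_of_real (g t))"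
    if "continuous_on {0..} g" "\<And>t. t \<ge> 0 \<Longrightarrow> \<bar>g t\<bar> \<le> D" for g :: "real \<Rightarrow> real" and D
  proof (rule set_integrable_continuous_bound[where w = "\<lambda>t. D * exp (- Re \<theta> * t)"])
    show "continuous_on {0..} (\<lambda>t. E t * complex_of_real (g t))"
      using that contE by (intro continuous_intros)
    show "set_integrable lborel {0..} (\<lambda>t. D * exp (- Re \<theta> * t))"
      using set_integrable_exp_Ici[OF theta] by (intro set_integrable_mult_right)
    show "norm (E t * complex_of_real (g t)) \<le> D * exp (- Re \<theta> * t)" if "t \<in> {0..}" for t
      using that \<open>\<And>t. t \<ge> 0 \<Longrightarrow> \<bar>g t\<bar> \<le> D\<close>[of t] by (simp add: norm_mult normE mult.commute mult_right_mono)
  qed simp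
  note intf = int[OF cont(1) bdd(1)] and intG = int[OF cont(2) bdd(2)]
  define L where "L = laplace_transform f \<theta>"
  define LG where "LG = laplace_transform G \<theta>"
  have L: "L = (LINT t:{0..}|lborel. E t * complex_of_real (f t))" and LG: "LG = (LINT t:{0..}|lborel. E t * complex_of_real (G t))"
    by (simp_all add: L_def LG_def laplace_transform_def E_def)
  \<comment> \<open>The substitution of \<open>t - h\<close> for \<open>t\<close> in the transform
    of the shifted function leads to this expression; it is differentiable at 0 because
    \<open>f\<close> is continuous.\<close>
  define q where "q = (\<lambda>h::real. exp (\<theta> * of_real h) * (L - integral {0..h} (\<lambda>t. E t * complex_of_real (f t))))"
  have shift: "(LINT t:{0..}|lborel. E t * complex_of_real (f (h + t))) = q h"
    and int_shift: "set_integrable lborel {0..} (\<lambda>t. E t * complex_of_real (f (h + t)))"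
    if h: "h > 0" for h
  proof -
    have c: "continuous_on {0..} (\<lambda>t. f (h + t))"
      by (rule continuous_on_compose2[OF cont(1)]) (use h in \<open>auto intro!: continuous_intros\<close>)
    show "set_integrable lborel {0..} (\<lambda>t. E t * complex_of_real (f (h + t)))"
      by (rule int[OF c, of B]) (use h bdd(1) in auto)
    have i2: "set_integrable lborel {0..h} (\<lambda>t. E t * complex_of_real (f t))"
      by (rule set_integrable_subset[OF intf]) auto
    have i3: "set_integrable lborel {h<..} (\<lambda>t. E t * complex_of_real (f t))"
      by (rule set_integrable_subset[OF intf]) (use h in auto)
    have "L = (LINT t:{0..h} \<union> {h<..}|lborel. E t * complex_of_real (f t))"
      unfolding L using h by (intro arg_cong2[where f = "\<lambda>A. set_lebesgue_integral lborel A"]) auto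
    also have "\<dots> = (LINT t:{0..h}|lborel. E t * complex_of_real (f t)) + (LINT t:{h<..}|lborel. E t * complex_of_real (f t))"
      by (rule set_integral_Un[OF _ i2 i3]) auto
    also have "(LINT t:{0..h}|lborel. E t * complex_of_real (f t)) = integral {0..h} (\<lambda>t. E t * complex_of_real (f t))"
      by (rule set_borel_integral_eq_integral(2)[OF i2])
    also have "(LINT t:{h<..}|lborel. E t * complex_of_real (f t)) = (LINT t|lborel. indicator {h<..} (h + 1 * t) *\<^sub>R (E (h + 1 * t) * complex_of_real (f (h + 1 * t))))"
      unfolding set_lebesgue_integral_def by (subst lborel_integral_real_affine[where c = 1 and t = h]) auto
    also have "\<dots> = (LINT t:{0<..}|lborel. exp (- \<theta> * of_real h) * (E t * complex_of_real (f (h + t))))"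
      unfolding set_lebesgue_integral_def
      by (intro Bochner_Integration.integral_cong) (auto simp: indicator_def E_def exp_add[symmetric] algebra_simps)
    also have "\<dots> = (LINT t:{0..}|lborel. exp (- \<theta> * of_real h) * (E t * complex_of_real (f (h + t))))"
      by (rule set_integral_discrete_difference[where X = "{0}"]) auto
    also have "\<dots> = exp (- \<theta> * of_real h) * (LINT t:{0..}|lborel. E t * complex_of_real (f (h + t)))"
      by (rule set_integral_mult_right)
    finally have "L - integral {0..h} (\<lambda>t. E t * complex_of_real (f t)) = exp (- \<theta> * of_real h) * (LINT t:{0..}|lborel. E t * complex_of_real (f (h + t)))"
      by simp
    thus "(LINT t:{0..}|lborel. E t * complex_of_real (f (h + t))) = q h"
      unfolding q_def by (simp add: mult.assoc[symmetric] exp_add[symmetric] exp_minus field_simps)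
  qed
  have q0: "q 0 = L" by (simp add: q_def)
  define I0 where "I0 = (LINT t:{0..}|lborel. exp (- Re \<theta> * t))"
  have bound: "norm ((q h - q 0) /\<^sub>R h - LG) \<le> e h / h * I0" if h: "h > 0" for h
  proof -
    have "(q h - q 0) - of_real h * LG = (LINT t:{0..}|lborel. E t * complex_of_real (f (h + t)) - E t * complex_of_real (f t) - of_real h * (E t * complex_of_real (G t)))"
      unfolding shift[OF h, symmetric] q0 L LG
      using int_shift[OF h] intf intG by (subst set_integral_mult_right[symmetric], subst set_integral_diff(2)[symmetric], simp, simp, subst set_integral_diff(2)[symmetric]) auto
    also have "norm \<dots> \<le> (LINT t:{0..}|lborel. norm (E t * complex_of_real (f (h + t)) - E t * complex_of_real (f t) - of_real h * (E t * complex_of_real (G t))))"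
      using int_shift[OF h] intf intG by (intro set_integral_norm_bound set_integral_diff set_integrable_mult_right)
    also have "\<dots> \<le> (LINT t:{0..}|lborel. e h * exp (- Re \<theta> * t))"
    proof (rule set_integral_mono)
      show "set_integrable lborel {0..} (\<lambda>t. norm (E t * complex_of_real (f (h + t)) - E t * complex_of_real (f t) - of_real h * (E t * complex_of_real (G t))))"
        using int_shift[OF h] intf intG by (intro set_integrable_norm set_integral_diff set_integrable_mult_right)
      show "set_integrable lborel {0..} (\<lambda>t. e h * exp (- Re \<theta> * t))"
        using set_integrable_exp_Ici[OF theta] by (intro set_integrable_mult_right)
      show "norm (E t * complex_of_real (f (h + t)) - E t * complex_of_real (f t) - of_real h * (E t * complex_of_real (G t))) \<le> e h * exp (- Re \<theta> * t)"
        if "t \<in> {0..}" for t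
      proof -
        have "E t * complex_of_real (f (h + t)) - E t * complex_of_real (f t) - of_real h * (E t * complex_of_real (G t)) = E t * complex_of_real (f (h + t) - f t - h * G t)"
          by (simp add: algebra_simps)
        also have "norm \<dots> = exp (- Re \<theta> * t) * \<bar>f (h + t) - f t - h * G t\<bar>"
          by (simp add: norm_mult normE del: of_real_diff of_real_mult)
        also have "\<dots> \<le> exp (- Re \<theta> * t) * e h"
          using est[OF h, of t] that by (intro mult_left_mono) auto
        finally show ?thesis by (simp add: mult.commute)
      qed
    qed
    also have "\<dots> = e h * I0" by (simp add: I0_def)
    finally have *: "norm ((q h - q 0) - of_real h * LG) \<le> e h * I0" .
    have "(q h - q 0) /\<^sub>R h - LG = ((q h - q 0) - of_real h * LG) /\<^sub>R h"
      using h by (simp add: scaleR_conv_of_real field_simps)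
    hence "norm ((q h - q 0) /\<^sub>R h - LG) = norm ((q h - q 0) - of_real h * LG) / h"
      using h by (simp add: divide_inverse_commute)
    also have "\<dots> \<le> e h * I0 / h" using * h by (intro divide_right_mono) auto
    finally show ?thesis by simp
  qed
  have "((\<lambda>h. (q h - q 0) /\<^sub>R h) \<longlongrightarrow> LG) (at_right 0)"
  proof (rule LIM_zero_cancel, rule Lim_null_comparison)
    show "\<forall>\<^sub>F h in at_right 0. norm ((q h - q 0) /\<^sub>R h - LG) \<le> e h / h * I0"
      using bound by (auto simp: eventually_at_filter)
    have "((\<lambda>h. e h / h) \<longlongrightarrow> 0) (at_right 0)" by (rule smalloD_tendsto[OF e])
    thus "((\<lambda>h. e h / h * I0) \<longlongrightarrow> 0) (at_right 0)" by (rule tendsto_mult_left_zero)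
  qed
  moreover have "((\<lambda>h. (q h - q 0) /\<^sub>R h) \<longlongrightarrow> \<theta> * L - of_real (f 0)) (at_right 0)"
  proof -
    have c: "continuous_on {0..1} (\<lambda>t. E t * complex_of_real (f t))"
      using contE continuous_on_subset[OF cont(1), of "{0..1}"] by (intro continuous_intros) auto
    have d1: "((\<lambda>h. integral {0..h} (\<lambda>t. E t * complex_of_real (f t))) has_vector_derivative (E 0 * complex_of_real (f 0))) (at 0 within {0..1})"
      by (rule integral_has_vector_derivative[OF c]) auto
    have d2: "((\<lambda>h::real. exp (\<theta> * of_real h)) has_vector_derivative \<theta>) (at 0 within {0..1})"
      by (rule has_vector_derivative_eq_rhs, rule has_vector_derivative_real_field) (auto intro!: derivative_eq_intros)
    have "(q has_vector_derivative \<theta> * L - of_real (f 0)) (at 0 within {0..1})"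
      unfolding q_def
      by (rule has_vector_derivative_eq_rhs, rule has_vector_derivative_mult[OF d2 has_vector_derivative_diff[OF has_vector_derivative_const d1]])
         (simp add: E_def)
    hence "((\<lambda>h. (q h - q 0) /\<^sub>R h) \<longlongrightarrow> \<theta> * L - of_real (f 0)) (at 0 within {0..1})"
      unfolding has_vector_derivative_def has_derivative_within
    proof -
      assume "bounded_linear (\<lambda>x. x *\<^sub>R (\<theta> * L - of_real (f 0))) \<and>
        ((\<lambda>y. (1 / norm (y - 0)) *\<^sub>R (q y - (q 0 + (y - 0) *\<^sub>R (\<theta> * L - of_real (f 0))))) \<longlongrightarrow> 0) (at 0 within {0..1})"
      hence "((\<lambda>y. (1 / norm (y - 0)) *\<^sub>R (q y - (q 0 + (y - 0) *\<^sub>R (\<theta> * L - of_real (f 0))))) \<longlongrightarrow> 0) (at 0 within {0..1})" by blast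
      hence "((\<lambda>y. (q y - q 0) /\<^sub>R y - (\<theta> * L - of_real (f 0))) \<longlongrightarrow> 0) (at 0 within {0..1})"
        by (rule Lim_transform_eventually)
           (auto simp: eventually_at_filter scaleR_conv_of_real field_simps)
      thus ?thesis by (rule LIM_zero_cancel)
    qed
    thus ?thesis by (rule filterlim_mono) (auto simp: at_within_Icc_at_right)
  qed
  ultimately have "\<theta> * L - of_real (f 0) = LG"
    by (intro tendsto_unique[of "at_right (0::real)"]) auto
  thus ?thesis by (simp add: L_def LG_def)
qed

section \<open>Markov chains: transition probabilities out of visited states\<close>

locale markov_chain = prob_space M for M :: "'a measure" +
  fixes X :: "real \<Rightarrow> 'a \<Rightarrow> nat" and P :: "real \<Rightarrow> nat \<Rightarrow> nat \<Rightarrow> real"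
  assumes hmp: "homogeneous_markov_process M X P"
begin

text \<open>\<open>P\<close> is arbitrary in all other states, so each fact about a row of
  \<open>P\<close> is guarded by this predicate; \<open>visited_step\<close> carries it along
  jumps.\<close>

definition visited :: "nat \<Rightarrow> bool" where
  "visited i \<longleftrightarrow> (\<exists>s\<ge>0. prob {\<omega> \<in> space M. X s \<omega> = i} > 0)"

lemma X_measurable [measurable]: "t \<ge> 0 \<Longrightarrow> X t \<in> measurable M (count_space UNIV)"
  using hmp by (simp add: homogeneous_markov_process_def)

lemma event [measurable]: "t \<ge> 0 \<Longrightarrow> {\<omega> \<in> space M. X t \<omega> = i} \<in> events"
  by measurable

lemma markov_property:
  assumes "s \<ge> 0" "h \<ge> 0" "finite T" "T \<subseteq> {0..<s}"
    and "prob {\<omega> \<in> space M. X s \<omega> = i \<and> (\<forall>u\<in>T. X u \<omega> = f u)} > 0"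
  shows "prob {\<omega> \<in> space M. X (s + h) \<omega> = j \<and> X s \<omega> = i \<and> (\<forall>u\<in>T. X u \<omega> = f u)} =
    prob {\<omega> \<in> space M. X s \<omega> = i \<and> (\<forall>u\<in>T. X u \<omega> = f u)} * P h i j"
proof -
  have "cond_prob M (\<lambda>\<omega>. X (s + h) \<omega> = j) (\<lambda>\<omega>. X s \<omega> = i \<and> (\<forall>u\<in>T. X u \<omega> = f u)) = P h i j"
    using hmp assms unfolding homogeneous_markov_process_def by blast
  thus ?thesis using assms(5) by (simp add: cond_prob_def field_simps)
qed

lemma joint1:
  assumes "s \<ge> 0" "h \<ge> 0" "prob {\<omega> \<in> space M. X s \<omega> = i} > 0"
  shows "prob {\<omega> \<in> space M. X (s + h) \<omega> = j \<and> X s \<omega> = i} = prob {\<omega> \<in> space M. X s \<omega> = i} * P h i j"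
  using markov_property[of s h "{}" i] assms by simp

text \<open>One earlier time suffices for the Chapman-Kolmogorov equation. It has to be strictly
  earlier, since the past in the Markov property ranges over \<open>{0..<s}\<close>.\<close>

lemma joint2:
  assumes "0 \<le> u" "u < s" "h \<ge> 0" "prob {\<omega> \<in> space M. X s \<omega> = k \<and> X u \<omega> = i} > 0"
  shows "prob {\<omega> \<in> space M. X (s + h) \<omega> = j \<and> X s \<omega> = k \<and> X u \<omega> = i} =
    prob {\<omega> \<in> space M. X s \<omega> = k \<and> X u \<omega> = i} * P h k j"
  using markov_property[of s h "{u}" k "\<lambda>_. i"] assms by simp

lemma visited_step:
  assumes "visited i" "h \<ge> 0" "P h i k > 0"
  shows "visited k"
proof -
  obtain s where s: "s \<ge> 0" "prob {\<omega> \<in> space M. X s \<omega> = i} > 0" using assms(1) by (auto simp: visited_def)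
  have "0 < prob {\<omega> \<in> space M. X s \<omega> = i} * P h i k" using s assms by simp
  also have "\<dots> = prob {\<omega> \<in> space M. X (s + h) \<omega> = k \<and> X s \<omega> = i}"
    using joint1[OF s(1) assms(2) s(2)] by simp
  also have "\<dots> \<le> prob {\<omega> \<in> space M. X (s + h) \<omega> = k}"
    using s assms by (intro finite_measure_mono event) auto
  finally show ?thesis using s assms unfolding visited_def by (intro exI[of _ "s + h"]) auto
qed

lemma P_nonneg:
  assumes "visited i" "h \<ge> 0" shows "P h i j \<ge> 0"
proof -
  obtain s where s: "s \<ge> 0" "prob {\<omega> \<in> space M. X s \<omega> = i} > 0" using assms(1) by (auto simp: visited_def)
  have "0 \<le> prob {\<omega> \<in> space M. X s \<omega> = i} * P h i j"
    unfolding joint1[OF s(1) assms(2) s(2), symmetric] by simp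
  thus ?thesis using s by (simp add: zero_le_mult_iff)
qed

lemma P_sums:
  assumes "visited i" "h \<ge> 0" shows "(\<lambda>j. P h i j) sums 1"
proof -
  obtain s where s: "s \<ge> 0" "prob {\<omega> \<in> space M. X s \<omega> = i} > 0" using assms(1) by (auto simp: visited_def)
  define A where "A = (\<lambda>j. {\<omega> \<in> space M. X (s + h) \<omega> = j \<and> X s \<omega> = i})"
  have [measurable]: "X s \<in> measurable M (count_space UNIV)" "X (s + h) \<in> measurable M (count_space UNIV)"
    using s assms by (auto intro!: X_measurable)
  have mA: "A j \<in> events" for j unfolding A_def by measurable
  have "(\<lambda>j. prob (A j)) sums prob (\<Union>j. A j)"
    using mA by (intro finite_measure_UNION) (auto simp: disjoint_family_on_def A_def)
  also have "(\<Union>j. A j) = {\<omega> \<in> space M. X s \<omega> = i}" by (auto simp: A_def)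
  also have "(\<lambda>j. prob (A j)) = (\<lambda>j. prob {\<omega> \<in> space M. X s \<omega> = i} * P h i j)"
    unfolding A_def using joint1[OF s(1) assms(2) s(2)] by simp
  finally have "(\<lambda>j. prob {\<omega> \<in> space M. X s \<omega> = i} * P h i j) sums (prob {\<omega> \<in> space M. X s \<omega> = i} * 1)" by simp
  thus ?thesis using s by (subst (asm) sums_mult_iff) auto
qed

lemma P_le_1:
  assumes "visited i" "h \<ge> 0" shows "P h i j \<le> 1"
  using sum_le_suminf[OF sums_summable[OF P_sums[OF assms]], of "{j}"] P_nonneg[OF assms] sums_unique[OF P_sums[OF assms]] by simp

lemma P_0:
  assumes "visited i" shows "P 0 i j = (if i = j then 1 else 0)"
proof -
  obtain s where s: "s \<ge> 0" "prob {\<omega> \<in> space M. X s \<omega> = i} > 0" using assms(1) by (auto simp: visited_def)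
  have "prob {\<omega> \<in> space M. X s \<omega> = j \<and> X s \<omega> = i} = prob {\<omega> \<in> space M. X s \<omega> = i} * P 0 i j"
    using joint1[OF s(1) order_refl s(2), of j] by simp
  moreover have "{\<omega> \<in> space M. X s \<omega> = j \<and> X s \<omega> = i} = (if i = j then {\<omega> \<in> space M. X s \<omega> = i} else {})" by auto
  ultimately show ?thesis using s by (auto split: if_splits)
qed

text \<open>The event is split by the state at the intermediate time \<open>s + h\<close>. The time
  \<open>s\<close> then plays the role of the past and must lie strictly before it, whence
  \<open>h > 0\<close>.\<close>

lemma chapman_kolmogorov:
  assumes "visited i" "h > 0" "t \<ge> 0"
  shows "(\<lambda>k. P h i k * P t k j) sums P (h + t) i j"
proof -
  obtain s where s: "s \<ge> 0" "prob {\<omega> \<in> space M. X s \<omega> = i} > 0" using assms(1) by (auto simp: visited_def)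
  define A where "A = (\<lambda>k. {\<omega> \<in> space M. X (s + h + t) \<omega> = j \<and> X (s + h) \<omega> = k \<and> X s \<omega> = i})"
  define p where "p = prob {\<omega> \<in> space M. X s \<omega> = i}"
  have [measurable]: "X s \<in> measurable M (count_space UNIV)" "X (s + h) \<in> measurable M (count_space UNIV)"
      "X (s + h + t) \<in> measurable M (count_space UNIV)"
    using s assms by (auto intro!: X_measurable)
  have mA: "A j \<in> events" for j unfolding A_def by measurable
  have "(\<lambda>k. prob (A k)) sums prob (\<Union>k. A k)"
    using mA by (intro finite_measure_UNION) (auto simp: disjoint_family_on_def A_def)
  also have "(\<Union>k. A k) = {\<omega> \<in> space M. X (s + (h + t)) \<omega> = j \<and> X s \<omega> = i}" by (auto simp: A_def add.assoc)
  also have "prob \<dots> = p * P (h + t) i j" unfolding p_def using s assms by (intro joint1) auto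
  also have "(\<lambda>k. prob (A k)) = (\<lambda>k. p * (P h i k * P t k j))"
  proof
    fix k
    have eq: "prob {\<omega> \<in> space M. X (s + h) \<omega> = k \<and> X s \<omega> = i} = p * P h i k"
      unfolding p_def using s assms by (intro joint1) auto
    show "prob (A k) = p * (P h i k * P t k j)"
    proof (cases "prob {\<omega> \<in> space M. X (s + h) \<omega> = k \<and> X s \<omega> = i} > 0")
      case True
      have "prob (A k) = prob {\<omega> \<in> space M. X (s + h) \<omega> = k \<and> X s \<omega> = i} * P t k j"
        unfolding A_def using s assms by (intro joint2[OF _ _ _ True]) auto
      thus ?thesis by (simp add: eq)
    next
      \<comment> \<open>An intermediate state of probability zero may leave \<open>P t k j\<close>
        undetermined, but then \<open>P h i k = 0\<close> and the product vanishes all the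
        same.\<close>
      case False
      hence 0: "prob {\<omega> \<in> space M. X (s + h) \<omega> = k \<and> X s \<omega> = i} = 0"
        using measure_nonneg[of M "{\<omega> \<in> space M. X (s + h) \<omega> = k \<and> X s \<omega> = i}"] by linarith
      have "prob (A k) \<le> prob {\<omega> \<in> space M. X (s + h) \<omega> = k \<and> X s \<omega> = i}"
        unfolding A_def using s assms by (intro finite_measure_mono) auto
      hence "prob (A k) = 0" using 0 measure_nonneg[of M "A k"] by linarith
      thus ?thesis using 0 eq by auto
    qed
  qed
  finally show ?thesis using s by (subst (asm) sums_mult_iff) (auto simp: p_def)
qed

end

text \<open>A positive rate forces a positive jump probability over some short time; this is how the
  neighbours of a visited state turn out to be visited.\<close>

lemma smallo_linear_pos:
  fixes f :: "real \<Rightarrow> real"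
  assumes "(\<lambda>h. f h - c * h) \<in> o[at_right 0](\<lambda>h. h)" "c > 0"
  obtains h where "h > 0" "f h > 0"
proof -
  have "\<forall>\<^sub>F h in at_right 0. norm (f h - c * h) \<le> c / 2 * norm h"
    using landau_o.smallD[OF assms(1), of "c / 2"] assms(2) by simp
  moreover have "\<forall>\<^sub>F h::real in at_right 0. h > 0" by (simp add: eventually_at_filter)
  ultimately have "\<forall>\<^sub>F h in at_right 0. h > 0 \<and> f h > 0"
  proof eventually_elim
    case (elim h)
    hence "\<bar>f h - c * h\<bar> \<le> c * h / 2" by simp
    moreover have "c * h > 0" using elim assms(2) by simp
    ultimately show ?case using elim by linarith
  qed
  from eventually_happens[OF this] show ?thesis using that by auto
qed

section \<open>The backward equation of a birth-death chain and its Laplace transform\<close>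

locale visited_birth_death = markov_chain +
  fixes \<beta> \<delta> :: "nat \<Rightarrow> real"
  assumes birth: "\<And>i. (\<lambda>h. P h i (Suc i) - \<beta> i * h) \<in> o[at_right 0](\<lambda>h. h)"
    and death: "\<And>i. (\<lambda>h. P h (Suc i) i - \<delta> (Suc i) * h) \<in> o[at_right 0](\<lambda>h. h)"
    and stay: "\<And>i. (\<lambda>h. P h i i - (1 - (\<beta> i + \<delta> i) * h)) \<in> o[at_right 0](\<lambda>h. h)"
    and delta_0: "\<delta> 0 = 0"
    and all_visited: "\<And>i. visited i"
begin

text \<open>At \<open>i = 0\<close> truncated subtraction turns \<open>u (i - 1)\<close> into
  \<open>u 0\<close>; the coefficient \<open>\<delta> 0 = 0\<close> removes this term.\<close>

definition generator :: "(nat \<Rightarrow> real) \<Rightarrow> nat \<Rightarrow> real" where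
  "generator u i = \<beta> i * u (Suc i) + \<delta> i * u (i - 1) - (\<beta> i + \<delta> i) * u i"

text \<open>The first interval, of length \<open>h\<close>, starts in the fixed state
  \<open>i\<close>, so every error comes from the row \<open>P h i\<close>. Its entries at
  \<open>i\<close> and at the neighbours of \<open>i\<close> are known up to o(h) and add up to 1 up
  to o(h). As the entries of \<open>P t\<close> lie between 0 and 1, the more distant jumps
  contribute o(h) as well, with a bound that does not involve \<open>t\<close>.\<close>

lemma kolmogorov_backward_uniform:
  "\<exists>e. e \<in> o[at_right 0](\<lambda>h. h) \<and>
    (\<forall>h t. h > 0 \<longrightarrow> t \<ge> 0 \<longrightarrow> \<bar>P (h + t) i j - P t i j - h * generator (\<lambda>k. P t k j) i\<bar> \<le> e h)"
proof -
  define d where "d = (\<lambda>h. if i = 0 then 0 else P h i (i - 1))"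
  define ea where "ea = (\<lambda>h. P h i (Suc i) - \<beta> i * h)"
  define ed where "ed = (\<lambda>h. d h - \<delta> i * h)"
  define ec where "ec = (\<lambda>h. P h i i - (1 - (\<beta> i + \<delta> i) * h))"
  \<comment> \<open>One copy of the three errors pays for the distant jumps, the other for the jumps
    to \<open>i\<close> and its neighbours.\<close>
  define e where "e = (\<lambda>h. 2 * (\<bar>ea h\<bar> + \<bar>ed h\<bar> + \<bar>ec h\<bar>))"
  have "ea \<in> o[at_right 0](\<lambda>h. h)" unfolding ea_def by (rule birth)
  moreover have "ec \<in> o[at_right 0](\<lambda>h. h)" unfolding ec_def by (rule stay)
  moreover have "ed \<in> o[at_right 0](\<lambda>h. h)"
    using death[of "i - 1"] delta_0 by (cases i) (auto simp: ed_def d_def)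
  ultimately have eo: "e \<in> o[at_right 0](\<lambda>h. h)"
    unfolding e_def by (intro landau_o.small.cmult_in_iff[THEN iffD2] sum_in_smallo) auto
  have S: "(\<Sum>k\<in>{i-1..Suc i}. g k) = (if i = 0 then 0 else g (i - 1)) + g i + g (Suc i)" for g :: "nat \<Rightarrow> real"
    by (cases i) (auto simp: atLeastAtMostSuc_conv)
  have "\<bar>P (h + t) i j - P t i j - h * generator (\<lambda>k. P t k j) i\<bar> \<le> e h" if h: "h > 0" and t: "t \<ge> 0" for h t
  proof -
    let ?S = "{i-1..Suc i}"
    define D where "D = P (h + t) i j - (\<Sum>k\<in>?S. P h i k * P t k j)"
    have s1: "(\<lambda>k. P h i k * P t k j - (if k \<in> ?S then P h i k * P t k j else 0)) sums D"
      unfolding D_def using h t by (intro sums_diff chapman_kolmogorov all_visited sums_If_finite_set) auto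
    have s2: "(\<lambda>k. P h i k - (if k \<in> ?S then P h i k else 0)) sums (1 - (\<Sum>k\<in>?S. P h i k))"
      using h t by (intro sums_diff P_sums all_visited sums_If_finite_set) auto
    have D0: "0 \<le> D"
      by (rule sums_le[OF _ sums_zero s1]) (use h t in \<open>auto intro!: mult_nonneg_nonneg P_nonneg all_visited\<close>)
    have D1: "D \<le> 1 - (\<Sum>k\<in>?S. P h i k)"
      by (rule sums_le[OF _ s1 s2]) (use h t in \<open>auto intro!: mult_left_le P_nonneg P_le_1 all_visited\<close>)
    \<comment> \<open>In the total mass of the entries near \<open>i\<close> the terms linear in
      \<open>h\<close> cancel, so the mass left for distant jumps is a pure sum of errors.\<close>
    have D1': "D \<le> - (ea h + ed h + ec h)"
      using D1 unfolding S by (auto simp: ea_def ed_def ec_def d_def algebra_simps delta_0)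
    have Dabs: "\<bar>D\<bar> \<le> \<bar>ea h\<bar> + \<bar>ed h\<bar> + \<bar>ec h\<bar>" using D0 D1' by linarith
    have pt: "\<bar>P t k j\<bar> \<le> 1" for k
      using P_nonneg[OF all_visited t, of k j] P_le_1[OF all_visited t, of k j] by simp
    have eq: "P (h + t) i j - P t i j - h * generator (\<lambda>k. P t k j) i =
        D + ea h * P t (Suc i) j + ed h * P t (i - 1) j + ec h * P t i j"
      unfolding D_def S by (auto simp: generator_def ea_def ed_def ec_def d_def algebra_simps)
    have "\<bar>ea h * P t (Suc i) j\<bar> \<le> \<bar>ea h\<bar>" "\<bar>ed h * P t (i - 1) j\<bar> \<le> \<bar>ed h\<bar>" "\<bar>ec h * P t i j\<bar> \<le> \<bar>ec h\<bar>"
      using pt by (auto simp: abs_mult intro!: mult_left_le)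
    note le = this
    have "\<bar>D + ea h * P t (Suc i) j + ed h * P t (i - 1) j + ec h * P t i j\<bar> \<le>
        \<bar>D\<bar> + \<bar>ea h * P t (Suc i) j\<bar> + \<bar>ed h * P t (i - 1) j\<bar> + \<bar>ec h * P t i j\<bar>"
      by linarith
    also have "\<dots> \<le> (\<bar>ea h\<bar> + \<bar>ed h\<bar> + \<bar>ec h\<bar>) + \<bar>ea h\<bar> + \<bar>ed h\<bar> + \<bar>ec h\<bar>"
      by (intro add_mono Dabs le)
    finally show ?thesis unfolding eq e_def by simp
  qed
  thus ?thesis using eo by blast
qed

lemma P_abs_le_1: "t \<ge> 0 \<Longrightarrow> \<bar>P t k j\<bar> \<le> 1"
  using P_nonneg[OF all_visited, of t k j] P_le_1[OF all_visited, of t k j] by simp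

lemma generator_bound:
  assumes "t \<ge> 0" shows "\<bar>generator (\<lambda>k. P t k j) i\<bar> \<le> 2 * (\<bar>\<beta> i\<bar> + \<bar>\<delta> i\<bar>)"
proof -
  have "\<bar>\<beta> i * P t (Suc i) j\<bar> \<le> \<bar>\<beta> i\<bar>" "\<bar>\<delta> i * P t (i - 1) j\<bar> \<le> \<bar>\<delta> i\<bar>"
    "\<bar>(\<beta> i + \<delta> i) * P t i j\<bar> \<le> \<bar>\<beta> i + \<delta> i\<bar>"
    using P_abs_le_1[OF assms] by (auto simp: abs_mult intro!: mult_left_le)
  note le = this
  have "\<bar>\<beta> i * P t (Suc i) j + \<delta> i * P t (i - 1) j - (\<beta> i + \<delta> i) * P t i j\<bar> \<le>
      \<bar>\<beta> i * P t (Suc i) j\<bar> + \<bar>\<delta> i * P t (i - 1) j\<bar> + \<bar>(\<beta> i + \<delta> i) * P t i j\<bar>"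
    by linarith
  also have "\<dots> \<le> \<bar>\<beta> i\<bar> + \<bar>\<delta> i\<bar> + (\<bar>\<beta> i\<bar> + \<bar>\<delta> i\<bar>)"
    by (intro add_mono le order_trans[OF le(3)] abs_triangle_ineq)
  finally show ?thesis unfolding generator_def by simp
qed

text \<open>A right increment over a time \<open>h\<close> is at most \<open>h\<close> times the
  bound of the generator plus an error that is independent of the starting time. Starting the
  increment at either of two given times yields two-sided continuity.\<close>

lemma P_continuous: "continuous_on {0..} (\<lambda>t. P t i j)"
proof -
  obtain e where e: "e \<in> o[at_right 0](\<lambda>h. h)"
    "\<And>h t. h > 0 \<Longrightarrow> t \<ge> 0 \<Longrightarrow> \<bar>P (h + t) i j - P t i j - h * generator (\<lambda>k. P t k j) i\<bar> \<le> e h"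
    using kolmogorov_backward_uniform[of i j] by blast
  define K where "K = 1 + 2 * (\<bar>\<beta> i\<bar> + \<bar>\<delta> i\<bar>)"
  have K: "K > 0" by (simp add: K_def add_pos_nonneg)
  have "\<forall>\<^sub>F h in at_right 0. norm (e h) \<le> 1 * norm h"
    using landau_o.smallD[OF e(1), of 1] by simp
  then obtain d0 where d0: "d0 > 0" "\<And>h. h > 0 \<Longrightarrow> h < d0 \<Longrightarrow> \<bar>e h\<bar> \<le> h"
    unfolding eventually_at_right_field by auto
  have lip: "\<bar>P s i j - P t i j\<bar> \<le> K * (s - t)" if "0 \<le> t" "t < s" "s - t < d0" for s t
  proof -
    define h where "h = s - t"
    have h: "h > 0" "h < d0" "s = h + t" using that by (auto simp: h_def)
    have "\<bar>h * generator (\<lambda>k. P t k j) i\<bar> \<le> h * (2 * (\<bar>\<beta> i\<bar> + \<bar>\<delta> i\<bar>))"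
      using h generator_bound[OF that(1)] by (simp add: abs_mult)
    moreover have "\<bar>e h\<bar> \<le> h" using d0 h by auto
    ultimately have "\<bar>P s i j - P t i j\<bar> \<le> h + h * (2 * (\<bar>\<beta> i\<bar> + \<bar>\<delta> i\<bar>))"
      using e(2)[OF h(1) that(1)] unfolding h(3) by linarith
    thus ?thesis by (simp add: K_def h_def algebra_simps)
  qed
  show ?thesis
    unfolding continuous_on_iff
  proof (intro ballI allI impI)
    fix t \<epsilon> :: real assume t: "t \<in> {0..}" and \<epsilon>: "\<epsilon> > 0"
    define d where "d = min d0 (\<epsilon> / K)"
    have "d > 0" using d0 \<epsilon> K by (simp add: d_def)
    moreover have "dist (P s i j) (P t i j) < \<epsilon>" if s: "s \<in> {0..}" "dist s t < d" for s
    proof -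
      have "K * \<bar>s - t\<bar> < \<epsilon>" using s(2) K by (simp add: d_def dist_real_def field_simps)
      moreover have "\<bar>P s i j - P t i j\<bar> \<le> K * \<bar>s - t\<bar>"
        using lip[of t s] lip[of s t] s t by (cases s t rule: linorder_cases) (auto simp: d_def dist_real_def abs_minus_commute)
      ultimately show ?thesis by (simp add: dist_real_def)
    qed
    ultimately show "\<exists>d>0. \<forall>s\<in>{0..}. dist s t < d \<longrightarrow> dist (P s i j) (P t i j) < \<epsilon>" by blast
  qed
qed

lemma P_laplace_integrable:
  assumes "Re \<theta> > 0"
  shows "set_integrable lborel {0..} (\<lambda>t. exp (- \<theta> * complex_of_real t) * complex_of_real (P t i j))"
proof (rule set_integrable_continuous_bound)
  show "continuous_on {0..} (\<lambda>t. exp (- \<theta> * complex_of_real t) * complex_of_real (P t i j))"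
    by (intro continuous_intros P_continuous)
  show "set_integrable lborel {0..} (\<lambda>t. exp (- Re \<theta> * t))"
    using assms by (rule set_integrable_exp_Ici)
  show "norm (exp (- \<theta> * complex_of_real t) * complex_of_real (P t i j)) \<le> exp (- Re \<theta> * t)" if "t \<in> {0..}" for t
    using P_abs_le_1[of t i j] that by (simp add: norm_mult mult_left_le)
qed simp

lemma laplace_P_bound:
  assumes "Re \<theta> > 0"
  shows "norm (laplace_transform (\<lambda>t. P t i j) \<theta>) \<le> (LINT t:{0..}|lborel. exp (- Re \<theta> * t))"
proof -
  have "norm (laplace_transform (\<lambda>t. P t i j) \<theta>) \<le> (LINT t:{0..}|lborel. norm (exp (- \<theta> * complex_of_real t) * complex_of_real (P t i j)))"
    unfolding laplace_transform_def by (intro set_integral_norm_bound P_laplace_integrable assms)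
  also have "\<dots> \<le> (LINT t:{0..}|lborel. exp (- Re \<theta> * t))"
  proof (rule set_integral_mono)
    show "norm (exp (- \<theta> * complex_of_real t) * complex_of_real (P t i j)) \<le> exp (- Re \<theta> * t)" if "t \<in> {0..}" for t
      using P_abs_le_1[of t i j] that by (simp add: norm_mult mult_left_le)
  qed (intro set_integrable_norm P_laplace_integrable assms set_integrable_exp_Ici)+
  finally show ?thesis .
qed

lemma laplace_P_backward:
  assumes "Re \<theta> > 0"
  shows "(\<theta> + of_real (\<beta> i + \<delta> i)) * laplace_transform (\<lambda>t. P t i j) \<theta> =
    of_real (\<beta> i) * laplace_transform (\<lambda>t. P t (Suc i) j) \<theta> +
    of_real (\<delta> i) * laplace_transform (\<lambda>t. P t (i - 1) j) \<theta> + (if i = j then 1 else 0)"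
proof -
  define L where "L = (\<lambda>i. laplace_transform (\<lambda>t. P t i j) \<theta>)"
  obtain e where e: "e \<in> o[at_right 0](\<lambda>h. h)"
    "\<And>h t. h > 0 \<Longrightarrow> t \<ge> 0 \<Longrightarrow> \<bar>P (h + t) i j - P t i j - h * generator (\<lambda>k. P t k j) i\<bar> \<le> e h"
    using kolmogorov_backward_uniform[of i j] by blast
  have "\<theta> * L i - of_real (P 0 i j) = laplace_transform (\<lambda>t. generator (\<lambda>k. P t k j) i) \<theta>"
    unfolding L_def
  proof (rule laplace_transform_derivative[OF P_continuous _ _ _ e(1) e(2) assms])
    show "continuous_on {0..} (\<lambda>t. generator (\<lambda>k. P t k j) i)"
      unfolding generator_def by (intro continuous_intros P_continuous)
  qed (use P_abs_le_1 generator_bound in auto)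
  also have "\<dots> = (LINT t:{0..}|lborel. of_real (\<beta> i) * (exp (- \<theta> * complex_of_real t) * complex_of_real (P t (Suc i) j))
      + of_real (\<delta> i) * (exp (- \<theta> * complex_of_real t) * complex_of_real (P t (i - 1) j))
      - of_real (\<beta> i + \<delta> i) * (exp (- \<theta> * complex_of_real t) * complex_of_real (P t i j)))"
    unfolding laplace_transform_def generator_def by (intro set_lebesgue_integral_cong) (auto simp: algebra_simps)
  also have "\<dots> = of_real (\<beta> i) * L (Suc i) + of_real (\<delta> i) * L (i - 1) - of_real (\<beta> i + \<delta> i) * L i"
    unfolding L_def laplace_transform_def
    by (subst set_integral_diff set_integral_add, intro set_integral_add set_integrable_mult_right P_laplace_integrable assms,
        intro set_integrable_mult_right P_laplace_integrable assms,
        subst set_integral_add, (intro set_integrable_mult_right P_laplace_integrable assms)+,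
        (subst set_integral_mult_right)+, rule refl)
  finally have "(\<theta> + of_real (\<beta> i + \<delta> i)) * L i =
      of_real (\<beta> i) * L (Suc i) + of_real (\<delta> i) * L (i - 1) + (if i = j then 1 else 0)"
    using P_0[OF all_visited, of i j] by (simp add: algebra_simps split: if_splits)
  thus ?thesis by (simp add: L_def)
qed

end

text \<open>Positive rates spread the property of being visited from \<open>n\<^sub>0\<close> to all
  states above and below. The whole matrix \<open>R\<close> is produced, although only its row
  \<open>n\<^sub>0\<close> is asked for in the end, because the backward equation couples different
  rows.\<close>

lemma birth_death_laplace_backward:
  assumes "birth_death_process \<beta> \<delta> M X"
    and "\<And>i. \<beta> i > 0" "\<And>i. \<delta> (Suc i) > 0"
    and init: "AE \<omega> in M. X 0 \<omega> = n\<^sub>0" and theta: "Re \<theta> > 0"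
  obtains R C where "\<And>i j. norm (R i j) \<le> C"
    "\<And>i j. (\<theta> + of_real (\<beta> i + \<delta> i)) * R i j =
      of_real (\<beta> i) * R (Suc i) j + of_real (\<delta> i) * R (i - 1) j + (if i = j then 1 else 0 :: complex)"
    "\<And>n. laplace_transform (transition_prob M X n\<^sub>0 n) \<theta> = R n\<^sub>0 n"
proof -
  obtain P where P: "homogeneous_markov_process M X P"
    "\<And>i. (\<lambda>h. P h i (Suc i) - \<beta> i * h) \<in> o[at_right 0](\<lambda>h. h)"
    "\<And>i. (\<lambda>h. P h (Suc i) i - \<delta> (Suc i) * h) \<in> o[at_right 0](\<lambda>h. h)"
    "\<And>i. (\<lambda>h. P h i i - (1 - (\<beta> i + \<delta> i) * h)) \<in> o[at_right 0](\<lambda>h. h)" and d0: "\<delta> 0 = 0"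
    using assms(1) unfolding birth_death_process_def by blast
  interpret prob_space M using P(1) by (simp add: homogeneous_markov_process_def)
  interpret markov_chain M X P by unfold_locales (rule P(1))
  have p1: "prob {\<omega> \<in> space M. X 0 \<omega> = n\<^sub>0} = 1"
    using init event[of 0 n\<^sub>0] by (subst prob_Collect_eq_1) auto
  have v0: "visited n\<^sub>0" unfolding visited_def using p1 by (intro exI[of _ 0]) auto
  have up: "visited (Suc i)" if "visited i" for i
    using smallo_linear_pos[OF P(2) assms(2), of i] visited_step[OF that] by (metis less_imp_le)
  have down: "visited i" if "visited (Suc i)" for i
    using smallo_linear_pos[OF P(3) assms(3), of i] visited_step[OF that] by (metis less_imp_le)
  have "visited (n\<^sub>0 + i)" for i by (induction i) (auto simp: v0 up)
  moreover have "visited (n\<^sub>0 - i)" for i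
  proof (induction i)
    case (Suc i)
    show ?case
    proof (cases "i < n\<^sub>0")
      case True
      hence "n\<^sub>0 - i = Suc (n\<^sub>0 - Suc i)" by simp
      with Suc down show ?thesis by metis
    qed (use Suc in auto)
  qed (simp add: v0)
  ultimately have vis: "visited i" for i
    by (metis le_add_diff_inverse diff_diff_cancel nat_le_linear)
  interpret visited_birth_death M X P \<beta> \<delta>
    by unfold_locales (use P d0 vis in auto)
  have tp: "transition_prob M X n\<^sub>0 n t = P t n\<^sub>0 n" if "t \<ge> 0" for n t
    using joint1[of 0 t n\<^sub>0 n] p1 that by (simp add: transition_prob_def cond_prob_def)
  show ?thesis
  proof (rule that[where R = "\<lambda>i j. laplace_transform (\<lambda>t. P t i j) \<theta>"])
    show "laplace_transform (transition_prob M X n\<^sub>0 n) \<theta> = laplace_transform (\<lambda>t. P t n\<^sub>0 n) \<theta>" for n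
      unfolding laplace_transform_def by (intro set_lebesgue_integral_cong) (auto simp: tp)
  qed (use laplace_P_bound[OF theta] laplace_P_backward[OF theta] in auto)
qed

section \<open>The resolvent equations of a birth-death process\<close>

locale bd_resolvent =
  fixes \<rho> :: real and \<delta> :: "nat \<Rightarrow> real" and \<theta> :: complex
  assumes rho_pos: "\<rho> > 0"
    and delta_0: "\<delta> 0 = 0"
    and delta_pos: "\<And>i. \<delta> (Suc i) > 0"
    and Re_theta_pos: "Re \<theta> > 0"
begin

text \<open>The reversing measure with value 1 in state 0; \<open>weight_Suc\<close> is its detailed
  balance equation.\<close>

definition weight :: "nat \<Rightarrow> real" where
  "weight n = (\<Prod>k<n. \<rho> / \<delta> (Suc k))"

definition backward :: "(nat \<Rightarrow> complex) \<Rightarrow> (nat \<Rightarrow> complex) \<Rightarrow> bool" where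
  "backward s u \<longleftrightarrow> (\<forall>i. (\<theta> + of_real (\<rho> + \<delta> i)) * u i =
      of_real \<rho> * u (Suc i) + of_real (\<delta> i) * u (i - 1) + s i)"

text \<open>The boundary at 0 needs a case of its own here, because the birth rate does not vanish;
  in \<open>backward\<close> the truncated term \<open>u (i - 1)\<close> is removed by
  \<open>\<delta> 0 = 0\<close>.\<close>

definition forward :: "(nat \<Rightarrow> complex) \<Rightarrow> (nat \<Rightarrow> complex) \<Rightarrow> bool" where
  "forward s v \<longleftrightarrow> (\<forall>n. (\<theta> + of_real (\<rho> + \<delta> n)) * v n =
      (if n = 0 then 0 else of_real \<rho> * v (n - 1)) + of_real (\<delta> (Suc n)) * v (Suc n) + s n)"

lemma weight_pos [simp]: "weight n > 0"
  unfolding weight_def using rho_pos delta_pos by (intro prod_pos) auto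

lemma weight_nz [simp]: "weight n \<noteq> 0"
  using weight_pos[of n] by linarith

lemma abs_weight [simp]: "\<bar>weight n\<bar> = weight n"
  using weight_pos[of n] by linarith

lemma weight_Suc: "\<delta> (Suc n) * weight (Suc n) = \<rho> * weight n"
  using delta_pos[of n] by (simp add: weight_def)

lemma weight_Suc': "of_real (\<delta> (Suc n)) * of_real (weight (Suc n)) = (of_real \<rho> * of_real (weight n) :: complex)"
  using weight_Suc[of n] by (metis of_real_mult)

text \<open>A nonzero solution grows at least like \<open>(1 + Re \<theta> / \<rho>) ^ i\<close>.\<close>

lemma bounded_backward_unique:
  assumes rec: "backward (\<lambda>_. 0) w" and bdd: "\<And>i. norm (w i) \<le> C"
  shows "w i = 0"
proof -
  define q where "q = 1 + Re \<theta> / \<rho>"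
  have q1: "q > 1" using rho_pos Re_theta_pos by (simp add: q_def)
  have step: "q * norm (w i) \<le> norm (w (Suc i))" for i
  proof (induction i)
    case (0)
    have "norm (\<theta> + of_real \<rho>) * norm (w 0) = \<rho> * norm (w (Suc 0))"
      using rec[unfolded backward_def, rule_format, of 0] delta_0 rho_pos
      by (simp flip: norm_mult) (simp add: norm_mult)
    moreover have "Re \<theta> + \<rho> \<le> norm (\<theta> + of_real \<rho>)"
      using complex_Re_le_cmod[of "\<theta> + of_real \<rho>"] by simp
    ultimately have "(Re \<theta> + \<rho>) * norm (w 0) \<le> \<rho> * norm (w (Suc 0))"
      by (metis mult_right_mono norm_ge_zero)
    thus ?case using rho_pos by (simp add: q_def field_simps)
  next
    case (Suc i)
    let ?d = "\<delta> (Suc i)"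
    \<comment> \<open>This monotonicity, contained in the induction hypothesis because
      \<open>q > 1\<close>, allows the death term to be absorbed on the left. What remains is the
      same factor \<open>q\<close> in every state, as the birth rate is constant.\<close>
    have le: "norm (w i) \<le> norm (w (Suc i))"
      using Suc q1 by (smt (verit) mult_le_cancel_right1 norm_ge_zero)
    have "norm (\<theta> + of_real (\<rho> + ?d)) * norm (w (Suc i)) = norm (of_real \<rho> * w (Suc (Suc i)) + of_real ?d * w i)"
      using rec[unfolded backward_def, rule_format, of "Suc i"] by (simp flip: norm_mult)
    also have "\<dots> \<le> \<rho> * norm (w (Suc (Suc i))) + ?d * norm (w i)"
      using rho_pos delta_pos[of i] by (intro order_trans[OF norm_triangle_ineq]) (simp add: norm_mult)
    also have "\<dots> \<le> \<rho> * norm (w (Suc (Suc i))) + ?d * norm (w (Suc i))"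
      using le delta_pos[of i] by (intro add_left_mono mult_left_mono) auto
    finally have 1: "norm (\<theta> + of_real (\<rho> + ?d)) * norm (w (Suc i)) \<le>
        \<rho> * norm (w (Suc (Suc i))) + ?d * norm (w (Suc i))" .
    have "Re \<theta> + (\<rho> + ?d) \<le> norm (\<theta> + of_real (\<rho> + ?d))"
      using complex_Re_le_cmod[of "\<theta> + of_real (\<rho> + ?d)"] by simp
    hence "(Re \<theta> + (\<rho> + ?d)) * norm (w (Suc i)) \<le> norm (\<theta> + of_real (\<rho> + ?d)) * norm (w (Suc i))"
      by (intro mult_right_mono) auto
    with 1 have "(Re \<theta> + \<rho>) * norm (w (Suc i)) \<le> \<rho> * norm (w (Suc (Suc i)))"
      by (simp add: algebra_simps)
    thus ?case using rho_pos by (simp add: q_def field_simps)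
  qed
  have pow: "q ^ k * norm (w i) \<le> norm (w (i + k))" for k
  proof (induction k)
    case (Suc k)
    have "q * (q ^ k * norm (w i)) \<le> q * norm (w (i + k))"
      using Suc q1 by (intro mult_left_mono) auto
    also have "\<dots> \<le> norm (w (Suc (i + k)))" by (rule step)
    finally show ?case by (simp add: mult.assoc)
  qed auto
  show ?thesis
  proof (rule ccontr)
    assume nz: "w i \<noteq> 0"
    obtain k where "C / norm (w i) < q ^ k" using real_arch_pow[OF q1] by blast
    hence "C < q ^ k * norm (w i)" using nz by (simp add: field_simps)
    with pow[of k] bdd[of "i + k"] show False by linarith
  qed
qed

text \<open>By detailed balance, division by the weights exchanges the coefficients of the upper and
  the lower neighbour.\<close>

lemma forward_imp_backward:
  assumes "forward s v"
  shows "backward (\<lambda>n. s n / of_real (weight n)) (\<lambda>n. v n / of_real (weight n))"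
  unfolding backward_def
proof
  fix n
  define W :: "nat \<Rightarrow> complex" where "W = (\<lambda>n. of_real (weight n))"
  have nz: "W n \<noteq> 0" for n by (simp add: W_def)
  have e1: "of_real (\<delta> (Suc n)) * W (Suc n) = of_real \<rho> * W n" for n
    using weight_Suc' by (simp add: W_def)
  have F: "(\<theta> + of_real (\<rho> + \<delta> n)) * v n =
      (if n = 0 then 0 else of_real \<rho> * v (n - 1)) + of_real (\<delta> (Suc n)) * v (Suc n) + s n"
    using assms by (simp add: forward_def)
  have A: "of_real (\<delta> (Suc n)) * v (Suc n) / W n = of_real \<rho> * (v (Suc n) / W (Suc n))"
    using e1[of n] nz[of n] nz[of "Suc n"] by (simp add: field_simps)
  have B: "(if n = 0 then 0 else of_real \<rho> * v (n - 1)) / W n = of_real (\<delta> n) * (v (n - 1) / W (n - 1))"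
  proof (cases n)
    case (Suc k)
    then show ?thesis using e1[of k] nz[of k] nz[of "Suc k"]
      by (simp add: field_simps)
  qed (simp add: delta_0)
  have "(\<theta> + of_real (\<rho> + \<delta> n)) * (v n / W n) = ((\<theta> + of_real (\<rho> + \<delta> n)) * v n) / W n" by simp
  also have "\<dots> = of_real \<rho> * (v (Suc n) / W (Suc n)) + of_real (\<delta> n) * (v (n - 1) / W (n - 1)) + s n / W n"
    unfolding F add_divide_distrib A B by simp
  finally show "(\<theta> + of_real (\<rho> + \<delta> n)) * (v n / of_real (weight n)) =
      of_real \<rho> * (v (Suc n) / of_real (weight (Suc n))) +
      of_real (\<delta> n) * (v (n - 1) / of_real (weight (n - 1))) + s n / of_real (weight n)"
    by (simp add: W_def)
qed

lemma forward_unique: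
  assumes "forward (\<lambda>_. 0) v" and bdd: "\<And>n. norm (v n) \<le> C * weight n"
  shows "v n = 0"
proof -
  have "backward (\<lambda>_. 0) (\<lambda>n. v n / of_real (weight n))"
    using forward_imp_backward[OF assms(1)] by simp
  moreover have "norm (v i / of_real (weight i)) \<le> C" for i
    using bdd[of i] weight_pos[of i] by (simp add: norm_divide field_simps)
  ultimately have "v n / of_real (weight n) = 0"
    by (rule bounded_backward_unique)
  thus ?thesis by simp
qed

text \<open>Summation by parts: the boundary term at infinity vanishes with the weights.\<close>

lemma resolvent_symmetric:
  assumes u: "backward (\<lambda>i. if i = j then 1 else 0) u" "\<And>i. norm (u i) \<le> C"
    and v: "backward (\<lambda>i. if i = k then 1 else 0) v" "\<And>i. norm (v i) \<le> C"
    and weight0: "weight \<longlonglongrightarrow> 0"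
  shows "of_real (weight j) * v j = of_real (weight k) * u k"
proof -
  define W :: "nat \<Rightarrow> complex" where "W = (\<lambda>n. of_real (weight n))"
  \<comment> \<open>The weighted Casoratian of \<open>u\<close> and \<open>v\<close> across the edge
    from \<open>i\<close> to \<open>Suc i\<close>. By detailed balance the recurrences carry it from
    one edge to the next unchanged, except at the two sources.\<close>
  define E where "E = (\<lambda>i. of_real \<rho> * W i * (u i * v (Suc i) - v i * u (Suc i)))"
  have e1: "of_real (\<delta> (Suc n)) * W (Suc n) = of_real \<rho> * W n" for n
    using weight_Suc' by (simp add: W_def)
  define sj sk where "sj = (\<lambda>i. if i = j then 1 else 0 :: complex)" and "sk = (\<lambda>i. if i = k then 1 else 0 :: complex)"
  have U: "of_real \<rho> * u (Suc i) = (\<theta> + of_real (\<rho> + \<delta> i)) * u i - of_real (\<delta> i) * u (i - 1) - sj i" for i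
    using u(1)[unfolded backward_def, rule_format, of i] by (simp add: sj_def algebra_simps)
  have V: "of_real \<rho> * v (Suc i) = (\<theta> + of_real (\<rho> + \<delta> i)) * v i - of_real (\<delta> i) * v (i - 1) - sk i" for i
    using v(1)[unfolded backward_def, rule_format, of i] by (simp add: sk_def algebra_simps)
  have EE: "E i = W i * (of_real (\<delta> i) * (u (i - 1) * v i - v (i - 1) * u i) + sj i * v i - sk i * u i)" for i
  proof -
    have "E i = W i * (u i * (of_real \<rho> * v (Suc i)) - v i * (of_real \<rho> * u (Suc i)))"
      by (simp add: E_def algebra_simps)
    also have "\<dots> = W i * (of_real (\<delta> i) * (u (i - 1) * v i - v (i - 1) * u i) + sj i * v i - sk i * u i)"
      unfolding U V by (simp add: algebra_simps)
    finally show ?thesis .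
  qed
  have sum: "E L = (\<Sum>i\<le>L. W i * (sj i * v i - sk i * u i))" for L
  proof (induction L)
    case 0
    show ?case by (simp add: EE delta_0)
  next
    case (Suc L)
    have "E (Suc L) = (of_real (\<delta> (Suc L)) * W (Suc L)) * (u L * v (Suc L) - v L * u (Suc L)) + W (Suc L) * (sj (Suc L) * v (Suc L) - sk (Suc L) * u (Suc L))"
      unfolding EE[of "Suc L"] by (simp add: algebra_simps)
    also have "(of_real (\<delta> (Suc L)) * W (Suc L)) * (u L * v (Suc L) - v L * u (Suc L)) = E L"
      unfolding e1 E_def ..
    finally show ?case using Suc by simp
  qed
  have const: "E L = W j * v j - W k * u k" if "L \<ge> max j k" for L
  proof -
    have "E L = (\<Sum>i\<le>L. W i * sj i * v i) - (\<Sum>i\<le>L. W i * sk i * u i)"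
      unfolding sum by (simp add: sum_subtractf[symmetric] algebra_simps)
    also have "(\<Sum>i\<le>L. W i * sj i * v i) = (\<Sum>i\<le>L. if i = j then W i * v i else 0)"
      by (intro sum.cong) (auto simp: sj_def)
    also have "\<dots> = W j * v j" using that by (subst sum.delta) auto
    also have "(\<Sum>i\<le>L. W i * sk i * u i) = (\<Sum>i\<le>L. if i = k then W i * u i else 0)"
      by (intro sum.cong) (auto simp: sk_def)
    also have "\<dots> = W k * u k" using that by (subst sum.delta) auto
    finally show ?thesis .
  qed
  have "E \<longlonglongrightarrow> 0"
  proof (rule Lim_null_comparison)
    have "C \<ge> 0" using u(2)[of 0] norm_ge_zero order_trans by blast
    have "norm (E i) \<le> \<rho> * weight i * (2 * C * C)" for i
    proof -
      have "norm (u i * v (Suc i) - v i * u (Suc i)) \<le> norm (u i) * norm (v (Suc i)) + norm (v i) * norm (u (Suc i))"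
        by (metis norm_mult norm_triangle_ineq4)
      also have "\<dots> \<le> C * C + C * C"
        using u(2) v(2) \<open>C \<ge> 0\<close> by (intro add_mono mult_mono) auto
      finally show ?thesis using rho_pos weight_pos[of i]
        by (simp add: E_def W_def norm_mult mult_left_mono)
    qed
    thus "\<forall>\<^sub>F i in sequentially. norm (E i) \<le> \<rho> * weight i * (2 * C * C)" by simp
    show "(\<lambda>i. \<rho> * weight i * (2 * C * C)) \<longlonglongrightarrow> 0"
      using tendsto_mult[OF tendsto_mult[OF tendsto_const[of \<rho>] weight0] tendsto_const[of "2*C*C"]] by simp
  qed
  moreover have "E \<longlonglongrightarrow> W j * v j - W k * u k"
    by (rule tendsto_eventually) (use const eventually_ge_at_top[of "max j k"] in \<open>auto elim!: eventually_mono\<close>)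
  ultimately have "W j * v j - W k * u k = 0" by (metis LIMSEQ_unique)
  thus ?thesis by (simp add: W_def)
qed

text \<open>The backward equation determines the columns of \<open>R\<close>, not its rows. So
  \<open>v\<close> is first converted into a bounded backward solution and identified with column
  \<open>n\<^sub>0\<close>; the symmetry of \<open>R\<close> then turns that column into the
  row.\<close>

lemma resolvent_row:
  assumes R: "\<And>j. backward (\<lambda>i. if i = j then 1 else 0) (\<lambda>i. R i j)" "\<And>i j. norm (R i j) \<le> C"
    and v: "forward (\<lambda>n. if n = n\<^sub>0 then 1 else 0) v" "\<And>n. norm (v n) \<le> K * weight n"
    and weight0: "weight \<longlonglongrightarrow> 0"
  shows "R n\<^sub>0 n = v n"
proof -
  define W :: "nat \<Rightarrow> complex" where "W = (\<lambda>n. of_real (weight n))"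
  have W: "W n \<noteq> 0" for n by (simp add: W_def)
  \<comment> \<open>The factor \<open>W n\<^sub>0\<close> restores the source at
    \<open>n\<^sub>0\<close> to 1, after the division by the weights has scaled it.\<close>
  define u where "u = (\<lambda>i. W n\<^sub>0 * (v i / W i))"
  have fu: "backward (\<lambda>i. if i = n\<^sub>0 then 1 else 0) u"
    unfolding backward_def
  proof
    fix i
    have "(\<theta> + of_real (\<rho> + \<delta> i)) * (v i / W i) = of_real \<rho> * (v (Suc i) / W (Suc i)) +
        of_real (\<delta> i) * (v (i - 1) / W (i - 1)) + (if i = n\<^sub>0 then 1 else 0) / W i"
      using forward_imp_backward[OF v(1)] by (simp add: backward_def W_def)
    hence "W n\<^sub>0 * ((\<theta> + of_real (\<rho> + \<delta> i)) * (v i / W i)) = W n\<^sub>0 * (of_real \<rho> * (v (Suc i) / W (Suc i)) +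
        of_real (\<delta> i) * (v (i - 1) / W (i - 1)) + (if i = n\<^sub>0 then 1 else 0) / W i)" by simp
    thus "(\<theta> + of_real (\<rho> + \<delta> i)) * u i = of_real \<rho> * u (Suc i) + of_real (\<delta> i) * u (i - 1) + (if i = n\<^sub>0 then 1 else 0)"
      using W[of n\<^sub>0] by (simp only: u_def distrib_left mult.left_commute[of "W n\<^sub>0"]) simp
  qed
  have bu: "norm (u i) \<le> weight n\<^sub>0 * K" for i
    using v(2)[of i] weight_pos[of i] weight_pos[of n\<^sub>0] by (simp add: u_def W_def norm_mult norm_divide field_simps)
  have uR: "R i n\<^sub>0 = u i" for i
  proof -
    have "backward (\<lambda>_. 0) (\<lambda>i. R i n\<^sub>0 - u i)"
      using R(1)[of n\<^sub>0] fu by (simp add: backward_def algebra_simps)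
    moreover have "norm (R i n\<^sub>0 - u i) \<le> C + weight n\<^sub>0 * K" for i
      using norm_triangle_ineq4[of "R i n\<^sub>0" "u i"] R(2)[of i n\<^sub>0] bu[of i] by linarith
    ultimately have "R i n\<^sub>0 - u i = 0" by (rule bounded_backward_unique)
    thus ?thesis by simp
  qed
  have "of_real (weight n\<^sub>0) * R n\<^sub>0 n = of_real (weight n) * R n n\<^sub>0"
    by (rule resolvent_symmetric[OF R(1)[of n\<^sub>0] R(2) R(1)[of n] R(2) weight0])
  thus ?thesis unfolding uR using W[of n] W[of n\<^sub>0] by (simp add: u_def W_def)
qed

text \<open>The recurrence for \<open>f\<close> at \<open>m - 1\<close> reaches up to
  \<open>m\<close>, and that for \<open>d\<close> at \<open>m\<close> reaches down to
  \<open>m - 1\<close>; hence the two pieces have to agree at both levels.\<close>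

lemma forward_glue:
  assumes m: "m \<ge> 1"
    and f: "\<And>n. n < m \<Longrightarrow> (\<theta> + of_real (\<rho> + \<delta> n)) * f n =
      (if n = 0 then 0 else of_real \<rho> * f (n - 1)) + of_real (\<delta> (Suc n)) * f (Suc n)"
    and d: "\<And>n. n \<ge> m \<Longrightarrow> (\<theta> + of_real (\<rho> + \<delta> n)) * d n =
      of_real \<rho> * d (n - 1) + of_real (\<delta> (Suc n)) * d (Suc n) + s n"
    and s: "\<And>n. n < m \<Longrightarrow> s n = 0"
    and eq: "c * f (m - 1) = d (m - 1)" "c * f m = d m"
  shows "forward s (\<lambda>n. if n < m then c * f n else d n)"
  unfolding forward_def
proof
  fix n
  let ?v = "\<lambda>n. if n < m then c * f n else d n"
  show "(\<theta> + of_real (\<rho> + \<delta> n)) * ?v n =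
      (if n = 0 then 0 else of_real \<rho> * ?v (n - 1)) + of_real (\<delta> (Suc n)) * ?v (Suc n) + s n"
  proof (cases "n < m")
    case True
    have v: "?v (Suc n) = c * f (Suc n)" using True eq(2) by (cases "Suc n = m") auto
    have "(\<theta> + of_real (\<rho> + \<delta> n)) * ?v n = c * ((\<theta> + of_real (\<rho> + \<delta> n)) * f n)" using True by simp
    also have "\<dots> = (if n = 0 then 0 else of_real \<rho> * ?v (n - 1)) + of_real (\<delta> (Suc n)) * ?v (Suc n)"
      unfolding f[OF True] v using True by (auto simp: algebra_simps)
    finally show ?thesis using s[OF True] by simp
  next
    case False
    have "?v (n - 1) = d (n - 1)" using False eq(1) m by (cases "n = m") auto
    thus ?thesis using False m d[of n] by simp
  qed
qed

lemma weight_bound_extend: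
  assumes "\<And>n. n \<ge> N \<Longrightarrow> norm (v n :: complex) \<le> K * weight n"
  shows "\<exists>K'. \<forall>n. norm (v n) \<le> K' * weight n"
proof -
  define S where "S = (\<Sum>k<N. norm (v k) / weight k)"
  have S: "S \<ge> 0" unfolding S_def by (intro sum_nonneg) (simp add: less_imp_le)
  have "norm (v n) \<le> (S + \<bar>K\<bar>) * weight n" for n
  proof (cases "n < N")
    case True
    have "norm (v n) / weight n \<le> S"
      unfolding S_def using True by (intro member_le_sum) (auto simp: less_imp_le)
    hence "norm (v n) \<le> S * weight n" by (simp add: field_simps)
    also have "\<dots> \<le> (S + \<bar>K\<bar>) * weight n" by (intro mult_right_mono) (auto simp: less_imp_le)
    finally show ?thesis .
  next
    case False
    hence "norm (v n) \<le> K * weight n" using assms by simp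
    also have "\<dots> \<le> (S + \<bar>K\<bar>) * weight n" using S by (intro mult_right_mono) (auto simp: less_imp_le)
    finally show ?thesis .
  qed
  thus ?thesis by blast
qed

section \<open>The Green function for a source at or above level \<open>m\<close>\<close>

context
  fixes m :: nat and f h i w :: "nat \<Rightarrow> complex" and K :: real
  assumes m: "m \<ge> 1"
    and f_rec: "\<And>n. n < m \<Longrightarrow> (\<theta> + of_real (\<rho> + \<delta> n)) * f n =
      (if n = 0 then 0 else of_real \<rho> * f (n - 1)) + of_real (\<delta> (Suc n)) * f (Suc n)"
    and f_0: "f 0 = 1"
    and h_rec: "\<And>n. n \<ge> m \<Longrightarrow> (\<theta> + of_real (\<rho> + \<delta> n)) * h n =
      of_real \<rho> * h (n - 1) + of_real (\<delta> (Suc n)) * h (Suc n)"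
    and i_rec: "\<And>n. n \<ge> m \<Longrightarrow> (\<theta> + of_real (\<rho> + \<delta> n)) * i n =
      of_real \<rho> * i (n - 1) + of_real (\<delta> (Suc n)) * i (Suc n)"
    and casoratian: "\<And>n. n \<ge> m - 1 \<Longrightarrow> h n * i (Suc n) - h (Suc n) * i n = w n"
    and w_nz: "\<And>n. n \<ge> m - 1 \<Longrightarrow> w n \<noteq> 0"
    and h_bound: "\<And>n. n \<ge> m \<Longrightarrow> norm (h n) \<le> K * weight n"
begin

text \<open>Since \<open>\<rho>\<close> is nonzero, the recurrence can be solved for the lower
  neighbour, so two adjacent zeros would propagate down to \<open>f 0 = 1\<close>.\<close>

lemma f_pair_nz: "f m \<noteq> 0 \<or> f (m - 1) \<noteq> 0"
proof (rule ccontr)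
  assume "\<not> ?thesis"
  hence 0: "f m = 0" "f (m - 1) = 0" by auto
  have "j < m \<Longrightarrow> f (m - j) = 0 \<and> f (m - Suc j) = 0" for j
  proof (induction j)
    case 0
    thus ?case using \<open>\<not> (f m \<noteq> 0 \<or> f (m - 1) \<noteq> 0)\<close> by simp
  next
    case (Suc j)
    define n where "n = m - Suc j"
    have n: "n > 0" "n < m" "Suc n = m - j" "n - 1 = m - Suc (Suc j)" using Suc.prems by (auto simp: n_def)
    have "f n = 0" "f (Suc n) = 0" using Suc n by (auto simp: n_def)
    hence "of_real \<rho> * f (n - 1) = 0" using f_rec[OF n(2)] n(1) by simp
    thus ?case using rho_pos \<open>f n = 0\<close> n by (simp add: n_def)
  qed
  from this[of "m - 1"] have "f 0 = 0" using m by simp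
  thus False using f_0 by simp
qed

text \<open>If the determinant vanished, suitable multiples of \<open>f\<close> and \<open>h\<close>
  would agree at \<open>m - 1\<close> and \<open>m\<close> and glue to a source-free solution
  bounded relative to the weights. Uniqueness makes it zero, but its value at 0 is a nonzero
  multiple of \<open>f 0\<close>.\<close>

lemma determinant_nz: "f m * h (m - 1) - h m * f (m - 1) \<noteq> 0"
proof
  assume D: "f m * h (m - 1) - h m * f (m - 1) = 0"
  have m1: "Suc (m - 1) = m" using m by simp
  have hp: "h m \<noteq> 0 \<or> h (m - 1) \<noteq> 0"
    using casoratian[of "m - 1"] w_nz[of "m - 1"] unfolding m1 by auto
  \<comment> \<open>The pairs of values of \<open>f\<close> and of \<open>h\<close> at
    \<open>m - 1\<close> and \<open>m\<close> are both nonzero, so they are proportional with a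
    nonzero factor; the cases decide which coordinate serves to compare them.\<close>
  obtain c d where cd: "c \<noteq> 0" "c * f (m - 1) = d * h (m - 1)" "c * f m = d * h m"
  proof (cases "f m = 0")
    case False
    show ?thesis
      by (rule that[of "h m" "f m"]) (use D hp False in \<open>auto simp: algebra_simps\<close>)
  next
    case True
    hence "f (m - 1) \<noteq> 0" using f_pair_nz by auto
    hence "h m = 0" using D True by simp
    thus ?thesis using that[of "h (m - 1)" "f (m - 1)"] hp True by (auto simp: mult.commute)
  qed
  let ?v = "\<lambda>n. if n < m then c * f n else d * h n"
  have "forward (\<lambda>_. 0) ?v"
  proof (rule forward_glue[OF m f_rec])
    show "(\<theta> + of_real (\<rho> + \<delta> n)) * (d * h n) = of_real \<rho> * (d * h (n - 1)) + of_real (\<delta> (Suc n)) * (d * h (Suc n)) + 0" if "n \<ge> m" for n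
    proof -
      have "(\<theta> + of_real (\<rho> + \<delta> n)) * (d * h n) = d * ((\<theta> + of_real (\<rho> + \<delta> n)) * h n)" by simp
      thus ?thesis unfolding h_rec[OF that] by (simp add: algebra_simps)
    qed
  qed (use cd in auto)
  moreover have bd: "norm (?v n) \<le> norm d * K * weight n" if "n \<ge> m" for n
    using mult_left_mono[OF h_bound[OF that], of "norm d"] that by (simp add: norm_mult mult_ac)
  obtain K' where "\<And>n. norm (?v n) \<le> K' * weight n"
    using bd weight_bound_extend[of m ?v "norm d * K"] by blast
  ultimately have "?v 0 = 0" by (rule forward_unique)
  thus False using m cd f_0 by simp
qed

text \<open>Above the source only \<open>h\<close> has the right growth. Below it the solution has
  to continue a multiple of \<open>f\<close> across \<open>m\<close>, which singles out the
  combination \<open>i n + B * h n\<close>. The product of the two has a jump at the source equal to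
  the Casoratian, and \<open>A\<close> normalises it.\<close>

lemma green_function:
  fixes n\<^sub>0 :: nat and A B :: complex
  assumes R: "\<And>j. backward (\<lambda>i. if i = j then 1 else 0) (\<lambda>i. R i j)" "\<And>i j. norm (R i j) \<le> C"
    and weight0: "weight \<longlonglongrightarrow> 0" and n0: "n\<^sub>0 \<ge> m"
    and A: "A * (of_real (\<delta> (Suc n\<^sub>0)) * w n\<^sub>0) = 1"
    and B: "B = (i m * f (m - 1) - i (m - 1) * f m) / (f m * h (m - 1) - h m * f (m - 1))"
  shows "n \<ge> n\<^sub>0 \<Longrightarrow> R n\<^sub>0 n = A * (i n\<^sub>0 + B * h n\<^sub>0) * h n"
    and "m \<le> n \<Longrightarrow> n \<le> n\<^sub>0 \<Longrightarrow> R n\<^sub>0 n = A * (i n + B * h n) * h n\<^sub>0"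
    and "n \<le> m \<Longrightarrow> R n\<^sub>0 n = A * w (m - 1) * (h n\<^sub>0 * f n / (f m * h (m - 1) - h m * f (m - 1)))"
proof -
  define D where "D = f m * h (m - 1) - h m * f (m - 1)"
  have D: "D \<noteq> 0" unfolding D_def by (rule determinant_nz)
  define J where "J = (\<lambda>n. i n + B * h n)"
  define c where "c = A * w (m - 1) * h n\<^sub>0 / D"
  define d where "d = (\<lambda>n. if n \<le> n\<^sub>0 then A * J n * h n\<^sub>0 else A * J n\<^sub>0 * h n)"
  define v where "v = (\<lambda>n. if n < m then c * f n else d n)"
  have m1: "Suc (m - 1) = m" using m by simp
  have BD: "B * D = i m * f (m - 1) - i (m - 1) * f m" using D B by (simp add: D_def)
  have W: "h (m - 1) * i m - h m * i (m - 1) = w (m - 1)" using casoratian[of "m - 1"] unfolding m1 by simp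
  \<comment> \<open>This is the purpose of \<open>B\<close>: at \<open>m - 1\<close> and at
    \<open>m\<close>, \<open>J\<close> is the same multiple of \<open>f\<close>.\<close>
  have JD: "J m * D = w (m - 1) * f m" "J (m - 1) * D = w (m - 1) * f (m - 1)"
  proof -
    have "J m * D = i m * D + (B * D) * h m" by (simp add: J_def algebra_simps)
    thus "J m * D = w (m - 1) * f m" unfolding BD W[symmetric] by (simp add: D_def algebra_simps)
    have "J (m - 1) * D = i (m - 1) * D + (B * D) * h (m - 1)" by (simp add: J_def algebra_simps)
    thus "J (m - 1) * D = w (m - 1) * f (m - 1)" unfolding BD W[symmetric] by (simp add: D_def algebra_simps)
  qed
  have J_eq: "J m = w (m - 1) * f m / D" "J (m - 1) = w (m - 1) * f (m - 1) / D"
    using JD D by (auto simp: field_simps)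
  have J_rec: "(\<theta> + of_real (\<rho> + \<delta> n)) * J n = of_real \<rho> * J (n - 1) + of_real (\<delta> (Suc n)) * J (Suc n)" if "n \<ge> m" for n
  proof -
    have "(\<theta> + of_real (\<rho> + \<delta> n)) * J n = (\<theta> + of_real (\<rho> + \<delta> n)) * i n + B * ((\<theta> + of_real (\<rho> + \<delta> n)) * h n)"
      by (simp add: J_def algebra_simps)
    thus ?thesis unfolding i_rec[OF that] h_rec[OF that] by (simp add: J_def algebra_simps)
  qed
  have JW: "h n\<^sub>0 * J (Suc n\<^sub>0) - J n\<^sub>0 * h (Suc n\<^sub>0) = w n\<^sub>0"
    using casoratian[of n\<^sub>0] n0 by (simp add: J_def algebra_simps)
  have fwd: "forward (\<lambda>n. if n = n\<^sub>0 then 1 else 0) v"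
    unfolding v_def
  proof (rule forward_glue[OF m f_rec])
    fix n assume n: "n \<ge> m"
    let ?k = "\<theta> + of_real (\<rho> + \<delta> n)"
    consider "n < n\<^sub>0" | "n = n\<^sub>0" | "n > n\<^sub>0" by linarith
    thus "?k * d n = of_real \<rho> * d (n - 1) + of_real (\<delta> (Suc n)) * d (Suc n) + (if n = n\<^sub>0 then 1 else 0)"
    proof cases
      case 1
      have p: "d (n - 1) = A * J (n - 1) * h n\<^sub>0" "d (Suc n) = A * J (Suc n) * h n\<^sub>0"
        using 1 by (auto simp: d_def)
      have "?k * d n = A * h n\<^sub>0 * (?k * J n)" using 1 by (simp add: d_def)
      thus ?thesis unfolding J_rec[OF n] p using 1 by (simp add: algebra_simps)
    next
      \<comment> \<open>Here the recurrence for \<open>J\<close> asks for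
        \<open>h n\<^sub>0 * J (Suc n\<^sub>0)\<close>, whereas \<open>d (Suc n\<^sub>0)\<close>
        contains \<open>J n\<^sub>0 * h (Suc n\<^sub>0)\<close>. The difference is
        \<open>w n\<^sub>0\<close>, which becomes the unit source.\<close>
      case 2
      have "?k * d n = A * h n\<^sub>0 * (?k * J n)" using 2 by (simp add: d_def)
      also have "\<dots> = of_real \<rho> * d (n - 1) + of_real (\<delta> (Suc n)) * (A * (h n\<^sub>0 * J (Suc n\<^sub>0)))"
        unfolding J_rec[OF n] using 2 by (simp add: d_def algebra_simps)
      also have "h n\<^sub>0 * J (Suc n\<^sub>0) = w n\<^sub>0 + J n\<^sub>0 * h (Suc n\<^sub>0)" using JW by (simp add: algebra_simps)
      also have "of_real (\<delta> (Suc n)) * (A * (w n\<^sub>0 + J n\<^sub>0 * h (Suc n\<^sub>0))) =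
          A * (of_real (\<delta> (Suc n\<^sub>0)) * w n\<^sub>0) + of_real (\<delta> (Suc n)) * d (Suc n)"
        using 2 by (simp add: d_def algebra_simps)
      finally show ?thesis using A 2 by simp
    next
      case 3
      have p: "d (n - 1) = A * J n\<^sub>0 * h (n - 1)"
        using 3 by (cases "n - 1 = n\<^sub>0") (auto simp: d_def)
      have "?k * d n = A * J n\<^sub>0 * (?k * h n)" using 3 by (simp add: d_def)
      thus ?thesis unfolding h_rec[OF n] p using 3 by (simp add: d_def algebra_simps)
    qed
  next
    have "d (m - 1) = A * J (m - 1) * h n\<^sub>0" using n0 by (auto simp: d_def)
    thus "c * f (m - 1) = d (m - 1)" unfolding J_eq c_def by simp
    show "c * f m = d m" using n0 by (simp add: c_def d_def J_eq)
  qed (use n0 in auto)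
  have bd: "norm (v n) \<le> norm (A * J n\<^sub>0) * K * weight n" if n: "n \<ge> Suc n\<^sub>0" for n
    using mult_left_mono[OF h_bound[of n], of "norm (A * J n\<^sub>0)"] n n0
    by (simp add: v_def d_def norm_mult mult_ac)
  obtain K' where "\<And>n. norm (v n) \<le> K' * weight n"
    using weight_bound_extend[of "Suc n\<^sub>0" v, OF bd] by blast
  from resolvent_row[OF R fwd this weight0] have Rv: "R n\<^sub>0 n = v n" for n .
  show "n \<ge> n\<^sub>0 \<Longrightarrow> R n\<^sub>0 n = A * (i n\<^sub>0 + B * h n\<^sub>0) * h n"
    using n0 by (auto simp: Rv v_def d_def J_def)
  show "m \<le> n \<Longrightarrow> n \<le> n\<^sub>0 \<Longrightarrow> R n\<^sub>0 n = A * (i n + B * h n) * h n\<^sub>0"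
    by (auto simp: Rv v_def d_def J_def)
  show "n \<le> m \<Longrightarrow> R n\<^sub>0 n = A * w (m - 1) * (h n\<^sub>0 * f n / (f m * h (m - 1) - h m * f (m - 1)))"
    using n0 J_eq(1) unfolding D_def[symmetric] by (cases "n = m") (auto simp: Rv v_def d_def c_def)
qed

end

end

section \<open>Hankel contours\<close>

text \<open>\<open>T\<close> is the gap of the real axis through which a contour may pass: the reals
  above 1 for \<open>contour_C1\<close>, the interval between 0 and 1 for \<open>contour_C2\<close>.
  For convex \<open>T\<close> the domain is star-shaped about each point of \<open>T\<close>, so
  holomorphic functions on it have primitives.\<close>

definition slit :: "real set \<Rightarrow> complex set" where
  "slit T = {z. Im z \<noteq> 0 \<or> Re z \<in> T}"

lemma open_slit: "open T \<Longrightarrow> open (slit T)"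
proof -
  assume "open T"
  have "slit T = Im -` (- {0}) \<union> Re -` T" by (auto simp: slit_def)
  moreover have "open (Im -` (- {0}))" by (intro open_vimage) (auto intro!: continuous_intros)
  moreover have "open (Re -` T)" using \<open>open T\<close> by (intro open_vimage) (auto intro!: continuous_intros)
  ultimately show ?thesis by auto
qed

lemma starlike_slit:
  assumes "c \<in> T" "convex T" shows "starlike (slit T)"
  unfolding starlike_def
proof (intro bexI ballI subsetI)
  show "complex_of_real c \<in> slit T" using assms by (simp add: slit_def)
  fix z w assume z: "z \<in> slit T" and w: "w \<in> closed_segment (complex_of_real c) z"
  then obtain u where u: "0 \<le> u" "u \<le> 1" "w = (1 - u) *\<^sub>R complex_of_real c + u *\<^sub>R z"
    by (auto simp: closed_segment_def)
  show "w \<in> slit T"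
  proof (cases "Im z = 0")
    case True
    hence "(1 - u) *\<^sub>R c + u *\<^sub>R Re z \<in> T" using z u assms by (intro convexD) (auto simp: slit_def)
    thus ?thesis by (simp add: slit_def u)
  next
    case False
    thus ?thesis using u assms by (cases "u = 0") (auto simp: slit_def)
  qed
qed

text \<open>Exponential decay to the left, uniform on horizontal strips away from the real axis. It
  makes the integrals along the half-lines converge and those over vertical segments far to the left
  vanish.\<close>

definition hankel_decay :: "(complex \<Rightarrow> complex) \<Rightarrow> bool" where
  "hankel_decay f \<longleftrightarrow> (\<forall>\<epsilon>>0. \<forall>E. \<exists>K. \<exists>k>0. \<forall>z. Re z \<le> 0 \<longrightarrow> \<epsilon> \<le> \<bar>Im z\<bar> \<longrightarrow> \<bar>Im z\<bar> \<le> E \<longrightarrow>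
      norm (f z) \<le> K * exp (k * Re z))"

lemma hankel_decayD:
  assumes "hankel_decay f" "\<epsilon> > 0"
  shows "\<exists>K k. k > 0 \<and> (\<forall>z. Re z \<le> 0 \<longrightarrow> \<epsilon> \<le> \<bar>Im z\<bar> \<longrightarrow> \<bar>Im z\<bar> \<le> E \<longrightarrow> norm (f z) \<le> K * exp (k * Re z))"
  using assms unfolding hankel_decay_def by blast

definition hankel_ray :: "(complex \<Rightarrow> complex) \<Rightarrow> real \<Rightarrow> real \<Rightarrow> complex" where
  "hankel_ray f a y = (LINT x:{..a}|lborel. f (Complex x y))"

text \<open>
  \<open>hankel_line c \<epsilon> f\<close> is the integral of \<open>f\<close> along the contour consisting of the half-lines
  to the left of \<open>c - i\<epsilon>\<close> and \<open>c + i\<epsilon>\<close> and the vertical segment between these points.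
\<close>

definition hankel_line :: "real \<Rightarrow> real \<Rightarrow> (complex \<Rightarrow> complex) \<Rightarrow> complex" where
  "hankel_line c \<epsilon> f = hankel_ray f c (- \<epsilon>)
     + 2 * \<i> * of_real \<epsilon> * (LINT t:{0..1}|lborel. f (Complex c (\<epsilon> * (2 * t - 1)))) - hankel_ray f c \<epsilon>"

lemma continuous_on_slit_compose:
  assumes "continuous_on (slit T) f" "continuous_on S u" "continuous_on S v"
    "\<And>x. x \<in> S \<Longrightarrow> v x \<noteq> 0 \<or> u x \<in> T"
  shows "continuous_on S (\<lambda>x. f (Complex (u x) (v x)))"
  by (rule continuous_on_compose2[OF assms(1)]) (use assms in \<open>auto intro!: continuous_intros simp: slit_def\<close>)

lemma ray_integrable:
  assumes f: "continuous_on (slit T) f" and dec: "hankel_decay f" and y: "y \<noteq> 0"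
  shows "set_integrable lborel {..a} (\<lambda>x. f (Complex x y))"
proof -
  obtain K k where Kk: "k > 0" "\<And>z. Re z \<le> 0 \<Longrightarrow> \<bar>y\<bar> \<le> \<bar>Im z\<bar> \<Longrightarrow> \<bar>Im z\<bar> \<le> \<bar>y\<bar> \<Longrightarrow> norm (f z) \<le> K * exp (k * Re z)"
    using hankel_decayD[OF dec zero_less_abs_iff[THEN iffD2, OF y], of "\<bar>y\<bar>"] by blast
  have c: "continuous_on S (\<lambda>x. f (Complex x y))" for S
    using y by (intro continuous_on_slit_compose[OF f] continuous_intros) auto
  have 1: "set_integrable lborel {..0} (\<lambda>x. f (Complex x y))"
  proof (rule set_integrable_continuous_bound[OF c])
    show "set_integrable lborel {..0} (\<lambda>x. K * exp (k * x))"
      using set_integrable_exp_Iic[OF Kk(1)] by (intro set_integrable_mult_right)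
    show "norm (f (Complex x y)) \<le> K * exp (k * x)" if "x \<in> {..0}" for x
      using Kk(2)[of "Complex x y"] that by simp
  qed simp
  have 2: "set_integrable lborel {0..\<bar>a\<bar>} (\<lambda>x. f (Complex x y))"
    by (rule borel_integrable_atLeastAtMost'[OF c])
  have "set_integrable lborel ({..0} \<union> {0..\<bar>a\<bar>}) (\<lambda>x. f (Complex x y))"
    by (intro set_integrable_Un 1 2) auto
  thus ?thesis by (rule set_integrable_subset) auto
qed

text \<open>The right-hand side is thereby recognised as the value of the primitive at the left end
  of the line of height \<open>y\<close>.\<close>

lemma primitive_ray_limit:
  assumes prim: "\<And>z. z \<in> slit T \<Longrightarrow> (\<Phi> has_field_derivative f z) (at z)"
    and f: "continuous_on (slit T) f" and dec: "hankel_decay f" and y: "y \<noteq> 0"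
  shows "((\<lambda>L. \<Phi> (Complex (- L) y)) \<longlongrightarrow> \<Phi> (Complex a y) - hankel_ray f a y) at_top"
proof -
  have c: "continuous_on S (\<lambda>x. f (Complex x y))" for S
    using y by (intro continuous_on_slit_compose[OF f] continuous_intros) auto
  note int = ray_integrable[OF f dec y]
  have eq: "(LINT x:{-L..a}|lborel. f (Complex x y)) = \<Phi> (Complex a y) - \<Phi> (Complex (-L) y)" if "-L \<le> a" for L
  proof -
    have "((\<lambda>x. f (Complex x y)) has_integral \<Phi> (Complex a y) - \<Phi> (Complex (-L) y)) {-L..a}"
    proof (rule fundamental_theorem_of_calculus[OF that])
      fix x
      have d: "(\<Phi> has_field_derivative f (Complex x y)) (at (Complex x y))"
        by (rule prim) (use y in \<open>auto simp: slit_def\<close>)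
      have "((\<lambda>x. Complex x y) has_vector_derivative 1) (at x within {-L..a})"
        unfolding Complex_eq by (auto intro!: derivative_eq_intros)
      from field_vector_diff_chain_within[OF this, of \<Phi> "f (Complex x y)"] d
      show "((\<lambda>x. \<Phi> (Complex x y)) has_vector_derivative f (Complex x y)) (at x within {-L..a})"
        by (auto simp: o_def intro: has_field_derivative_at_within)
    qed
    thus ?thesis
      using set_borel_integral_eq_integral(2)[OF borel_integrable_atLeastAtMost'[OF c]]
      by (simp add: integral_unique)
  qed
  have "((\<lambda>L. LINT x:{-L..a}|lborel. f (Complex x y)) \<longlongrightarrow> hankel_ray f a y) at_top"
    unfolding hankel_ray_def set_lebesgue_integral_def
  proof (rule integral_dominated_convergence_at_top[where w = "\<lambda>x. norm (indicat_real {..a} x *\<^sub>R f (Complex x y))"])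
    show "(\<lambda>x. indicat_real {..a} x *\<^sub>R f (Complex x y)) \<in> borel_measurable lborel"
      using int[of a] unfolding set_integrable_def by (rule borel_measurable_integrable)
    show "(\<lambda>x. indicat_real {-L..a} x *\<^sub>R f (Complex x y)) \<in> borel_measurable lborel" for L
      using borel_measurable_continuous_on_indicator[of "{-L..a}", OF _ c] by simp
    show "integrable lborel (\<lambda>x. norm (indicat_real {..a} x *\<^sub>R f (Complex x y)))"
      using int[of a] unfolding set_integrable_def by (rule integrable_norm)
    show "AE x in lborel. ((\<lambda>L. indicat_real {-L..a} x *\<^sub>R f (Complex x y)) \<longlongrightarrow> indicat_real {..a} x *\<^sub>R f (Complex x y)) at_top"
    proof (rule AE_I2, rule tendsto_eventually)
      fix x
      show "\<forall>\<^sub>F L in at_top. indicat_real {-L..a} x *\<^sub>R f (Complex x y) = indicat_real {..a} x *\<^sub>R f (Complex x y)"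
        using eventually_ge_at_top[of "-x"] by eventually_elim (auto simp: indicator_def)
    qed
    show "\<forall>\<^sub>F L in at_top. AE x in lborel. norm (indicat_real {-L..a} x *\<^sub>R f (Complex x y)) \<le> norm (indicat_real {..a} x *\<^sub>R f (Complex x y))"
      by (intro always_eventually allI AE_I2) (auto simp: indicator_def)
  qed
  hence "((\<lambda>L. \<Phi> (Complex a y) - \<Phi> (Complex (-L) y)) \<longlongrightarrow> hankel_ray f a y) at_top"
  proof (rule Lim_transform_eventually)
    show "\<forall>\<^sub>F L in at_top. (LINT x:{-L..a}|lborel. f (Complex x y)) = \<Phi> (Complex a y) - \<Phi> (Complex (-L) y)"
      using eventually_ge_at_top[of "-a"] by eventually_elim (rule eq, simp)
  qed
  from tendsto_diff[OF tendsto_const[of "\<Phi> (Complex a y)"] this] show ?thesis by simp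
qed

lemma vertical_segment:
  assumes "z \<in> closed_segment (Complex a y) (Complex a y')"
  shows "Re z = a \<and> Im z \<in> closed_segment y y'"
proof -
  obtain u where u: "0 \<le> u" "u \<le> 1" "z = (1 - u) *\<^sub>R Complex a y + u *\<^sub>R Complex a y'"
    using assms by (auto simp: closed_segment_def)
  show ?thesis using u(1,2) by (auto simp: u(3) closed_segment_def left_diff_distrib)
qed

lemma primitive_vertical_limit:
  assumes prim: "\<And>z. z \<in> slit T \<Longrightarrow> (\<Phi> has_field_derivative f z) (at z)"
    and dec: "hankel_decay f" and y: "y1 * y2 > 0"
  shows "((\<lambda>L. \<Phi> (Complex (- L) y1) - \<Phi> (Complex (- L) y2)) \<longlongrightarrow> 0) at_top"
proof -
  define \<epsilon> E where "\<epsilon> = min \<bar>y1\<bar> \<bar>y2\<bar>" and "E = max \<bar>y1\<bar> \<bar>y2\<bar>"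
  have eps: "\<epsilon> > 0" using y by (auto simp: \<epsilon>_def zero_less_mult_iff)
  obtain K k where Kk: "k > 0" "\<And>z. Re z \<le> 0 \<Longrightarrow> \<epsilon> \<le> \<bar>Im z\<bar> \<Longrightarrow> \<bar>Im z\<bar> \<le> E \<Longrightarrow> norm (f z) \<le> K * exp (k * Re z)"
    using hankel_decayD[OF dec eps, of E] by blast
  have bd: "norm (\<Phi> (Complex (- L) y1) - \<Phi> (Complex (- L) y2)) \<le> K * exp (k * (- L)) * \<bar>y1 - y2\<bar>" if "L \<ge> 0" for L
  proof -
    let ?S = "closed_segment (Complex (- L) y2) (Complex (- L) y1)"
    have S: "Re z = - L \<and> Im z \<in> closed_segment y2 y1" if z: "z \<in> ?S" for z
      using vertical_segment[OF z] by simp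
    have b: "\<epsilon> \<le> \<bar>v\<bar> \<and> \<bar>v\<bar> \<le> E" if "v \<in> closed_segment y2 y1" for v
      using that y by (auto simp: \<epsilon>_def E_def closed_segment_eq_real_ivl zero_less_mult_iff split: if_splits)
    have "norm (\<Phi> (Complex (- L) y1) - \<Phi> (Complex (- L) y2)) \<le> K * exp (k * (- L)) * norm (Complex (- L) y1 - Complex (- L) y2)"
    proof (rule field_differentiable_bound[where S = ?S and f' = f])
      fix z assume z: "z \<in> ?S"
      have "z \<in> slit T" using S[OF z] b[of "Im z"] eps by (auto simp: slit_def)
      thus "(\<Phi> has_field_derivative f z) (at z within ?S)" by (rule has_field_derivative_at_within[OF prim])
      show "norm (f z) \<le> K * exp (k * (- L))" using Kk(2)[of z] S[OF z] b[of "Im z"] that by auto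
    qed auto
    also have "norm (Complex (- L) y1 - Complex (- L) y2) = \<bar>y1 - y2\<bar>"
      by (simp add: cmod_def)
    finally show ?thesis .
  qed
  show ?thesis
  proof (rule Lim_null_comparison)
    show "\<forall>\<^sub>F L in at_top. norm (\<Phi> (Complex (- L) y1) - \<Phi> (Complex (- L) y2)) \<le> K * exp (k * (- L)) * \<bar>y1 - y2\<bar>"
      using eventually_ge_at_top[of 0] by eventually_elim (rule bd)
    have "((\<lambda>L. exp (k * (- L))) \<longlongrightarrow> 0) at_top"
      using Kk(1) by real_asymp
    thus "((\<lambda>L. K * exp (k * (- L)) * \<bar>y1 - y2\<bar>) \<longlongrightarrow> 0) at_top"
      by (intro tendsto_mult_left_zero tendsto_mult_right_zero)
  qed
qed

text \<open>Both sides are the limit of \<open>\<Phi>\<close> far to the left. The condition on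
  \<open>y1 * y2\<close> puts the two lines into the same half-plane, where a vertical segment
  joining them has an exponentially small integral.\<close>

lemma hankel_ray_primitive:
  assumes prim: "\<And>z. z \<in> slit T \<Longrightarrow> (\<Phi> has_field_derivative f z) (at z)"
    and f: "continuous_on (slit T) f" and dec: "hankel_decay f" and y: "y1 * y2 > 0"
  shows "\<Phi> (Complex a y1) - hankel_ray f a y1 = \<Phi> (Complex b y2) - hankel_ray f b y2"
proof -
  have "y1 \<noteq> 0" "y2 \<noteq> 0" using y by auto
  note l = primitive_ray_limit[OF prim f dec this(1), of a] primitive_ray_limit[OF prim f dec this(2), of b]
  from tendsto_diff[OF this] have "((\<lambda>L. \<Phi> (Complex (- L) y1) - \<Phi> (Complex (- L) y2)) \<longlongrightarrow>
      (\<Phi> (Complex a y1) - hankel_ray f a y1) - (\<Phi> (Complex b y2) - hankel_ray f b y2)) at_top" .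
  from tendsto_unique[OF _ this primitive_vertical_limit[OF prim dec y]] show ?thesis by simp
qed

lemma hankel_line_primitive:
  assumes prim: "\<And>z. z \<in> slit T \<Longrightarrow> (\<Phi> has_field_derivative f z) (at z)"
    and f: "continuous_on (slit T) f" and "c \<in> T" "\<epsilon> > 0"
  shows "hankel_line c \<epsilon> f = (\<Phi> (Complex c \<epsilon>) - hankel_ray f c \<epsilon>) - (\<Phi> (Complex c (- \<epsilon>)) - hankel_ray f c (- \<epsilon>))"
proof -
  have c: "continuous_on {0..1} (\<lambda>t. f (Complex c (\<epsilon> * (2 * t - 1))))"
    using assms by (intro continuous_on_slit_compose[OF f] continuous_intros) auto
  have "((\<lambda>t. 2 * \<i> * of_real \<epsilon> * f (Complex c (\<epsilon> * (2 * t - 1)))) has_integral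
      \<Phi> (Complex c (\<epsilon> * (2 * 1 - 1))) - \<Phi> (Complex c (\<epsilon> * (2 * 0 - 1)))) {0..1}"
  proof (rule fundamental_theorem_of_calculus)
    fix t :: real
    let ?z = "Complex c (\<epsilon> * (2 * t - 1))"
    have d: "(\<Phi> has_field_derivative f ?z) (at ?z)"
      by (rule prim) (use assms in \<open>auto simp: slit_def\<close>)
    have "((\<lambda>t. Complex c (\<epsilon> * (2 * t - 1))) has_vector_derivative (2 * \<i> * of_real \<epsilon>)) (at t within {0..1})"
      unfolding Complex_eq by (auto intro!: derivative_eq_intros simp: scaleR_conv_of_real)
    from field_vector_diff_chain_within[OF this, of \<Phi> "f ?z"] d
    show "((\<lambda>t. \<Phi> (Complex c (\<epsilon> * (2 * t - 1)))) has_vector_derivative 2 * \<i> * of_real \<epsilon> * f ?z) (at t within {0..1})"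
      by (auto simp: o_def intro: has_field_derivative_at_within)
  qed simp
  note ftc = this
  have int: "set_integrable lborel {0..1} (\<lambda>t. 2 * \<i> * of_real \<epsilon> * f (Complex c (\<epsilon> * (2 * t - 1))))"
    by (rule borel_integrable_atLeastAtMost'[OF continuous_on_mult_left[OF c]])
  have "(LINT t:{0..1}|lborel. 2 * \<i> * of_real \<epsilon> * f (Complex c (\<epsilon> * (2 * t - 1)))) = \<Phi> (Complex c \<epsilon>) - \<Phi> (Complex c (-\<epsilon>))"
    unfolding set_borel_integral_eq_integral(2)[OF int] integral_unique[OF ftc] by simp
  hence "2 * \<i> * of_real \<epsilon> * (LINT t:{0..1}|lborel. f (Complex c (\<epsilon> * (2 * t - 1)))) = \<Phi> (Complex c \<epsilon>) - \<Phi> (Complex c (-\<epsilon>))"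
    by (simp only: set_integral_mult_right)
  thus ?thesis unfolding hankel_line_def by simp
qed

text \<open>With a primitive on the whole slit domain, the path contributes only its end points.
  Combined with the half-lines these become the limits of the primitive far to the left in the two
  half-planes, which are the same for all admissible contours.\<close>

lemma hankel_integral_eq_line:
  assumes f: "f holomorphic_on slit T" and dec: "hankel_decay f"
    and T: "open T" "convex T" "c \<in> T" and \<epsilon>: "\<epsilon> > 0"
    and g: "valid_path g" "path_image g \<subseteq> slit T" "Im (pathstart g) < 0" "pathfinish g = cnj (pathstart g)"
  shows "hankel_integral g f = hankel_line c \<epsilon> f"
proof -
  note cf = holomorphic_on_imp_continuous_on[OF f]
  obtain \<Phi> where prim: "\<And>z. z \<in> slit T \<Longrightarrow> (\<Phi> has_field_derivative f z) (at z)"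
    using holomorphic_starlike_primitive[OF cf starlike_slit[OF T(3,2)] open_slit[OF T(1)], of "{}"] f
      holomorphic_on_imp_differentiable_at[OF f open_slit[OF T(1)]] by auto
  define a y where "a = Re (pathstart g)" and "y = - Im (pathstart g)"
  have ps: "pathstart g = Complex a (- y)" "pathfinish g = Complex a y" and y: "y > 0"
    using g by (auto simp: a_def y_def complex_eq_iff)
  have "contour_integral g f = \<Phi> (pathfinish g) - \<Phi> (pathstart g)"
    by (rule contour_integral_unique, rule contour_integral_primitive[OF _ g(1,2)])
       (rule has_field_derivative_at_within[OF prim])
  hence "hankel_integral g f = (\<Phi> (Complex a y) - hankel_ray f a y) - (\<Phi> (Complex a (- y)) - hankel_ray f a (- y))"
    unfolding hankel_integral_def ps hankel_ray_def by simp
  also have "\<Phi> (Complex a y) - hankel_ray f a y = \<Phi> (Complex c \<epsilon>) - hankel_ray f c \<epsilon>"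
    using y \<epsilon> by (intro hankel_ray_primitive[OF prim cf dec]) auto
  also have "\<Phi> (Complex a (- y)) - hankel_ray f a (- y) = \<Phi> (Complex c (- \<epsilon>)) - hankel_ray f c (- \<epsilon>)"
    using y \<epsilon> by (intro hankel_ray_primitive[OF prim cf dec]) auto
  finally show ?thesis using hankel_line_primitive[OF prim cf T(3) \<epsilon>] by simp
qed

lemma hankel_line_indep:
  assumes f: "f holomorphic_on slit T" and dec: "hankel_decay f"
    and T: "open T" "convex T" "c \<in> T" "c' \<in> T" and \<epsilon>: "\<epsilon> > 0" "\<epsilon>' > 0"
  shows "hankel_line c \<epsilon> f = hankel_line c' \<epsilon>' f"
proof -
  \<comment> \<open>A vertical segment is itself an admissible path; its Hankel integral is computed
    with both sets of parameters.\<close>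
  let ?g = "linepath (Complex c (- \<epsilon>)) (Complex c \<epsilon>)"
  have "path_image ?g \<subseteq> slit T"
    using T vertical_segment by (auto simp: slit_def)
  moreover have "Im (pathstart ?g) < 0" "pathfinish ?g = cnj (pathstart ?g)"
    using \<epsilon> by (auto simp: complex_eq_iff)
  ultimately show ?thesis
    using hankel_integral_eq_line[OF f dec T(1,2,3) \<epsilon>(1), of ?g] hankel_integral_eq_line[OF f dec T(1,2,4) \<epsilon>(2), of ?g]
    by simp
qed

text \<open>Integration by parts without boundary terms: as \<open>\<Phi>\<close> itself decays, its
  limits at both ends are zero.\<close>

lemma hankel_line_derivative:
  assumes prim: "\<And>z. z \<in> slit T \<Longrightarrow> (\<Phi> has_field_derivative f z) (at z)"
    and f: "continuous_on (slit T) f" and dec: "hankel_decay f" "hankel_decay \<Phi>"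
    and T: "c \<in> T" "\<epsilon> > 0"
  shows "hankel_line c \<epsilon> f = 0"
proof -
  have lim: "\<Phi> (Complex c y) - hankel_ray f c y = 0" if y: "y \<noteq> 0" for y
  proof -
    obtain K k where Kk: "k > 0" "\<And>z. Re z \<le> 0 \<Longrightarrow> \<bar>y\<bar> \<le> \<bar>Im z\<bar> \<Longrightarrow> \<bar>Im z\<bar> \<le> \<bar>y\<bar> \<Longrightarrow> norm (\<Phi> z) \<le> K * exp (k * Re z)"
      using hankel_decayD[OF dec(2) zero_less_abs_iff[THEN iffD2, OF y], of "\<bar>y\<bar>"] by blast
    have "((\<lambda>L. \<Phi> (Complex (- L) y)) \<longlongrightarrow> 0) at_top"
    proof (rule Lim_null_comparison)
      show "\<forall>\<^sub>F L in at_top. norm (\<Phi> (Complex (- L) y)) \<le> K * exp (k * (- L))"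
        using eventually_ge_at_top[of 0]
      proof eventually_elim
        case (elim L)
        thus ?case using Kk(2)[of "Complex (- L) y"] by simp
      qed
      have "((\<lambda>L. exp (k * (- L))) \<longlongrightarrow> 0) at_top" using Kk(1) by real_asymp
      thus "((\<lambda>L. K * exp (k * (- L))) \<longlongrightarrow> 0) at_top" by (rule tendsto_mult_right_zero)
    qed
    from tendsto_unique[OF _ primitive_ray_limit[OF prim f dec(1) y, of c] this] show ?thesis by simp
  qed
  show ?thesis using hankel_line_primitive[OF prim f T] lim[of "\<epsilon>"] lim[of "- \<epsilon>"] T(2) by simp
qed

section \<open>Hankel's integral for the reciprocal Gamma function\<close>

text \<open>Growth to the left slower than every exponential, on strips away from the real axis.
  Unlike a bound with one fixed rate, this is closed under products, since the rate \<open>k\<close>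
  may be split between the factors.\<close>

definition subexponential :: "(complex \<Rightarrow> complex) \<Rightarrow> bool" where
  "subexponential p \<longleftrightarrow> (\<forall>\<epsilon>>0. \<forall>E. \<forall>k>0. \<exists>K. \<forall>z. Re z \<le> 0 \<longrightarrow> \<epsilon> \<le> \<bar>Im z\<bar> \<longrightarrow> \<bar>Im z\<bar> \<le> E \<longrightarrow>
      norm (p z) \<le> K * exp (- k * Re z))"

lemma subexponentialD:
  assumes "subexponential p" "\<epsilon> > 0" "k > 0"
  shows "\<exists>K. \<forall>z. Re z \<le> 0 \<longrightarrow> \<epsilon> \<le> \<bar>Im z\<bar> \<longrightarrow> \<bar>Im z\<bar> \<le> E \<longrightarrow> norm (p z) \<le> K * exp (- k * Re z)"
  using assms unfolding subexponential_def by blast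

text \<open>Half of the rate \<open>y\<close> pays for the growth of \<open>p\<close>, the other
  half remains as decay.\<close>

lemma hankel_decay_exp_mult:
  assumes "y > 0" "subexponential p"
  shows "hankel_decay (\<lambda>z. exp (of_real y * z) * p z)"
  unfolding hankel_decay_def
proof (intro allI impI)
  fix \<epsilon> E :: real assume e: "\<epsilon> > 0"
  obtain K where K: "\<And>z. Re z \<le> 0 \<Longrightarrow> \<epsilon> \<le> \<bar>Im z\<bar> \<Longrightarrow> \<bar>Im z\<bar> \<le> E \<Longrightarrow> norm (p z) \<le> K * exp (- (y / 2) * Re z)"
    using subexponentialD[OF assms(2) e, of "y / 2" E] assms(1) by auto
  have "norm (exp (of_real y * z) * p z) \<le> K * exp (y / 2 * Re z)"
    if "Re z \<le> 0" "\<epsilon> \<le> \<bar>Im z\<bar>" "\<bar>Im z\<bar> \<le> E" for z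
  proof -
    have "norm (exp (of_real y * z) * p z) \<le> exp (y * Re z) * (K * exp (- (y / 2) * Re z))"
      using K[OF that] by (simp add: norm_mult)
    also have "\<dots> = K * (exp (y * Re z) * exp (- (y / 2) * Re z))" by simp
    also have "\<dots> = K * exp (y / 2 * Re z)" unfolding exp_add[symmetric] by (simp add: algebra_simps)
    finally show ?thesis .
  qed
  thus "\<exists>K. \<exists>k>0. \<forall>z. Re z \<le> 0 \<longrightarrow> \<epsilon> \<le> \<bar>Im z\<bar> \<longrightarrow> \<bar>Im z\<bar> \<le> E \<longrightarrow> norm (exp (of_real y * z) * p z) \<le> K * exp (k * Re z)"
    using assms(1) by (intro exI[of _ K] exI[of _ "y / 2"]) auto
qed

lemma subexponential_mult:
  assumes "subexponential p" "subexponential q"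
  shows "subexponential (\<lambda>z. p z * q z)"
  unfolding subexponential_def
proof (intro allI impI)
  fix \<epsilon> E k :: real assume e: "\<epsilon> > 0" "k > 0"
  obtain K where K: "\<And>z. Re z \<le> 0 \<Longrightarrow> \<epsilon> \<le> \<bar>Im z\<bar> \<Longrightarrow> \<bar>Im z\<bar> \<le> E \<Longrightarrow> norm (p z) \<le> K * exp (- (k / 2) * Re z)"
    using subexponentialD[OF assms(1) e(1), of "k / 2" E] e(2) by auto
  obtain K' where K': "\<And>z. Re z \<le> 0 \<Longrightarrow> \<epsilon> \<le> \<bar>Im z\<bar> \<Longrightarrow> \<bar>Im z\<bar> \<le> E \<Longrightarrow> norm (q z) \<le> K' * exp (- (k / 2) * Re z)"
    using subexponentialD[OF assms(2) e(1), of "k / 2" E] e(2) by auto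
  have "norm (p z * q z) \<le> K * K' * exp (- k * Re z)"
    if "Re z \<le> 0" "\<epsilon> \<le> \<bar>Im z\<bar>" "\<bar>Im z\<bar> \<le> E" for z
  proof -
    have "norm (p z * q z) \<le> (K * exp (- (k / 2) * Re z)) * (K' * exp (- (k / 2) * Re z))"
      unfolding norm_mult using K[OF that] K'[OF that]
      by (intro mult_mono) (auto intro: order_trans[OF norm_ge_zero])
    also have "\<dots> = K * K' * (exp (- (k / 2) * Re z) * exp (- (k / 2) * Re z))" by simp
    also have "\<dots> = K * K' * exp (- k * Re z)" unfolding exp_add[symmetric] by (simp add: algebra_simps)
    finally show ?thesis .
  qed
  thus "\<exists>K. \<forall>z. Re z \<le> 0 \<longrightarrow> \<epsilon> \<le> \<bar>Im z\<bar> \<longrightarrow> \<bar>Im z\<bar> \<le> E \<longrightarrow> norm (p z * q z) \<le> K * exp (- k * Re z)" by blast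
qed

lemma subexponential_add:
  assumes "subexponential p" "subexponential q"
  shows "subexponential (\<lambda>z. p z + q z)"
  unfolding subexponential_def
proof (intro allI impI)
  fix \<epsilon> E k :: real assume e: "\<epsilon> > 0" "k > 0"
  obtain K where K: "\<And>z. Re z \<le> 0 \<Longrightarrow> \<epsilon> \<le> \<bar>Im z\<bar> \<Longrightarrow> \<bar>Im z\<bar> \<le> E \<Longrightarrow> norm (p z) \<le> K * exp (- k * Re z)"
    using subexponentialD[OF assms(1) e, of E] by auto
  obtain K' where K': "\<And>z. Re z \<le> 0 \<Longrightarrow> \<epsilon> \<le> \<bar>Im z\<bar> \<Longrightarrow> \<bar>Im z\<bar> \<le> E \<Longrightarrow> norm (q z) \<le> K' * exp (- k * Re z)"
    using subexponentialD[OF assms(2) e, of E] by auto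
  have "norm (p z + q z) \<le> (K + K') * exp (- k * Re z)"
    if "Re z \<le> 0" "\<epsilon> \<le> \<bar>Im z\<bar>" "\<bar>Im z\<bar> \<le> E" for z
    using norm_triangle_ineq[of "p z" "q z"] K[OF that] K'[OF that] by (simp add: distrib_right)
  thus "\<exists>K. \<forall>z. Re z \<le> 0 \<longrightarrow> \<epsilon> \<le> \<bar>Im z\<bar> \<longrightarrow> \<bar>Im z\<bar> \<le> E \<longrightarrow> norm (p z + q z) \<le> K * exp (- k * Re z)" by blast
qed

lemma subexponential_const: "subexponential (\<lambda>_. c)"
  unfolding subexponential_def
proof (intro allI impI exI)
  fix k :: real and z :: complex assume "k > 0" "Re z \<le> 0"
  hence "exp 0 \<le> exp (- k * Re z)" unfolding exp_le_cancel_iff by (simp add: mult_nonneg_nonpos)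
  thus "norm c \<le> norm c * exp (- k * Re z)" by (simp add: mult_le_cancel_left1)
qed

text \<open>The principal argument is at most pi in absolute value, which bounds the contribution of
  the imaginary part of the exponent.\<close>

lemma norm_powr_le:
  assumes "z \<noteq> 0"
  shows "norm (z powr s) \<le> norm z powr Re s * exp (pi * \<bar>Im s\<bar>)"
proof -
  have "norm (z powr s) = exp (Re s * ln (norm z) - Im s * Im (Ln z))"
    using assms by (simp add: powr_def)
  also have "\<dots> \<le> exp (Re s * ln (norm z) + pi * \<bar>Im s\<bar>)"
  proof -
    have "\<bar>Im s * Im (Ln z)\<bar> \<le> \<bar>Im s\<bar> * pi"
      unfolding abs_mult using mpi_less_Im_Ln[OF assms] Im_Ln_le_pi[OF assms]
      by (intro mult_left_mono) auto
    thus ?thesis by (simp add: mult.commute)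
  qed
  also have "\<dots> = norm z powr Re s * exp (pi * \<bar>Im s\<bar>)"
    using assms by (simp add: powr_def exp_add)
  finally show ?thesis .
qed

lemma powr_le_exp:
  assumes "\<epsilon> > 0" "k > (0::real)"
  shows "\<exists>K\<ge>0. \<forall>u\<ge>\<epsilon>. u powr q \<le> K * exp (k * u)"
proof (cases "q > 0")
  case True
  \<comment> \<open>With this scale the tangent bound
    \<open>ln (\<delta> * u) \<le> \<delta> * u - 1\<close>, multiplied by \<open>q\<close>, has
    exactly the slope \<open>k\<close> in \<open>u\<close>.\<close>
  define \<delta> where "\<delta> = k / q"
  have d: "\<delta> > 0" using True assms by (simp add: \<delta>_def)
  have "u powr q \<le> exp (- q - q * ln \<delta>) * exp (k * u)" if "u \<ge> \<epsilon>" for u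
  proof -
    have u: "u > 0" using that assms by simp
    have "ln u = ln (\<delta> * u) - ln \<delta>" using d u by (simp add: ln_mult)
    also have "ln (\<delta> * u) \<le> \<delta> * u - 1" using d u by (intro ln_le_minus_one) auto
    finally have "q * ln u \<le> q * (\<delta> * u - 1 - ln \<delta>)" using True by (intro mult_left_mono) auto
    also have "\<dots> = (- q - q * ln \<delta>) + k * u" using True by (simp add: \<delta>_def field_simps)
    finally show ?thesis using u by (simp add: powr_def exp_add[symmetric])
  qed
  thus ?thesis by (intro exI[of _ "exp (- q - q * ln \<delta>)"]) auto
next
  case False
  have "u powr q \<le> \<epsilon> powr q * exp (k * u)" if "u \<ge> \<epsilon>" for u
  proof -
    have "u powr q \<le> \<epsilon> powr q" using False that assms by (intro powr_mono2') auto
    also have "\<dots> \<le> \<epsilon> powr q * exp (k * u)" using assms that by (simp add: mult_le_cancel_left1)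
    finally show ?thesis .
  qed
  thus ?thesis by (intro exI[of _ "\<epsilon> powr q"]) auto
qed

text \<open>\<open>w\<close> stands for \<open>z\<close>, \<open>z - 1\<close> or
  \<open>1 - z\<close>: the distance to the real axis is kept and the modulus grows by at most
  1.\<close>

lemma subexponential_powr:
  assumes w: "\<And>z. \<bar>Im (w z)\<bar> = \<bar>Im z\<bar>" "\<And>z. norm (w z) \<le> norm z + 1"
  shows "subexponential (\<lambda>z. w z powr s)"
  unfolding subexponential_def
proof (intro allI impI)
  fix \<epsilon> E k :: real assume e: "\<epsilon> > 0" "k > 0"
  obtain K where K: "K \<ge> 0" "\<And>u. u \<ge> \<epsilon> \<Longrightarrow> u powr Re s \<le> K * exp (k * u)"
    using powr_le_exp[OF e] by blast
  have "norm (w z powr s) \<le> K * exp (k * (E + 1)) * exp (pi * \<bar>Im s\<bar>) * exp (- k * Re z)"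
    if "Re z \<le> 0" "\<epsilon> \<le> \<bar>Im z\<bar>" "\<bar>Im z\<bar> \<le> E" for z
  proof -
    have ge: "norm (w z) \<ge> \<epsilon>" using abs_Im_le_cmod[of "w z"] w(1)[of z] that by linarith
    hence nz: "w z \<noteq> 0" using e by auto
    have "norm (w z) \<le> - Re z + E + 1" using w(2)[of z] cmod_le[of z] that by linarith
    hence le: "k * norm (w z) \<le> k * (E + 1) - k * Re z"
      using e mult_left_mono[of "norm (w z)" "- Re z + E + 1" k] by (simp add: algebra_simps)
    have "norm (w z powr s) \<le> norm (w z) powr Re s * exp (pi * \<bar>Im s\<bar>)" by (rule norm_powr_le[OF nz])
    also have "\<dots> \<le> (K * exp (k * norm (w z))) * exp (pi * \<bar>Im s\<bar>)"
      using K(2)[OF ge] by (intro mult_right_mono) auto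
    also have "\<dots> \<le> (K * exp (k * (E + 1) - k * Re z)) * exp (pi * \<bar>Im s\<bar>)"
      using K(1) le by (intro mult_right_mono mult_left_mono) auto
    also have "\<dots> = K * exp (k * (E + 1)) * exp (pi * \<bar>Im s\<bar>) * exp (- k * Re z)"
      by (simp add: exp_diff exp_minus field_simps)
    finally show ?thesis .
  qed
  thus "\<exists>K. \<forall>z. Re z \<le> 0 \<longrightarrow> \<epsilon> \<le> \<bar>Im z\<bar> \<longrightarrow> \<bar>Im z\<bar> \<le> E \<longrightarrow> norm (w z powr s) \<le> K * exp (- k * Re z)" by blast
qed

lemma subexponential_powr_id: "subexponential (\<lambda>z. z powr s)"
  by (rule subexponential_powr) auto

definition hankel_kernel :: "complex \<Rightarrow> complex \<Rightarrow> complex" where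
  "hankel_kernel s z = exp z * z powr (- s)"

lemma slit_pos_not_nonpos: "z \<in> slit {0<..} \<Longrightarrow> z \<notin> \<real>\<^sub>\<le>\<^sub>0"
  by (auto simp: slit_def complex_nonpos_Reals_iff)

lemma hankel_kernel_holomorphic: "hankel_kernel s holomorphic_on slit {0<..}"
  unfolding hankel_kernel_def[abs_def]
  by (intro holomorphic_intros) (auto dest: slit_pos_not_nonpos)

lemma hankel_kernel_decay: "hankel_decay (hankel_kernel s)"
  using hankel_decay_exp_mult[of 1, OF _ subexponential_powr_id[of "-s"]] by (simp add: hankel_kernel_def[abs_def])

lemma norm_hankel_kernel_le:
  assumes "z \<noteq> 0"
  shows "norm (hankel_kernel s z) \<le> exp (Re z) * norm z powr (- Re s) * exp (pi * \<bar>Im s\<bar>)"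
  unfolding hankel_kernel_def norm_mult norm_exp_eq_Re using norm_powr_le[OF assms, of "-s"]
  by (simp add: mult.assoc)

text \<open>\<open>\<kappa>\<close> names the half-plane. Passing from \<open>z\<close> to
  \<open>- z\<close> moves the cut away from the negative axis, so the right-hand side extends
  continuously to that axis and the values on its two banks can be compared.\<close>

lemma powr_uminus_half_plane:
  assumes "\<kappa> = 1 \<or> \<kappa> = -1" "\<kappa> * Im z > 0"
  shows "z powr s = exp (of_real \<kappa> * \<i> * of_real pi * s) * (- z) powr s"
proof -
  have nz: "z \<noteq> 0" using assms by auto
  have "Ln z = Ln (- z) + of_real \<kappa> * \<i> * of_real pi"
    using assms Ln_minus[OF nz] by auto
  thus ?thesis using nz by (simp add: powr_def exp_add[symmetric] algebra_simps)
qed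

text \<open>
  For \<open>Re s < 1\<close> the kernel is integrable at \<open>0\<close>, so the contour can be collapsed onto the
  branch cut, where it takes the values \<open>exp (\<plusminus> i \<pi> s)\<close> times the Gamma integrand.
\<close>

lemma hankel_ray_collapse:
  assumes s: "0 \<le> Re s" "Re s < 1" and \<kappa>: "\<kappa> = 1 \<or> \<kappa> = -1"
  defines "e \<equiv> \<lambda>n. inverse (real (Suc n))"
  shows "(\<lambda>n. hankel_ray (hankel_kernel s) (e n) (\<kappa> * e n)) \<longlonglongrightarrow> exp (- of_real \<kappa> * \<i> * of_real pi * s) * Gamma (1 - s)"
proof -
  have e: "e n > 0" "e n \<le> 1" for n by (auto simp: e_def field_simps)
  have e0: "e \<longlonglongrightarrow> 0" unfolding e_def by (rule LIMSEQ_inverse_real_of_nat)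
  define C where "C = exp (- of_real \<kappa> * \<i> * of_real pi * s)"
  define g where "g = (\<lambda>x::real. indicator {0<..} (0 + (-1) * x) *\<^sub>R (of_real (0 + (-1) * x) powr (- s) * exp (- complex_of_real (0 + (-1) * x))))"
  have g_int: "(LINT x|lborel. C * g x) = C * Gamma (1 - s)"
  proof -
    have "Gamma (1 - s) = (LINT t|lborel. indicator {0<..} t *\<^sub>R (of_real t powr (- s) * exp (- complex_of_real t)))"
      using Gamma_set_integral(2)[of "1 - s"] s by (simp add: set_lebesgue_integral_def)
    also have "\<dots> = \<bar>-1\<bar> *\<^sub>R (LINT x|lborel. g x)" unfolding g_def
      by (rule lborel_integral_real_affine) auto
    finally show ?thesis by simp
  qed
  \<comment> \<open>The real majorant on one half-axis; together with its mirror image it covers the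
    line without the origin.\<close>
  define h where "h = (\<lambda>t::real. indicator {0<..} t *\<^sub>R (t powr (- Re s) * exp (- t)))"
  have hi: "integrable lborel h"
  proof -
    have "set_integrable lborel {0<..} (\<lambda>t. of_real t powr (of_real (1 - Re s) - 1) * exp (- complex_of_real t))"
      by (rule Gamma_set_integral(1)) (use s in auto)
    hence "set_integrable lborel {0<..} (\<lambda>t. norm (of_real t powr (of_real (1 - Re s) - 1) * exp (- complex_of_real t)))"
      by (rule set_integrable_norm)
    also have "?this \<longleftrightarrow> set_integrable lborel {0<..} (\<lambda>t. t powr (- Re s) * exp (- t))"
      by (intro set_integrable_cong) (auto simp: norm_mult norm_powr_real_powr)
    finally show ?thesis by (simp add: h_def set_integrable_def)
  qed
  have hi': "integrable lborel (\<lambda>x. h (0 + (-1) * x))"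
    using lborel_integrable_real_affine[OF hi, of "-1" 0] by simp
  define M where "M = exp (pi * \<bar>Im s\<bar>)"
  have "(\<lambda>n. LINT x|lborel. indicator {..e n} x *\<^sub>R hankel_kernel s (Complex x (\<kappa> * e n))) \<longlonglongrightarrow> (LINT x|lborel. C * g x)"
  proof (rule integral_dominated_convergence[where w = "\<lambda>x. M * exp 2 * (h x + h (0 + (-1) * x))"])
    show "(\<lambda>x. C * g x) \<in> borel_measurable lborel"
      unfolding g_def by measurable
    show "(\<lambda>x. indicator {..e n} x *\<^sub>R hankel_kernel s (Complex x (\<kappa> * e n))) \<in> borel_measurable lborel" for n
      unfolding hankel_kernel_def Complex_eq by measurable
    show "integrable lborel (\<lambda>x. M * exp 2 * (h x + h (0 + (-1) * x)))"
      using hi hi' by (intro integrable_mult_right Bochner_Integration.integrable_add)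
    \<comment> \<open>The origin, where the kernel may be singular in the limit, is discarded as a
      null set.\<close>
    have nz: "AE x in lborel. x \<noteq> (0::real)" by (rule AE_lborel_singleton)
    show "AE x in lborel. (\<lambda>n. indicator {..e n} x *\<^sub>R hankel_kernel s (Complex x (\<kappa> * e n))) \<longlonglongrightarrow> C * g x"
      using nz
    proof eventually_elim
      case (elim x)
      show ?case
      proof (cases "x > 0")
        case True
        have "\<forall>\<^sub>F n in sequentially. e n < x" using e0 True by (rule order_tendstoD(2))
        hence "\<forall>\<^sub>F n in sequentially. indicator {..e n} x *\<^sub>R hankel_kernel s (Complex x (\<kappa> * e n)) = C * g x"
          by eventually_elim (use True in \<open>auto simp: g_def indicator_def\<close>)
        thus ?thesis by (rule tendsto_eventually)
      next
        case False
        hence x: "x < 0" using elim by simp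
        have "indicator {..e n} x *\<^sub>R hankel_kernel s (Complex x (\<kappa> * e n)) =
            exp (Complex x (\<kappa> * e n)) * (C * (- Complex x (\<kappa> * e n)) powr (- s))" for n
          using x e[of n] \<kappa> powr_uminus_half_plane[of \<kappa> "Complex x (\<kappa> * e n)" "- s"]
          by (auto simp: hankel_kernel_def C_def indicator_def)
        moreover have "(\<lambda>n. exp (Complex x (\<kappa> * e n)) * (C * (- Complex x (\<kappa> * e n)) powr (- s))) \<longlonglongrightarrow>
            exp (Complex x (\<kappa> * 0)) * (C * (- Complex x (\<kappa> * 0)) powr (- s))"
          by (intro tendsto_intros e0 tendsto_Complex) (use x in \<open>auto simp: complex_nonpos_Reals_iff\<close>)
        moreover have "exp (Complex x (\<kappa> * 0)) * (C * (- Complex x (\<kappa> * 0)) powr (- s)) = C * g x"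
          using x by (simp add: g_def Complex_eq)
        ultimately show ?thesis by (simp only:)
      qed
    qed
    show "AE x in lborel. norm (indicator {..e n} x *\<^sub>R hankel_kernel s (Complex x (\<kappa> * e n))) \<le> M * exp 2 * (h x + h (0 + (-1) * x))" for n
      using nz
    proof eventually_elim
      case (elim x)
      have hn: "h t \<ge> 0" for t by (simp add: h_def indicator_def)
      have hh: "h x + h (0 + (-1) * x) = \<bar>x\<bar> powr (- Re s) * exp (- \<bar>x\<bar>)"
        using elim by (auto simp: h_def indicator_def)
      show ?case
      proof (cases "x \<le> e n")
        case True
        let ?z = "Complex x (\<kappa> * e n)"
        have z: "?z \<noteq> 0" using elim by (auto simp: complex_eq_iff)
        have "norm (hankel_kernel s ?z) \<le> exp (Re ?z) * norm ?z powr (- Re s) * exp (pi * \<bar>Im s\<bar>)"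
          by (rule norm_hankel_kernel_le[OF z])
        also have "\<dots> \<le> (exp 2 * exp (- \<bar>x\<bar>)) * \<bar>x\<bar> powr (- Re s) * exp (pi * \<bar>Im s\<bar>)"
        proof (intro mult_mono mult_right_mono)
          \<comment> \<open>For positive \<open>x\<close> the inequality amounts to
            \<open>2 * x \<le> 2\<close>, which holds because \<open>x \<le> e n \<le> 1\<close>;
            this is the origin of \<open>exp 2\<close>.\<close>
          show "exp (Re ?z) \<le> exp 2 * exp (- \<bar>x\<bar>)"
            unfolding exp_add[symmetric] using True e(2)[of n] by simp
          show "norm ?z powr (- Re s) \<le> \<bar>x\<bar> powr (- Re s)"
            using elim s abs_Re_le_cmod[of ?z] by (intro powr_mono2') auto
        qed auto
        finally show ?thesis unfolding hh M_def using True by (simp add: mult_ac)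
      next
        case False
        thus ?thesis using hn[of x] hn[of "0 + (-1) * x"] by (simp add: M_def)
      qed
    qed
  qed
  from this[unfolded g_int] show ?thesis unfolding hankel_ray_def set_lebesgue_integral_def C_def .
qed

text \<open>The contour shrinks with \<open>e n\<close>, without changing the integral. The vertical
  segment has length \<open>2 * e n\<close> and an integrand of order
  \<open>e n powr (- Re s)\<close>, so it disappears for \<open>Re s < 1\<close>. The two banks
  leave \<open>2 * \<i> * sin (pi * s) * Gamma (1 - s)\<close>, and the reflection formula
  finishes.\<close>

lemma hankel_gamma_strip:
  assumes s: "0 \<le> Re s" "Re s < 1"
  shows "hankel_line 1 1 (hankel_kernel s) = 2 * of_real pi * \<i> * rGamma s"
proof -
  define e where "e = (\<lambda>n. inverse (real (Suc n)))"
  have e: "e n > 0" "e n \<le> 1" for n by (auto simp: e_def field_simps)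
  have e0: "e \<longlonglongrightarrow> 0" unfolding e_def by (rule LIMSEQ_inverse_real_of_nat)
  define V where "V = (\<lambda>n. 2 * \<i> * of_real (e n) * (LINT t:{0..1}|lborel. hankel_kernel s (Complex (e n) (e n * (2 * t - 1)))))"
  define M where "M = exp 1 * exp (pi * \<bar>Im s\<bar>)"
  have V: "norm (V n) \<le> 2 * M * e n powr (1 - Re s)" for n
  proof -
    let ?z = "\<lambda>t. Complex (e n) (e n * (2 * t - 1))"
    have c: "continuous_on {0..1} (\<lambda>t. hankel_kernel s (?z t))"
      using e[of n] by (intro continuous_on_slit_compose[OF holomorphic_on_imp_continuous_on[OF hankel_kernel_holomorphic]] continuous_intros) auto
    note i = borel_integrable_atLeastAtMost'[OF c]
    have "norm (LINT t:{0..1}|lborel. hankel_kernel s (?z t)) \<le> (LINT t:{0..1}|lborel. norm (hankel_kernel s (?z t)))"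
      by (rule set_integral_norm_bound[OF i])
    also have "\<dots> \<le> (LINT t:{0..1::real}|lborel. M * e n powr (- Re s))"
    proof (rule set_integral_mono)
      show "set_integrable lborel {0..1::real} (\<lambda>t. M * e n powr (- Re s))"
        by (rule borel_integrable_atLeastAtMost') auto
      fix t :: real
      have z: "?z t \<noteq> 0" using e[of n] by (auto simp: complex_eq_iff)
      have "norm (hankel_kernel s (?z t)) \<le> exp (Re (?z t)) * norm (?z t) powr (- Re s) * exp (pi * \<bar>Im s\<bar>)"
        by (rule norm_hankel_kernel_le[OF z])
      also have "\<dots> \<le> exp 1 * e n powr (- Re s) * exp (pi * \<bar>Im s\<bar>)"
      proof (intro mult_mono mult_right_mono)
        show "norm (?z t) powr (- Re s) \<le> e n powr (- Re s)"
          using s e[of n] abs_Re_le_cmod[of "?z t"] by (intro powr_mono2') auto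
      qed (use e[of n] in auto)
      finally show "norm (hankel_kernel s (?z t)) \<le> M * e n powr (- Re s)" by (simp add: M_def mult_ac)
    qed (rule set_integrable_norm[OF i])
    also have "\<dots> = M * e n powr (- Re s)" by (simp add: set_lebesgue_integral_def)
    finally have "norm (V n) \<le> 2 * e n * (M * e n powr (- Re s))"
      unfolding V_def using e[of n] by (simp add: norm_mult)
    also have "\<dots> = 2 * M * (e n powr 1 * e n powr (- Re s))" using e[of n] by simp
    also have "\<dots> = 2 * M * e n powr (1 - Re s)" unfolding powr_add[symmetric] by simp
    finally show ?thesis .
  qed
  have V0: "V \<longlonglongrightarrow> 0"
  proof (rule Lim_null_comparison)
    show "\<forall>\<^sub>F n in sequentially. norm (V n) \<le> 2 * M * e n powr (1 - Re s)" using V by simp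
    have "(\<lambda>n. e n powr (1 - Re s)) \<longlonglongrightarrow> 0 powr (1 - Re s)"
      using e0 s e(1) by (intro tendsto_powr') (auto intro!: always_eventually less_imp_le)
    thus "(\<lambda>n. 2 * M * e n powr (1 - Re s)) \<longlonglongrightarrow> 0"
      using s by (intro tendsto_mult_right_zero) simp
  qed
  have "hankel_line 1 1 (hankel_kernel s) = hankel_line (e n) (e n) (hankel_kernel s)" for n
    by (rule hankel_line_indep[OF hankel_kernel_holomorphic hankel_kernel_decay]) (use e[of n] in auto)
  hence "(\<lambda>n. hankel_line 1 1 (hankel_kernel s)) = (\<lambda>n. hankel_ray (hankel_kernel s) (e n) ((-1) * e n) + V n - hankel_ray (hankel_kernel s) (e n) (1 * e n))"
    by (simp add: hankel_line_def V_def)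
  also have "\<dots> \<longlonglongrightarrow> exp (- of_real (-1) * \<i> * of_real pi * s) * Gamma (1 - s) + 0 - exp (- of_real 1 * \<i> * of_real pi * s) * Gamma (1 - s)"
    unfolding e_def by (intro tendsto_intros hankel_ray_collapse s V0[unfolded e_def]) auto
  finally have "hankel_line 1 1 (hankel_kernel s) = exp (\<i> * of_real pi * s) * Gamma (1 - s) - exp (- (\<i> * of_real pi * s)) * Gamma (1 - s)"
    by (simp add: LIMSEQ_const_iff)
  also have "\<dots> = 2 * \<i> * sin (of_real pi * s) * Gamma (1 - s)"
    by (simp add: sin_exp_eq field_simps)
  also have "\<dots> = 2 * of_real pi * \<i> * rGamma s"
  proof -
    have "1 - s \<notin> \<int>\<^sub>\<le>\<^sub>0"
    proof
      assume "1 - s \<in> \<int>\<^sub>\<le>\<^sub>0"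
      then obtain n where n: "1 - s = of_int n" "n \<le> 0" by (elim nonpos_Ints_cases)
      have "1 - Re s = of_int n" using arg_cong[OF n(1), of Re] by simp
      thus False using n(2) s by linarith
    qed
    hence "rGamma (1 - s) \<noteq> 0" by (simp add: rGamma_eq_zero_iff)
    moreover have "rGamma s * rGamma (1 - s) = sin (of_real pi * s) / of_real pi" by (rule rGamma_reflection_complex)
    ultimately show ?thesis by (simp add: Gamma_def field_simps)
  qed
  finally show ?thesis .
qed

lemma hankel_line_cmult: "hankel_line c \<epsilon> (\<lambda>z. a * f z) = a * hankel_line c \<epsilon> f"
  by (simp add: hankel_line_def hankel_ray_def algebra_simps)

lemma hankel_line_diff:
  assumes "continuous_on (slit T) f" "hankel_decay f" "continuous_on (slit T) g" "hankel_decay g" "c \<in> T" "\<epsilon> > 0"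
  shows "hankel_line c \<epsilon> (\<lambda>z. f z - g z) = hankel_line c \<epsilon> f - hankel_line c \<epsilon> g"
proof -
  have r: "hankel_ray (\<lambda>z. f z - g z) c y = hankel_ray f c y - hankel_ray g c y" if "y \<noteq> 0" for y
    unfolding hankel_ray_def using that assms by (intro set_integral_diff ray_integrable)
  have v: "(LINT t:{0..1}|lborel. f (Complex c (\<epsilon> * (2 * t - 1))) - g (Complex c (\<epsilon> * (2 * t - 1)))) =
      (LINT t:{0..1}|lborel. f (Complex c (\<epsilon> * (2 * t - 1)))) - (LINT t:{0..1}|lborel. g (Complex c (\<epsilon> * (2 * t - 1))))"
    using assms by (intro set_integral_diff(2) borel_integrable_atLeastAtMost' continuous_on_slit_compose[OF assms(1)]
      continuous_on_slit_compose[OF assms(3)] continuous_intros) auto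
  show ?thesis unfolding hankel_line_def v using r[of \<epsilon>] r[of "-\<epsilon>"] assms(6) by (simp add: algebra_simps)
qed

text \<open>The derivative of the kernel is
  \<open>hankel_kernel s z - s * hankel_kernel (s + 1) z\<close>, and a total derivative integrates
  to zero. This mirrors the functional equation of \<open>rGamma\<close>.\<close>

lemma hankel_gamma_rec:
  "hankel_line 1 1 (hankel_kernel s) = s * hankel_line 1 1 (hankel_kernel (s + 1))"
proof -
  have hol: "continuous_on (slit {0<..}) (hankel_kernel s)" for s
    by (intro holomorphic_on_imp_continuous_on hankel_kernel_holomorphic)
  have dec: "hankel_decay (\<lambda>z. s * hankel_kernel (s + 1) z)"
    using hankel_decay_exp_mult[of 1, OF _ subexponential_mult[OF subexponential_const[of s] subexponential_powr_id[of "-(s+1)"]]]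
    by (simp add: hankel_kernel_def[abs_def] mult_ac)
  have dec2: "hankel_decay (\<lambda>z. hankel_kernel s z - s * hankel_kernel (s + 1) z)"
    using hankel_decay_exp_mult[of 1, OF _ subexponential_add[OF subexponential_powr_id[of "-s"] subexponential_mult[OF subexponential_const[of "-s"] subexponential_powr_id[of "-(s+1)"]]]]
    by (simp add: hankel_kernel_def[abs_def] algebra_simps)
  have "hankel_line 1 1 (\<lambda>z. hankel_kernel s z - s * hankel_kernel (s + 1) z) = 0"
  proof (rule hankel_line_derivative[OF _ _ dec2 hankel_kernel_decay[of s]])
    show "(hankel_kernel s has_field_derivative hankel_kernel s z - s * hankel_kernel (s + 1) z) (at z)"
      if "z \<in> slit {0<..}" for z
    proof -
      have "((\<lambda>z. exp z * z powr t) has_field_derivative exp z * z powr t + t * (exp z * z powr (t - 1))) (at z)" for t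
        using slit_pos_not_nonpos[OF that] by (auto intro!: derivative_eq_intros)
      from this[of "- s"] show ?thesis by (simp add: hankel_kernel_def[abs_def])
    qed
    show "continuous_on (slit {0<..}) (\<lambda>z. hankel_kernel s z - s * hankel_kernel (s + 1) z)"
      by (intro continuous_intros hol)
  qed auto
  moreover have "hankel_line 1 1 (\<lambda>z. hankel_kernel s z - s * hankel_kernel (s + 1) z) =
      hankel_line 1 1 (hankel_kernel s) - hankel_line 1 1 (\<lambda>z. s * hankel_kernel (s + 1) z)"
    by (rule hankel_line_diff[where T = "{0<..}"]) (auto intro!: hol hankel_kernel_decay dec continuous_intros)
  ultimately show ?thesis by (simp add: hankel_line_cmult)
qed

text \<open>At \<open>s = 1\<close> the recurrence degenerates, hence the passage to the limit.\<close>

lemma hankel_gamma_one: "hankel_line 1 1 (hankel_kernel 1) = 2 * of_real pi * \<i>"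
proof -
  \<comment> \<open>A real sequence that approaches 1 inside the strip on which the formula is
    already known.\<close>
  define s where "s = (\<lambda>n. 1 - complex_of_real (inverse (real (Suc n))))"
  have s1: "s \<longlonglongrightarrow> 1 - complex_of_real 0"
    unfolding s_def by (intro tendsto_intros LIMSEQ_inverse_real_of_nat)
  have s: "0 \<le> Re (s n)" "Re (s n) < 1" "Im (s n) = 0" for n by (auto simp: s_def field_simps)
  have cont: "continuous_on (slit {0<..}) (hankel_kernel s)" for s
    by (intro holomorphic_on_imp_continuous_on hankel_kernel_holomorphic)
  have lim: "(\<lambda>n. hankel_kernel (s n) z) \<longlonglongrightarrow> hankel_kernel 1 z" if "z \<in> slit {0<..}" for z
  proof -
    have "(\<lambda>n. hankel_kernel (s n) z) \<longlonglongrightarrow> hankel_kernel (1 - complex_of_real 0) z"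
      unfolding hankel_kernel_def by (intro tendsto_intros s1 disjI1 slit_pos_not_nonpos[OF that])
    thus ?thesis by simp
  qed
  \<comment> \<open>The contour with corners \<open>1 - \<i>\<close> and \<open>1 + \<i>\<close>
    stays outside the open unit disc. There the power has modulus at most 1 for all
    \<open>n\<close>, which leaves the exponential as a common majorant.\<close>
  have bd: "norm (hankel_kernel (s n) z) \<le> exp (Re z)" if "norm z \<ge> 1" for n z
  proof -
    have nz: "z \<noteq> 0" using that by auto
    have "norm z powr (- Re (s n)) \<le> norm z powr 0"
      using that s by (intro powr_mono) auto
    hence "exp (Re z) * norm z powr (- Re (s n)) \<le> exp (Re z) * 1"
      using nz by (intro mult_left_mono) auto
    moreover have "norm (hankel_kernel (s n) z) \<le> exp (Re z) * norm z powr (- Re (s n))"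
      using norm_hankel_kernel_le[OF nz, of "s n"] s(3)[of n] by simp
    ultimately show ?thesis by linarith
  qed
  have ray: "(\<lambda>n. hankel_ray (hankel_kernel (s n)) 1 y) \<longlonglongrightarrow> hankel_ray (hankel_kernel 1) 1 y" if y: "\<bar>y\<bar> = 1" for y
    unfolding hankel_ray_def
  proof (rule set_integral_dominated_convergence[where w = "\<lambda>x. exp (1 * x)"])
    show "set_integrable lborel {..1} (\<lambda>x::real. exp (1 * x))" by (rule set_integrable_exp_Iic) simp
    show "continuous_on {..1} (\<lambda>x. hankel_kernel (s n) (Complex x y))" for n
      using y by (intro continuous_on_slit_compose[OF cont] continuous_intros) auto
    show "continuous_on {..1} (\<lambda>x. hankel_kernel 1 (Complex x y))"
      using y by (intro continuous_on_slit_compose[OF cont] continuous_intros) auto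
    show "(\<lambda>n. hankel_kernel (s n) (Complex x y)) \<longlonglongrightarrow> hankel_kernel 1 (Complex x y)" for x
      using y by (intro lim) (auto simp: slit_def)
    show "norm (hankel_kernel (s n) (Complex x y)) \<le> exp (1 * x)" for n x
      using bd[of "Complex x y" n] abs_Im_le_cmod[of "Complex x y"] y by simp
  qed simp
  have vert: "(\<lambda>n. LINT t:{0..1}|lborel. hankel_kernel (s n) (Complex 1 (1 * (2 * t - 1)))) \<longlonglongrightarrow>
      (LINT t:{0..1}|lborel. hankel_kernel 1 (Complex 1 (1 * (2 * t - 1))))"
  proof (rule set_integral_dominated_convergence[where w = "\<lambda>x. exp 1"])
    show "set_integrable lborel {0..1} (\<lambda>x::real. exp 1 :: real)" by (rule borel_integrable_atLeastAtMost') auto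
    show "continuous_on {0..1} (\<lambda>t. hankel_kernel (s n) (Complex 1 (1 * (2 * t - 1))))" for n
      by (intro continuous_on_slit_compose[OF cont] continuous_intros) auto
    show "continuous_on {0..1} (\<lambda>t. hankel_kernel 1 (Complex 1 (1 * (2 * t - 1))))"
      by (intro continuous_on_slit_compose[OF cont] continuous_intros) auto
    show "(\<lambda>n. hankel_kernel (s n) (Complex 1 (1 * (2 * t - 1)))) \<longlonglongrightarrow> hankel_kernel 1 (Complex 1 (1 * (2 * t - 1)))" for t
      by (intro lim) (auto simp: slit_def)
    show "norm (hankel_kernel (s n) (Complex 1 (1 * (2 * t - 1)))) \<le> exp 1" for n t
      using bd[of "Complex 1 (1 * (2 * t - 1))" n] abs_Re_le_cmod[of "Complex 1 (1 * (2 * t - 1))"] by simp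
  qed simp
  have "(\<lambda>n. hankel_line 1 1 (hankel_kernel (s n))) \<longlonglongrightarrow> hankel_line 1 1 (hankel_kernel 1)"
    unfolding hankel_line_def by (intro tendsto_intros ray vert) auto
  moreover have "(\<lambda>n. hankel_line 1 1 (hankel_kernel (s n))) \<longlonglongrightarrow> 2 * of_real pi * \<i> * rGamma 1"
  proof -
    have "(\<lambda>n. 2 * of_real pi * \<i> * rGamma (s n)) \<longlonglongrightarrow> 2 * of_real pi * \<i> * rGamma (1 - complex_of_real 0)"
      by (intro tendsto_intros isCont_tendsto_compose[OF isCont_rGamma[OF continuous_ident]] s1)
    thus ?thesis by (simp add: hankel_gamma_strip[OF s(1,2)])
  qed
  ultimately have "hankel_line 1 1 (hankel_kernel 1) = 2 * of_real pi * \<i> * rGamma 1" by (rule LIMSEQ_unique)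
  thus ?thesis by simp
qed

text \<open>Induction on an integer bound for the real part: both sides obey the same functional
  equation, in which the factor \<open>s - 1\<close> can be cancelled except at
  \<open>s = 1\<close>.\<close>

lemma hankel_gamma_unit:
  assumes "0 \<le> Re s"
  shows "hankel_line 1 1 (hankel_kernel s) = 2 * of_real pi * \<i> * rGamma s"
proof -
  have main: "hankel_line 1 1 (hankel_kernel s) = 2 * of_real pi * \<i> * rGamma s" if "0 \<le> Re s" "Re s < real n + 1" for n s
    using that
  proof (induction n arbitrary: s)
    case 0
    thus ?case by (intro hankel_gamma_strip) auto
  next
    case (Suc n)
    consider "Re s < 1" | "s = 1" | "Re s \<ge> 1" "s \<noteq> 1" by linarith
    thus ?case
    proof cases
      case 1
      thus ?thesis using Suc.prems by (intro hankel_gamma_strip) auto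
    next
      case 2
      thus ?thesis by (simp add: hankel_gamma_one)
    next
      case 3
      have "(s - 1) * hankel_line 1 1 (hankel_kernel s) = hankel_line 1 1 (hankel_kernel (s - 1))"
        using hankel_gamma_rec[of "s - 1"] by simp
      also have "\<dots> = 2 * of_real pi * \<i> * rGamma (s - 1)" using 3 Suc.prems by (intro Suc.IH) auto
      also have "rGamma (s - 1) = (s - 1) * rGamma s" using rGamma_plus1[of "s - 1"] by simp
      finally show ?thesis using 3(2) by simp
    qed
  qed
  obtain n :: nat where "Re s < real n" using reals_Archimedean2 by blast
  hence "Re s < real n + 1" by linarith
  from main[OF assms this] show ?thesis .
qed

lemma hankel_line_scale:
  assumes y: "y > 0"
  shows "hankel_line c \<epsilon> (\<lambda>z. f (of_real y * z)) = hankel_line (y * c) (y * \<epsilon>) f / of_real y"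
proof -
  have cm: "of_real y * Complex x v = Complex (y * x) (y * v)" for x v
    by (simp add: complex_eq_iff)
  have r: "hankel_ray (\<lambda>z. f (of_real y * z)) c v = hankel_ray f (y * c) (y * v) / of_real y" for v
  proof -
    have "hankel_ray f (y * c) (y * v) = \<bar>y\<bar> *\<^sub>R (LINT x|lborel. indicator {..y * c} (0 + y * x) *\<^sub>R f (Complex (0 + y * x) (y * v)))"
      unfolding hankel_ray_def set_lebesgue_integral_def
      by (rule lborel_integral_real_affine) (use y in auto)
    also have "(LINT x|lborel. indicator {..y * c} (0 + y * x) *\<^sub>R f (Complex (0 + y * x) (y * v))) = hankel_ray (\<lambda>z. f (of_real y * z)) c v"
      unfolding hankel_ray_def set_lebesgue_integral_def cm
      using y by (intro Bochner_Integration.integral_cong) (auto simp: indicator_def)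
    finally show ?thesis using y by (simp add: scaleR_conv_of_real)
  qed
  show ?thesis
    unfolding hankel_line_def r cm using y by (simp add: field_simps)
qed

text \<open>The inverse Laplace transform of a power. The rate \<open>y\<close> is kept free, since
  it will be \<open>x\<close> for the functions of the first kind and \<open>x + t\<close> for those
  of the second.\<close>

lemma hankel_gamma:
  assumes y: "y > 0" and s: "0 \<le> Re s" and c: "c > 0" "\<epsilon> > 0"
  shows "hankel_line c \<epsilon> (\<lambda>z. exp (of_real y * z) * z powr (- s)) =
    2 * of_real pi * \<i> * rGamma s * of_real y powr (s - 1)"
proof -
  have eq: "exp (of_real y * z) * z powr (- s) = of_real y powr s * hankel_kernel s (of_real y * z)" for z
  proof (cases "z = 0")
    case False
    have "(of_real y * z) powr (- s) = of_real y powr (- s) * z powr (- s)"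
      using y by (intro powr_times_real_left) auto
    thus ?thesis using y by (simp add: hankel_kernel_def powr_minus field_simps)
  qed (simp add: hankel_kernel_def)
  have "hankel_line c \<epsilon> (\<lambda>z. exp (of_real y * z) * z powr (- s)) = of_real y powr s * (hankel_line (y * c) (y * \<epsilon>) (hankel_kernel s) / of_real y)"
    unfolding eq hankel_line_cmult hankel_line_scale[OF y] ..
  also have "hankel_line (y * c) (y * \<epsilon>) (hankel_kernel s) = hankel_line 1 1 (hankel_kernel s)"
    by (rule hankel_line_indep[OF hankel_kernel_holomorphic hankel_kernel_decay]) (use y c in auto)
  also have "\<dots> = 2 * of_real pi * \<i> * rGamma s" by (rule hankel_gamma_unit[OF s])
  finally show ?thesis using y by (simp add: powr_diff field_simps)
qed

section \<open>Kummer functions\<close>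

text \<open>The trace of the contour of \<open>hankel_line\<close>. The estimates for series and
  parameter integrals hold only there: they need \<open>z\<close> to stay large, or its real part to
  stay below 1.\<close>

definition hankel_points :: "real \<Rightarrow> real \<Rightarrow> complex set" where
  "hankel_points c \<epsilon> = {z. Re z \<le> c \<and> \<bar>Im z\<bar> = \<epsilon> \<or> Re z = c \<and> \<bar>Im z\<bar> \<le> \<epsilon>}"

lemma hankel_points_ray: "x \<le> c \<Longrightarrow> \<bar>y\<bar> = \<epsilon> \<Longrightarrow> Complex x y \<in> hankel_points c \<epsilon>"
  by (simp add: hankel_points_def)

lemma hankel_points_vertical:
  assumes "0 \<le> t" "t \<le> 1" "\<epsilon> > 0" shows "Complex c (\<epsilon> * (2 * t - 1)) \<in> hankel_points c \<epsilon>"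
proof -
  have "\<bar>2 * t - 1\<bar> \<le> 1" using assms by auto
  hence "\<epsilon> * \<bar>2 * t - 1\<bar> \<le> \<epsilon> * 1" using assms by (intro mult_left_mono) auto
  thus ?thesis using assms by (simp add: hankel_points_def abs_mult)
qed

lemma hankel_points_slit: "c \<in> T \<Longrightarrow> \<epsilon> > 0 \<Longrightarrow> hankel_points c \<epsilon> \<subseteq> slit T"
  by (auto simp: hankel_points_def slit_def)

lemma hankel_line_cong:
  assumes "\<And>z. z \<in> hankel_points c \<epsilon> \<Longrightarrow> f z = g z" "\<epsilon> > 0"
  shows "hankel_line c \<epsilon> f = hankel_line c \<epsilon> g"
proof -
  have r: "hankel_ray f c y = hankel_ray g c y" if "\<bar>y\<bar> = \<epsilon>" for y
    unfolding hankel_ray_def using that by (intro set_lebesgue_integral_cong) (auto intro!: assms hankel_points_ray)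
  have v: "(LINT t:{0..1}|lborel. f (Complex c (\<epsilon> * (2 * t - 1)))) = (LINT t:{0..1}|lborel. g (Complex c (\<epsilon> * (2 * t - 1))))"
    using assms by (intro set_lebesgue_integral_cong) (auto intro!: assms hankel_points_vertical)
  show ?thesis unfolding hankel_line_def v using r[of \<epsilon>] r[of "-\<epsilon>"] assms(2) by simp
qed

lemma hankel_line_sums:
  assumes f: "\<And>k. continuous_on (slit T) (f k)" and c: "c \<in> T" "\<epsilon> > 0" and x: "x > 0" and B: "summable B"
    and bd: "\<And>k z. z \<in> hankel_points c \<epsilon> \<Longrightarrow> norm (f k z) \<le> B k * exp (x * Re z)"
    and F: "\<And>z. z \<in> hankel_points c \<epsilon> \<Longrightarrow> (\<lambda>k. f k z) sums F z"
  shows "(\<lambda>k. hankel_line c \<epsilon> (f k)) sums hankel_line c \<epsilon> F"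
proof -
  have r: "(\<lambda>k. hankel_ray (f k) c y) sums hankel_ray F c y" if y: "\<bar>y\<bar> = \<epsilon>" for y
    unfolding hankel_ray_def
  proof (rule set_integral_sums[OF _ _ set_integrable_exp_Iic[OF x] B])
    show "continuous_on {..c} (\<lambda>u. f k (Complex u y))" for k
      using y c by (intro continuous_on_slit_compose[OF f] continuous_intros) auto
    show "norm (f k (Complex u y)) \<le> B k * exp (x * u)" if "u \<in> {..c}" for k u
      using bd[OF hankel_points_ray[of u c y \<epsilon>]] that y by simp
    show "(\<lambda>k. f k (Complex u y)) sums F (Complex u y)" if "u \<in> {..c}" for u
      using F[OF hankel_points_ray[of u c y \<epsilon>]] that y by simp
  qed simp
  have v: "(\<lambda>k. LINT t:{0..1}|lborel. f k (Complex c (\<epsilon> * (2 * t - 1)))) sums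
      (LINT t:{0..1}|lborel. F (Complex c (\<epsilon> * (2 * t - 1))))"
  proof (rule set_integral_sums[OF _ _ _ B, where w = "\<lambda>_. exp (x * c)"])
    show "set_integrable lborel {0..1::real} (\<lambda>_. exp (x * c))" by (rule borel_integrable_atLeastAtMost') auto
    show "continuous_on {0..1} (\<lambda>t. f k (Complex c (\<epsilon> * (2 * t - 1))))" for k
      using c by (intro continuous_on_slit_compose[OF f] continuous_intros) auto
    show "norm (f k (Complex c (\<epsilon> * (2 * t - 1)))) \<le> B k * exp (x * c)" if "t \<in> {0..1}" for k t
      using bd[OF hankel_points_vertical[of t \<epsilon> c]] that c by simp
    show "(\<lambda>k. f k (Complex c (\<epsilon> * (2 * t - 1)))) sums F (Complex c (\<epsilon> * (2 * t - 1)))" if "t \<in> {0..1}" for t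
      using F[OF hankel_points_vertical[of t \<epsilon> c]] that c by simp
  qed simp
  show ?thesis unfolding hankel_line_def using c by (intro sums_add sums_diff sums_mult r v) auto
qed

text \<open>The points \<open>z\<close>, \<open>1 - 1 / z\<close> and their product
  \<open>z - 1\<close> lie in the same open half-plane or all on the positive axis. Hence the
  principal logarithms add without a multiple of \<open>2 * pi * \<i>\<close>.\<close>

lemma powr_minus_one_factor:
  assumes z: "z \<in> slit {1<..}" "norm z > 1"
  shows "(z - 1) powr s = z powr s * (1 - 1 / z) powr s"
proof -
  let ?w = "1 - 1 / z"
  have nz: "z \<noteq> 0" using z by auto
  have w: "?w \<noteq> 0" using z nz by (auto simp: field_simps)
  have zw: "z * ?w = z - 1" using nz by (simp add: field_simps)
  have z1: "z - 1 \<noteq> 0" using z by auto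
  have imw: "Im ?w = Im z / (norm z)\<^sup>2" using nz by (simp add: Im_divide cmod_power2)
  have imp: "Im (Ln u) < 0" if "Im u < 0" for u
    using Im_Ln_pos_le[of u] Im_Ln_le_pi[of u] that by (cases "u = 0") force+
  have "Ln (z - 1) = Ln z + Ln ?w"
  proof (cases "Im z = 0")
    case True
    hence r: "Re z > 1" "z = of_real (Re z)" using z by (auto simp: slit_def complex_eq_iff)
    have w': "?w = of_real (1 - 1 / Re z)" by (subst r(2)) simp
    have "Im (Ln z) = 0" unfolding Im_Ln_eq_0[OF nz] using r(1) True by simp
    moreover have "Im (Ln ?w) = 0" unfolding Im_Ln_eq_0[OF w] using r(1) by (simp add: w')
    ultimately show ?thesis using Ln_times[OF nz w] unfolding zw by (simp add: pi_gt_zero not_le)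
  next
    case False
    have n2: "(norm z)\<^sup>2 > 0" using nz by simp
    consider "Im z > 0" | "Im z < 0" using False by linarith
    thus ?thesis
    proof cases
      case 1
      hence "Im ?w > 0" unfolding imw using n2 1 by (intro divide_pos_pos)
      note a = Im_Ln_pos_lt_imp[OF 1] Im_Ln_pos_lt_imp[OF this]
      have "Im (Ln (z - 1)) > 0" using Im_Ln_pos_lt_imp[of "z - 1"] 1 by simp
      with Ln_times[OF nz w] a show ?thesis unfolding zw by (auto split: if_splits)
    next
      case 2
      hence "Im ?w < 0" unfolding imw using n2 2 by (intro divide_neg_pos)
      note a = imp[OF 2] imp[OF this]
      have "Im (Ln (z - 1)) < 0" using imp[of "z - 1"] 2 by simp
      with Ln_times[OF nz w] a mpi_less_Im_Ln[OF nz] mpi_less_Im_Ln[OF w]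
      show ?thesis unfolding zw using pi_gt_zero by (auto split: if_splits)
    qed
  qed
  thus ?thesis using nz w z1 by (simp add: powr_def exp_add[symmetric] algebra_simps)
qed

section \<open>Functions of the first kind: the regularised Kummer series\<close>

lemma gbinomial_uminus: "(- a gchoose k) * (- w) ^ k = pochhammer a k / fact k * (w :: complex) ^ k"
  by (simp add: gbinomial_pochhammer power_minus[of w] mult_ac)

lemma pochhammer_power_summable:
  "summable (\<lambda>k. norm (pochhammer a k / fact k :: complex) * (1 / 2) ^ k)"
proof -
  \<comment> \<open>Convergence of the binomial series at 3/4 is traded for absolute convergence at
    the smaller radius 1/2, the largest value of \<open>norm (1 / z)\<close> on the contour used
    below.\<close>
  have "summable (\<lambda>k. (- a gchoose k) * (- (3 / 4) :: complex) ^ k)"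
    using gen_binomial_complex[of "- (3 / 4)" "- a"] by (simp add: sums_iff)
  hence "summable (\<lambda>k. pochhammer a k / fact k * (3 / 4 :: complex) ^ k)" by (simp only: gbinomial_uminus)
  from powser_insidea[OF this, of "1 / 2"] show ?thesis by (simp add: norm_mult norm_power norm_divide)
qed

definition kummer_coeff :: "complex \<Rightarrow> real \<Rightarrow> nat \<Rightarrow> complex" where
  "kummer_coeff a b k = pochhammer a k / fact k * rGamma (a + of_real b + of_nat k)"

text \<open>The regularised confluent hypergeometric function 1F1(a; a + b; x) / \<Gamma>(a + b).
  The difference \<open>b\<close> of its parameters serves as index because it is real and moves in
  unit steps with the state.\<close>

definition kummer_y :: "complex \<Rightarrow> real \<Rightarrow> complex \<Rightarrow> complex" where
  "kummer_y a b x = (\<Sum>k. kummer_coeff a b k * x ^ k)"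

text \<open>Adding \<open>b \<ge> 0\<close> to a number with positive real part increases its
  modulus, so the Pochhammer symbol of \<open>a\<close> is dominated by that of
  \<open>a + of_real b\<close>. The latter cancels against the reciprocal Gamma factor and leaves
  the exponential series.\<close>

lemma norm_kummer_coeff_le:
  assumes a: "Re a > 0" and b: "b \<ge> 0"
  shows "norm (kummer_coeff a b k) \<le> norm (rGamma (a + of_real b)) / fact k"
proof -
  have le: "norm (pochhammer a k) \<le> norm (pochhammer (a + of_real b) k)"
    unfolding pochhammer_prod prod_norm[symmetric]
  proof (intro prod_mono conjI norm_ge_zero)
    fix i
    have "norm (a + of_nat i) = sqrt ((Re a + i)\<^sup>2 + (Im a)\<^sup>2)" by (simp add: cmod_def)
    also have "\<dots> \<le> sqrt ((Re a + b + i)\<^sup>2 + (Im a)\<^sup>2)" using a b by (simp add: power_mono)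
    also have "\<dots> = norm (a + of_real b + of_nat i)" by (simp add: cmod_def)
    finally show "norm (a + of_nat i) \<le> norm (a + of_real b + of_nat i)" .
  qed
  have "norm (kummer_coeff a b k) = norm (pochhammer a k) * norm (rGamma (a + of_real b + of_nat k)) / fact k"
    by (simp add: kummer_coeff_def norm_mult norm_divide)
  also have "\<dots> \<le> norm (pochhammer (a + of_real b) k) * norm (rGamma (a + of_real b + of_nat k)) / fact k"
    using le by (intro divide_right_mono mult_right_mono) auto
  also have "\<dots> = norm (rGamma (a + of_real b)) / fact k"
    by (subst (2) pochhammer_rGamma[of _ k]) (simp add: norm_mult)
  finally show ?thesis .
qed

lemma kummer_y_sums:
  assumes a: "Re a > 0" and b: "b \<ge> 0"
  shows "(\<lambda>k. kummer_coeff a b k * x ^ k) sums kummer_y a b x"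
    and "norm (kummer_y a b x) \<le> norm (rGamma (a + of_real b)) * exp (norm x)"
proof -
  let ?G = "norm (rGamma (a + of_real b))"
  have e: "(\<lambda>k. ?G * (norm x ^ k / fact k)) sums (?G * exp (norm x))"
    using exp_converges[of "norm x"] by (intro sums_mult) (simp add: divide_inverse mult.commute)
  have bd: "norm (kummer_coeff a b k * x ^ k) \<le> ?G * (norm x ^ k / fact k)" for k
    using mult_right_mono[OF norm_kummer_coeff_le[OF a b, of k], of "norm x ^ k"]
    by (simp add: norm_mult norm_power)
  have sm: "summable (\<lambda>k. kummer_coeff a b k * x ^ k)"
    by (rule summable_comparison_test'[OF sums_summable[OF e], of 0]) (rule bd)
  thus "(\<lambda>k. kummer_coeff a b k * x ^ k) sums kummer_y a b x" unfolding kummer_y_def by (rule summable_sums)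
  have "norm (kummer_y a b x) \<le> (\<Sum>k. ?G * (norm x ^ k / fact k))"
    unfolding kummer_y_def by (rule norm_suminf_le[OF bd sums_summable[OF e]])
  also have "\<dots> = ?G * exp (norm x)" using e by (simp add: sums_iff)
  finally show "norm (kummer_y a b x) \<le> ?G * exp (norm x)" .
qed

text \<open>Write the new Pochhammer factor \<open>a + k\<close> as \<open>(a + b + k) - b\<close>;
  the first part lowers the argument of \<open>rGamma\<close> by one. Summed up, this is the formula
  for the derivative.\<close>

lemma kummer_coeff_Suc:
  "of_nat (Suc k) * kummer_coeff a b (Suc k) = kummer_coeff a b k - of_real b * kummer_coeff a (b + 1) k"
proof -
  define g where "g = rGamma (a + of_real b + of_nat k + 1)"
  have g: "rGamma (a + of_real b + of_nat k) = (a + of_real b + of_nat k) * g"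
    unfolding g_def by (rule rGamma_plus1[symmetric])
  have "of_nat (Suc k) * kummer_coeff a b (Suc k) = pochhammer a k / fact k * (a + of_nat k) * g"
    using of_nat_neq_0[where ?'a = complex, of k] by (simp add: kummer_coeff_def pochhammer_Suc g_def add_ac)
  also have "\<dots> = kummer_coeff a b k - of_real b * kummer_coeff a (b + 1) k"
    unfolding kummer_coeff_def g by (simp add: g_def algebra_simps add_divide_distrib)
  finally show ?thesis .
qed

lemma kummer_coeff_shift:
  "kummer_coeff a b k = (a + of_real b + of_nat k) * kummer_coeff a (b + 1) k"
  using rGamma_plus1[of "a + of_real b + of_nat k"] by (simp add: kummer_coeff_def add_ac mult_ac)

lemma kummer_y_derivative:
  assumes a: "Re a > 0" and b: "b \<ge> 0"
  shows "(kummer_y a b has_field_derivative kummer_y a b x - of_real b * kummer_y a (b + 1) x) (at x)"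
proof -
  have "((\<lambda>x. \<Sum>k. kummer_coeff a b k * x ^ k) has_field_derivative (\<Sum>k. diffs (kummer_coeff a b) k * x ^ k)) (at x)"
    using kummer_y_sums(1)[OF a b] by (intro termdiffs_strong_converges_everywhere) (auto simp: sums_iff)
  also have "(\<lambda>k. diffs (kummer_coeff a b) k * x ^ k) = (\<lambda>k. kummer_coeff a b k * x ^ k - of_real b * (kummer_coeff a (b + 1) k * x ^ k))"
    by (simp add: diffs_def kummer_coeff_Suc algebra_simps del: of_nat_Suc)
  also have "suminf \<dots> = kummer_y a b x - of_real b * kummer_y a (b + 1) x"
    using kummer_y_sums(1)[OF a b] kummer_y_sums(1)[OF a, of "b + 1"] b
    by (intro sums_unique[symmetric] sums_diff sums_mult) auto
  finally show ?thesis by (simp add: kummer_y_def[abs_def])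
qed

text \<open>Both sides are \<open>x\<close> times the derivative of
  \<open>kummer_y a (b + 1)\<close>: on the left by the derivative formula, on the right
  coefficientwise, since lowering \<open>b + 1\<close> to \<open>b\<close> multiplies the
  coefficient of index \<open>k\<close> by \<open>a + b + k\<close>.\<close>

lemma kummer_y_contiguous:
  assumes a: "Re a > 0" and b: "b \<ge> 0"
  shows "x * (kummer_y a (b + 1) x - of_real (b + 1) * kummer_y a (b + 2) x) = kummer_y a b x - (a + of_real b) * kummer_y a (b + 1) x"
proof -
  let ?c = "kummer_coeff a (b + 1)"
  have b1: "b + 1 \<ge> 0" "b + 2 \<ge> 0" using b by auto
  have b2: "b + 1 + 1 = b + 2" by simp
  have "(\<lambda>k. x * (?c k * x ^ k - of_real (b + 1) * (kummer_coeff a (b + 2) k * x ^ k))) sums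
      (x * (kummer_y a (b + 1) x - of_real (b + 1) * kummer_y a (b + 2) x))"
    by (intro sums_mult sums_diff kummer_y_sums a b1)
  also have "(\<lambda>k. x * (?c k * x ^ k - of_real (b + 1) * (kummer_coeff a (b + 2) k * x ^ k))) = (\<lambda>k. of_nat (Suc k) * ?c (Suc k) * x ^ Suc k)"
    unfolding kummer_coeff_Suc b2 by (simp add: algebra_simps)
  finally have A: "(\<lambda>k. of_nat k * ?c k * x ^ k) sums (x * (kummer_y a (b + 1) x - of_real (b + 1) * kummer_y a (b + 2) x))"
    by (subst (asm) sums_Suc_iff) simp
  have "(\<lambda>k. kummer_coeff a b k * x ^ k - (a + of_real b) * (?c k * x ^ k)) sums (kummer_y a b x - (a + of_real b) * kummer_y a (b + 1) x)"
    by (intro sums_mult sums_diff kummer_y_sums a b b1)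
  also have "(\<lambda>k. kummer_coeff a b k * x ^ k - (a + of_real b) * (?c k * x ^ k)) = (\<lambda>k. of_nat k * ?c k * x ^ k)"
  proof
    fix k
    show "kummer_coeff a b k * x ^ k - (a + of_real b) * (?c k * x ^ k) = of_nat k * ?c k * x ^ k"
      unfolding kummer_coeff_shift[of a b k] by (simp add: algebra_simps)
  qed
  finally show ?thesis using A by (rule sums_unique2[symmetric])
qed

text \<open>On this contour \<open>norm z \<ge> 2\<close>, so the expansion of
  \<open>(1 - 1 / z) powr (- a)\<close> in powers of \<open>1 / z\<close> converges uniformly, and
  each term is a Hankel integral with exponent \<open>a + b + k\<close>.\<close>

lemma hankel_line_kummer:
  assumes a: "Re a > 0" and b: "b \<ge> 0" and x: "x > 0"
  shows "hankel_line 2 2 (\<lambda>z. exp (of_real x * z) * ((z - 1) powr (- a) * z powr (- of_real b))) =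
    2 * of_real pi * \<i> * of_real x powr (a + of_real b - 1) * kummer_y a b (of_real x)"
proof -
  define c where "c = (\<lambda>k. pochhammer a k / fact k)"
  define f where "f = (\<lambda>k z. c k * (exp (of_real x * z) * z powr (- (a + of_real b + of_nat k))))"
  have sl: "hankel_points 2 2 \<subseteq> slit {1<..}" by (rule hankel_points_slit) auto
  have n2: "norm z \<ge> 2" if "z \<in> hankel_points 2 2" for z
    using that abs_Re_le_cmod[of z] abs_Im_le_cmod[of z] by (auto simp: hankel_points_def)
  have "(\<lambda>k. hankel_line 2 2 (f k)) sums hankel_line 2 2 (\<lambda>z. exp (of_real x * z) * ((z - 1) powr (- a) * z powr (- of_real b)))"
  proof (rule hankel_line_sums[where T = "{1<..}" and x = x])
    show "continuous_on (slit {1<..}) (f k)" for k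
      unfolding f_def by (intro continuous_intros) (auto simp: slit_def complex_nonpos_Reals_iff)
    show "summable (\<lambda>k. exp (pi * \<bar>Im a\<bar>) * (norm (c k) * (1 / 2) ^ k))"
      unfolding c_def by (intro summable_mult pochhammer_power_summable)
    fix z assume z: "z \<in> hankel_points 2 2"
    have nz: "z \<noteq> 0" using n2[OF z] by auto
    show "norm (f k z) \<le> exp (pi * \<bar>Im a\<bar>) * (norm (c k) * (1 / 2) ^ k) * exp (x * Re z)" for k
    proof -
      have "norm (z powr (- (a + of_real b + of_nat k))) \<le> norm z powr Re (- (a + of_real b + of_nat k)) * exp (pi * \<bar>Im (- (a + of_real b + of_nat k))\<bar>)"
        by (rule norm_powr_le[OF nz])
      also have "\<dots> \<le> (1 / 2) ^ k * exp (pi * \<bar>Im a\<bar>)"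
      proof (intro mult_mono)
        have "norm z powr Re (- (a + of_real b + of_nat k)) \<le> norm z powr (- real k)"
          using n2[OF z] a b by (intro powr_mono) auto
        also have "\<dots> \<le> 2 powr (- real k)" using n2[OF z] by (intro powr_mono2') auto
        also have "\<dots> = (1 / 2) ^ k" by (simp add: powr_minus powr_realpow field_simps)
        finally show "norm z powr Re (- (a + of_real b + of_nat k)) \<le> (1 / 2) ^ k" .
      qed auto
      finally have "norm (c k) * (exp (x * Re z) * norm (z powr (- (a + of_real b + of_nat k)))) \<le> norm (c k) * (exp (x * Re z) * ((1 / 2) ^ k * exp (pi * \<bar>Im a\<bar>)))"
        by (intro mult_left_mono) auto
      thus ?thesis by (simp add: f_def norm_mult mult_ac)
    qed
    show "(\<lambda>k. f k z) sums (exp (of_real x * z) * ((z - 1) powr (- a) * z powr (- of_real b)))"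
    proof -
      have "norm (- (1 / z)) < 1" using n2[OF z] nz by (simp add: norm_divide field_simps)
      from gen_binomial_complex[OF this, of "- a"]
      have "(\<lambda>k. c k * (1 / z) ^ k) sums ((1 - 1 / z) powr (- a))"
        by (simp only: gbinomial_uminus c_def diff_conv_add_uminus)
      from sums_mult[OF this, of "exp (of_real x * z) * (z powr (- a) * z powr (- of_real b))"]
      have "(\<lambda>k. exp (of_real x * z) * (z powr (- a) * z powr (- of_real b)) * (c k * (1 / z) ^ k)) sums
        (exp (of_real x * z) * (z powr (- a) * z powr (- of_real b)) * (1 - 1 / z) powr (- a))" .
      also have "exp (of_real x * z) * (z powr (- a) * z powr (- of_real b)) * (1 - 1 / z) powr (- a) =
          exp (of_real x * z) * ((z - 1) powr (- a) * z powr (- of_real b))"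
        using powr_minus_one_factor[of z "- a"] sl z n2[OF z] by auto
      also have "(\<lambda>k. exp (of_real x * z) * (z powr (- a) * z powr (- of_real b)) * (c k * (1 / z) ^ k)) = (\<lambda>k. f k z)"
      proof
        fix k
        have "z powr (- (a + of_real b + of_nat k)) = z powr (- a + - of_real b + - of_nat k)" by simp
        also have "\<dots> = z powr (- a) * z powr (- of_real b) * (1 / z) ^ k"
          unfolding powr_add using nz by (simp add: powr_minus powr_nat' field_simps)
        finally show "exp (of_real x * z) * (z powr (- a) * z powr (- of_real b)) * (c k * (1 / z) ^ k) = f k z"
          by (simp add: f_def mult_ac)
      qed
      finally show ?thesis .
    qed
  qed (use x in auto)
  moreover have "hankel_line 2 2 (f k) = 2 * of_real pi * \<i> * of_real x powr (a + of_real b - 1) * (kummer_coeff a b k * of_real x ^ k)" for k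
  proof -
    have "hankel_line 2 2 (f k) = c k * (2 * of_real pi * \<i> * rGamma (a + of_real b + of_nat k) * of_real x powr (a + of_real b + of_nat k - 1))"
      unfolding f_def hankel_line_cmult by (subst hankel_gamma[OF x]) (use a b in auto)
    also have "of_real x powr (a + of_real b + of_nat k - 1) = of_real x powr (a + of_real b - 1 + of_nat k)"
      by (simp add: algebra_simps)
    also have "\<dots> = of_real x powr (a + of_real b - 1) * of_real x ^ k" unfolding powr_add using x by (simp add: powr_nat')
    finally show ?thesis by (simp add: c_def kummer_coeff_def mult_ac)
  qed
  ultimately have "(\<lambda>k. 2 * of_real pi * \<i> * of_real x powr (a + of_real b - 1) * (kummer_coeff a b k * of_real x ^ k)) sums
      hankel_line 2 2 (\<lambda>z. exp (of_real x * z) * ((z - 1) powr (- a) * z powr (- of_real b)))" by simp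
  from sums_unique2[OF this sums_mult[OF kummer_y_sums(1)[OF a b]]] show ?thesis .
qed

section \<open>Functions of the second kind: Laplace-type integrals\<close>

lemma set_integral_swap:
  fixes F :: "real \<Rightarrow> real \<Rightarrow> complex"
  assumes S: "S \<in> sets borel" "U \<in> sets borel"
    and F: "continuous_on (S \<times> U) (\<lambda>(x, t). F x t)"
    and p: "set_integrable lborel S p" and q: "set_integrable lborel U q"
    and bd: "\<And>x t. x \<in> S \<Longrightarrow> t \<in> U \<Longrightarrow> norm (F x t) \<le> p x * (q t :: real)"
  shows "(LINT x:S|lborel. LINT t:U|lborel. F x t) = (LINT t:U|lborel. LINT x:S|lborel. F x t)"
    and "set_integrable lborel U (\<lambda>t. LINT x:S|lborel. F x t)"
proof -
  define F' where "F' = (\<lambda>x t. indicator (S \<times> U) (x, t) *\<^sub>R F x t)"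
  define p' where "p' = (\<lambda>x. indicator S x *\<^sub>R p x)"
  define q' where "q' = (\<lambda>t. indicator U t *\<^sub>R q t)"
  have p': "integrable lborel p'" and q': "integrable lborel q'"
    using p q by (simp_all add: p'_def q'_def set_integrable_def)
  have SU: "S \<times> U \<in> sets borel" using S by (rule borel_Times)
  have m: "(\<lambda>(x, t). F' x t) \<in> borel_measurable (lborel \<Otimes>\<^sub>M lborel)"
    unfolding lborel_prod F'_def using borel_measurable_continuous_on_indicator[OF SU F] by (simp add: case_prod_beta')
  have pq: "integrable (lborel \<Otimes>\<^sub>M lborel) (\<lambda>(x, t). p' x * q' t)"
  proof (rule lborel_pair.Fubini_integrable)
    show "(\<lambda>(x, t). p' x * q' t) \<in> borel_measurable (lborel \<Otimes>\<^sub>M lborel)"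
      using borel_measurable_integrable[OF p'] borel_measurable_integrable[OF q'] by measurable
    show "integrable lborel (\<lambda>x. LINT y|lborel. norm (case (x, y) of (x, t) \<Rightarrow> p' x * q' t))"
      using p' q' by (simp add: abs_mult)
    show "AE x in lborel. integrable lborel (\<lambda>y. case (x, y) of (x, t) \<Rightarrow> p' x * q' t)"
      using q' by (intro AE_I2) simp
  qed
  have int: "integrable (lborel \<Otimes>\<^sub>M lborel) (\<lambda>(x, t). F' x t)"
  proof (rule Bochner_Integration.integrable_bound[OF pq m], rule AE_I2)
    fix z :: "real \<times> real"
    obtain x t where z: "z = (x, t)" by (cases z)
    show "norm (case z of (x, t) \<Rightarrow> F' x t) \<le> norm (case z of (x, t) \<Rightarrow> p' x * q' t)"
      using bd[of x t] by (auto simp: z F'_def p'_def q'_def indicator_def intro: order_trans[OF _ abs_ge_self])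
  qed
  have e1: "(LINT t|lborel. F' x t) = indicator S x *\<^sub>R (LINT t:U|lborel. F x t)" for x
    unfolding F'_def set_lebesgue_integral_def
    by (cases "x \<in> S") (auto intro!: Bochner_Integration.integral_cong simp: indicator_def)
  have e2: "(LINT x|lborel. F' x t) = indicator U t *\<^sub>R (LINT x:S|lborel. F x t)" for t
    unfolding F'_def set_lebesgue_integral_def
    by (cases "t \<in> U") (auto intro!: Bochner_Integration.integral_cong simp: indicator_def)
  show "(LINT x:S|lborel. LINT t:U|lborel. F x t) = (LINT t:U|lborel. LINT x:S|lborel. F x t)"
    using lborel_pair.Fubini_integral[OF int] by (simp add: e1 e2 set_lebesgue_integral_def)
  show "set_integrable lborel U (\<lambda>t. LINT x:S|lborel. F x t)"
    using lborel_pair.integrable_snd[OF int] by (simp add: e2 set_integrable_def)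
qed

lemma hankel_line_swap:
  fixes F :: "complex \<Rightarrow> real \<Rightarrow> complex"
  assumes F: "continuous_on (slit T \<times> {0<..}) (\<lambda>(z, t). F z t)"
    and c: "c \<in> T" "\<epsilon> > 0" and x: "x > 0" and Q: "set_integrable lborel {0<..} Q"
    and bd: "\<And>z t. z \<in> hankel_points c \<epsilon> \<Longrightarrow> t > 0 \<Longrightarrow> norm (F z t) \<le> exp (x * Re z) * Q t"
  shows "hankel_line c \<epsilon> (\<lambda>z. LINT t:{0<..}|lborel. F z t) = (LINT t:{0<..}|lborel. hankel_line c \<epsilon> (\<lambda>z. F z t))"
proof -
  have cont: "continuous_on (S \<times> {0<..}) (\<lambda>(s, t). F (Complex (u s) (v s)) t)"
    if u: "continuous_on S u" and v: "continuous_on S v" and uv: "\<And>s. s \<in> S \<Longrightarrow> v s \<noteq> 0 \<or> u s \<in> T" for S u v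
  proof -
    have c1: "continuous_on (S \<times> {0<..}) (\<lambda>z. u (fst z))" "continuous_on (S \<times> {0<..}) (\<lambda>z. v (fst z))"
      by (rule continuous_on_compose2[OF u continuous_on_fst[OF continuous_on_id]], auto)
         (rule continuous_on_compose2[OF v continuous_on_fst[OF continuous_on_id]], auto)
    have c2: "continuous_on (S \<times> {0<..}) (\<lambda>z. (Complex (u (fst z)) (v (fst z)), snd z))"
      by (intro continuous_intros c1)
    have "(\<lambda>z. (Complex (u (fst z)) (v (fst z)), snd z)) ` (S \<times> {0<..}) \<subseteq> slit T \<times> {0<..}"
      using uv by (auto simp: slit_def)
    from continuous_on_compose2[OF F c2 this] show ?thesis by (simp add: case_prod_beta')
  qed
  have r: "hankel_ray (\<lambda>z. LINT t:{0<..}|lborel. F z t) c y = (LINT t:{0<..}|lborel. hankel_ray (\<lambda>z. F z t) c y)"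
    "set_integrable lborel {0<..} (\<lambda>t. hankel_ray (\<lambda>z. F z t) c y)" if y: "\<bar>y\<bar> = \<epsilon>" for y
    unfolding hankel_ray_def
  proof -
    have *: "continuous_on ({..c} \<times> {0<..}) (\<lambda>(s, t). F (Complex s y) t)"
      using y c by (intro cont continuous_intros) auto
    have b: "norm (F (Complex s y) t) \<le> exp (x * s) * Q t" if "s \<in> {..c}" "t \<in> {0<..}" for s t
      using bd[OF hankel_points_ray[of s c y \<epsilon>], of t] that y by simp
    show "(LINT s:{..c}|lborel. LINT t:{0<..}|lborel. F (Complex s y) t) = (LINT t:{0<..}|lborel. LINT s:{..c}|lborel. F (Complex s y) t)"
      by (rule set_integral_swap(1)[OF _ _ * set_integrable_exp_Iic[OF x] Q b]) auto
    show "set_integrable lborel {0<..} (\<lambda>t. LINT s:{..c}|lborel. F (Complex s y) t)"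
      by (rule set_integral_swap(2)[OF _ _ * set_integrable_exp_Iic[OF x] Q b]) auto
  qed
  let ?z = "\<lambda>s. Complex c (\<epsilon> * (2 * s - 1))"
  have *: "continuous_on ({0..1} \<times> {0<..}) (\<lambda>(s, t). F (?z s) t)"
    using c by (intro cont continuous_intros) auto
  have b: "norm (F (?z s) t) \<le> exp (x * c) * Q t" if "s \<in> {0..1}" "t \<in> {0<..}" for s t
    using bd[OF hankel_points_vertical[of s \<epsilon> c], of t] that c by simp
  have k: "set_integrable lborel {0..1::real} (\<lambda>s. exp (x * c))" by (rule borel_integrable_atLeastAtMost') auto
  have v1: "(LINT s:{0..1}|lborel. LINT t:{0<..}|lborel. F (?z s) t) = (LINT t:{0<..}|lborel. LINT s:{0..1}|lborel. F (?z s) t)"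
    by (rule set_integral_swap(1)[OF _ _ * k Q b]) auto
  have v2: "set_integrable lborel {0<..} (\<lambda>t. LINT s:{0..1}|lborel. F (?z s) t)"
    by (rule set_integral_swap(2)[OF _ _ * k Q b]) auto
  have e: "\<bar>\<epsilon>\<bar> = \<epsilon>" "\<bar>- \<epsilon>\<bar> = \<epsilon>" using c by auto
  show ?thesis
    unfolding hankel_line_def v1 r(1)[OF e(1)] r(1)[OF e(2)]
    by (subst set_integral_diff(2), intro set_integral_add(1) set_integrable_mult_right impI r(2) v2 e, rule r(2)[OF e(1)],
        subst set_integral_add(2), rule r(2)[OF e(2)], intro set_integrable_mult_right impI v2,
        subst set_integral_mult_right, rule refl)
qed

text \<open>This is \<Gamma>(a) U(a, a + b, w) with Tricomi's function U. The first argument is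
  complex because \<open>laplace_beta\<close> also represents \<open>(1 - z) powr (- a)\<close> for
  points \<open>z\<close> of the contour.\<close>

definition laplace_beta :: "complex \<Rightarrow> complex \<Rightarrow> real \<Rightarrow> complex" where
  "laplace_beta w a b = (LINT t:{0<..}|lborel.
     exp (- (w * of_real t)) * of_real t powr (a - 1) * of_real ((1 + t) powr (b - 1)))"

text \<open>Half of the exponential rate absorbs the power of \<open>1 + t\<close>, which leaves a
  Gamma integrand.\<close>

lemma set_integrable_laplace_beta_majorant:
  assumes \<alpha>: "\<alpha> > 0" and c: "c > 0"
  shows "set_integrable lborel {0<..} (\<lambda>t::real. exp (- (c * t)) * t powr (\<alpha> - 1) * (1 + t) powr q)"
proof -
  obtain K where K: "K \<ge> 0" "\<And>u. u \<ge> 1 \<Longrightarrow> u powr q \<le> K * exp (c / 2 * u)"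
    using powr_le_exp[of 1 "c / 2" q] c by auto
  have cn: "continuous_on {0<..} (\<lambda>t::real. t powr (\<alpha> - 1) * exp (- (c / 2 * t)))"
    by (intro continuous_intros) auto
  have m: "(\<lambda>t. indicator {0<..} t *\<^sub>R (t powr (\<alpha> - 1) * exp (- (c / 2 * t)))) \<in> borel_measurable lborel"
    using borel_measurable_continuous_on_indicator[OF _ cn] by simp
  have "(\<lambda>t. norm (complex_of_real t powr (of_real \<alpha> - 1) / of_real (exp (c / 2 * t)))) absolutely_integrable_on {0<..}"
    using absolutely_integrable_Gamma_integral[of "of_real \<alpha>" "c / 2"] \<alpha> c by (intro set_integrable_norm) auto
  also have "?this \<longleftrightarrow> (\<lambda>t. t powr (\<alpha> - 1) * exp (- (c / 2 * t))) absolutely_integrable_on {0<..}"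
    by (intro set_integrable_cong) (auto simp: norm_divide norm_powr_real_powr exp_minus field_simps)
  finally have 1: "set_integrable lborel {0<..} (\<lambda>t. t powr (\<alpha> - 1) * exp (- (c / 2 * t)))"
    unfolding set_integrable_def by (subst (asm) integrable_completion[OF m])
  show ?thesis
  proof (rule set_integrable_continuous_bound)
    show "continuous_on {0<..} (\<lambda>t::real. exp (- (c * t)) * t powr (\<alpha> - 1) * (1 + t) powr q)"
      by (intro continuous_intros) auto
    show "set_integrable lborel {0<..} (\<lambda>t. K * exp (c / 2) * (t powr (\<alpha> - 1) * exp (- (c / 2 * t))))"
      by (intro set_integrable_mult_right impI 1)
    fix t :: real assume t: "t \<in> {0<..}"
    have "norm (exp (- (c * t)) * t powr (\<alpha> - 1) * (1 + t) powr q) \<le> exp (- (c * t)) * t powr (\<alpha> - 1) * (K * exp (c / 2 * (1 + t)))"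
      using K(2)[of "1 + t"] t by (simp add: abs_mult mult_left_mono)
    also have "\<dots> = K * exp (c / 2) * (t powr (\<alpha> - 1) * (exp (- (c * t)) * exp (c / 2 * t)))"
      by (simp add: distrib_left exp_add)
    also have "exp (- (c * t)) * exp (c / 2 * t) = exp (- (c / 2 * t))"
      unfolding exp_add[symmetric] by (simp add: field_simps)
    finally show "norm (exp (- (c * t)) * t powr (\<alpha> - 1) * (1 + t) powr q) \<le> K * exp (c / 2) * (t powr (\<alpha> - 1) * exp (- (c / 2 * t)))" .
  qed simp
qed

abbreviation gamma_kernel :: "complex \<Rightarrow> real \<Rightarrow> complex" where
  "gamma_kernel a t \<equiv> exp (- complex_of_real t) * of_real t powr (a - 1)"

text \<open>The left-hand form is the one that the inner Hankel integral produces. Its exponential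
  no longer depends on \<open>x\<close>, which also makes the limit \<open>x \<rightarrow> 0\<close>
  accessible to dominated convergence.\<close>

lemma laplace_beta_scale:
  assumes x: "x > 0"
  shows "(LINT t:{0<..}|lborel. gamma_kernel a t * of_real ((x + t) powr (b - 1))) =
    of_real x powr (a + of_real b - 1) * laplace_beta (of_real x) a b"
proof -
  have "(LINT t:{0<..}|lborel. gamma_kernel a t * of_real ((x + t) powr (b - 1))) =
      \<bar>x\<bar> *\<^sub>R (LINT t|lborel. indicator {0<..} (0 + x * t) *\<^sub>R (exp (- complex_of_real (0 + x * t)) * of_real (0 + x * t) powr (a - 1) * of_real ((x + (0 + x * t)) powr (b - 1))))"
    unfolding set_lebesgue_integral_def by (rule lborel_integral_real_affine) (use x in auto)
  also have "(LINT t|lborel. indicator {0<..} (0 + x * t) *\<^sub>R (exp (- complex_of_real (0 + x * t)) * of_real (0 + x * t) powr (a - 1) * of_real ((x + (0 + x * t)) powr (b - 1)))) =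
      (LINT t:{0<..}|lborel. of_real x powr (a - 1) * of_real (x powr (b - 1)) * (exp (- (of_real x * complex_of_real t)) * of_real t powr (a - 1) * of_real ((1 + t) powr (b - 1))))"
    unfolding set_lebesgue_integral_def
  proof (intro Bochner_Integration.integral_cong refl)
    fix t :: real
    show "indicator {0<..} (0 + x * t) *\<^sub>R (exp (- complex_of_real (0 + x * t)) * of_real (0 + x * t) powr (a - 1) * of_real ((x + (0 + x * t)) powr (b - 1))) =
      indicator {0<..} t *\<^sub>R (of_real x powr (a - 1) * of_real (x powr (b - 1)) * (exp (- (of_real x * complex_of_real t)) * of_real t powr (a - 1) * of_real ((1 + t) powr (b - 1))))"
    proof (cases "t > 0")
      case True
      have "complex_of_real (x * t) powr (a - 1) = of_real x powr (a - 1) * of_real t powr (a - 1)"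
        using x True powr_times_real_left[of "of_real x" "of_real t" "a - 1"] by simp
      moreover have "(x + x * t) powr (b - 1) = x powr (b - 1) * (1 + t) powr (b - 1)"
        using x True powr_mult[of x "1 + t" "b - 1"] by (simp add: algebra_simps)
      ultimately show ?thesis using x True by (simp add: mult_ac)
    next
      case False
      thus ?thesis using x by (simp add: indicator_def zero_less_mult_iff)
    qed
  qed
  also have "\<dots> = of_real x powr (a - 1) * of_real (x powr (b - 1)) * laplace_beta (of_real x) a b"
    unfolding laplace_beta_def by (rule set_integral_mult_right)
  also have "\<bar>x\<bar> *\<^sub>R \<dots> = of_real x powr (1 + (a - 1) + (of_real b - 1)) * laplace_beta (of_real x) a b"
    unfolding powr_add using x powr_of_real[of x "b - 1"] by (simp add: scaleR_conv_of_real)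
  finally show ?thesis by (simp add: algebra_simps)
qed

lemma laplace_beta_integrand_continuous:
  "continuous_on {0<..} (\<lambda>t. exp (- (w * complex_of_real t)) * of_real t powr (a - 1) * of_real ((1 + t) powr (b - 1)))"
  by (intro continuous_intros) (auto simp: complex_nonpos_Reals_iff)

lemma laplace_beta_integrand_norm:
  assumes "t > 0"
  shows "norm (exp (- (w * complex_of_real t)) * of_real t powr (a - 1) * of_real ((1 + t) powr (b - 1))) =
    exp (- (Re w * t)) * t powr (Re a - 1) * (1 + t) powr (b - 1)"
  using assms by (simp add: norm_mult norm_powr_real_powr)

lemma laplace_beta_integrable:
  assumes w: "Re w > 0" and a: "Re a > 0"
  shows "set_integrable lborel {0<..} (\<lambda>t. exp (- (w * complex_of_real t)) * of_real t powr (a - 1) * of_real ((1 + t) powr (b - 1)))"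
  by (rule set_integrable_continuous_bound[OF laplace_beta_integrand_continuous _ set_integrable_laplace_beta_majorant[OF a w]])
     (auto simp: laplace_beta_integrand_norm)

lemma powr_add_one_minus_one: "t > 0 \<Longrightarrow> complex_of_real t powr (a + 1 - 1) = of_real t * of_real t powr (a - 1)"
  using powr_add[of "complex_of_real t" 1 "a - 1"] by simp

text \<open>Differentiation under the integral: the remainder of first-order Taylor expansion of the
  exponential costs a factor \<open>t powr 2\<close> and is quadratic in \<open>v - w\<close> after
  integration.\<close>

lemma laplace_beta_has_derivative:
  assumes w: "Re w > 0" and a: "Re a > 0"
  shows "((\<lambda>w. laplace_beta w a b) has_field_derivative - laplace_beta w (a + 1) b) (at w)"
proof -
  \<comment> \<open>For \<open>v\<close> closer to \<open>w\<close> than \<open>c\<close>, the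
    remainder grows at most like \<open>exp (c * t)\<close>, so decay of rate \<open>c\<close> is
    left over.\<close>
  define c where "c = Re w / 2"
  have c: "c > 0" using w by (simp add: c_def)
  define K where "K = (LINT t:{0<..}|lborel. exp (- (c * t)) * t powr (Re a + 2 - 1) * (1 + t) powr (b - 1))"
  let ?g = "\<lambda>v a t. exp (- (v * complex_of_real t)) * of_real t powr (a - 1) * of_real ((1 + t) powr (b - 1))"
  have bound: "norm ((laplace_beta v a b - laplace_beta w a b) / (v - w) - - laplace_beta w (a + 1) b) \<le> norm (v - w) * K"
    if v: "norm (v - w) < c" "v \<noteq> w" for v
  proof -
    have rv: "Re v > 0" using v(1) abs_Re_le_cmod[of "v - w"] w by (simp add: c_def)
    have a1: "Re (a + 1) > 0" using a by simp
    have i: "set_integrable lborel {0<..} (?g v a)" "set_integrable lborel {0<..} (?g w a)" "set_integrable lborel {0<..} (?g w (a + 1))"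
      by (intro laplace_beta_integrable rv w a a1)+
    have diff: "laplace_beta v a b - laplace_beta w a b + (v - w) * laplace_beta w (a + 1) b =
        (LINT t:{0<..}|lborel. ?g v a t - ?g w a t + (v - w) * ?g w (a + 1) t)"
      unfolding laplace_beta_def
      by (subst set_integral_add(2), rule set_integral_diff(1)[OF i(1,2)], rule set_integrable_mult_right, rule i(3),
          subst set_integral_diff(2)[OF i(1,2)], subst set_integral_mult_right, rule refl)
    have "norm (laplace_beta v a b - laplace_beta w a b + (v - w) * laplace_beta w (a + 1) b) \<le> (LINT t:{0<..}|lborel. norm (?g v a t - ?g w a t + (v - w) * ?g w (a + 1) t))"
      unfolding diff by (intro set_integral_norm_bound set_integral_add(1) set_integral_diff(1) set_integrable_mult_right i)
    also have "\<dots> \<le> (LINT t:{0<..}|lborel. (norm (v - w))\<^sup>2 * (exp (- (c * t)) * t powr (Re a + 2 - 1) * (1 + t) powr (b - 1)))"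
    proof (rule set_integral_mono)
      show "set_integrable lborel {0<..} (\<lambda>t. norm (?g v a t - ?g w a t + (v - w) * ?g w (a + 1) t))"
        by (intro set_integrable_norm set_integral_add(1) set_integral_diff(1) set_integrable_mult_right i)
      show "set_integrable lborel {0<..} (\<lambda>t. (norm (v - w))\<^sup>2 * (exp (- (c * t)) * t powr (Re a + 2 - 1) * (1 + t) powr (b - 1)))"
        using a c by (intro set_integrable_mult_right impI set_integrable_laplace_beta_majorant) auto
      fix t :: real assume "t \<in> {0<..}"
      hence t: "t > 0" by simp
      define z where "z = - ((v - w) * complex_of_real t)"
      have ev: "exp (- (v * complex_of_real t)) = exp (- (w * complex_of_real t)) * exp z"
        unfolding z_def exp_add[symmetric] by (simp add: algebra_simps)
      have eq: "?g v a t - ?g w a t + (v - w) * ?g w (a + 1) t = (exp z - 1 - z) * ?g w a t"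
        unfolding ev powr_add_one_minus_one[OF t] by (simp add: z_def algebra_simps)
      have "norm (exp z - (\<Sum>k\<le>1. z ^ k / fact k)) \<le> exp \<bar>Re z\<bar> * norm z ^ Suc 1 / fact 1" by (rule Taylor_exp)
      hence T: "norm (exp z - 1 - z) \<le> exp \<bar>Re z\<bar> * (norm z)\<^sup>2"
        by (simp add: diff_diff_eq power2_eq_square)
      have nz: "norm z = norm (v - w) * t" using t by (simp add: z_def norm_mult)
      have "\<bar>Re z\<bar> \<le> norm z" by (rule abs_Re_le_cmod)
      also have "\<dots> \<le> c * t" unfolding nz using v t by (intro mult_right_mono) auto
      finally have rz: "\<bar>Re z\<bar> \<le> c * t" .
      have "norm ((exp z - 1 - z) * ?g w a t) = norm (exp z - 1 - z) * (exp (- (Re w * t)) * t powr (Re a - 1) * (1 + t) powr (b - 1))"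
        using laplace_beta_integrand_norm[OF t, of w a b] by (simp only: norm_mult)
      also have "\<dots> \<le> (exp (c * t) * (norm (v - w) * t)\<^sup>2) * (exp (- (Re w * t)) * t powr (Re a - 1) * (1 + t) powr (b - 1))"
      proof (intro mult_right_mono)
        show "norm (exp z - 1 - z) \<le> exp (c * t) * (norm (v - w) * t)\<^sup>2"
          using T rz unfolding nz by (intro order_trans[OF T[unfolded nz] mult_right_mono]) auto
      qed auto
      also have "\<dots> = (norm (v - w))\<^sup>2 * ((exp (c * t) * exp (- (Re w * t))) * (t powr (Re a - 1) * t powr 2) * (1 + t) powr (b - 1))"
        using t by (simp add: power_mult_distrib powr_numeral mult_ac)
      also have "exp (c * t) * exp (- (Re w * t)) = exp (- (c * t))"
        unfolding exp_add[symmetric] by (simp add: c_def field_simps)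
      also have "t powr (Re a - 1) * t powr 2 = t powr (Re a + 2 - 1)"
        unfolding powr_add[symmetric] by (simp add: algebra_simps)
      finally show "norm (?g v a t - ?g w a t + (v - w) * ?g w (a + 1) t) \<le> (norm (v - w))\<^sup>2 * (exp (- (c * t)) * t powr (Re a + 2 - 1) * (1 + t) powr (b - 1))"
        unfolding eq .
    qed
    also have "\<dots> = (norm (v - w))\<^sup>2 * K" unfolding K_def by (rule set_integral_mult_right)
    finally have *: "norm (laplace_beta v a b - laplace_beta w a b + (v - w) * laplace_beta w (a + 1) b) \<le> (norm (v - w))\<^sup>2 * K" .
    have nz: "norm (v - w) > 0" using v by simp
    have "(laplace_beta v a b - laplace_beta w a b) / (v - w) - - laplace_beta w (a + 1) b =
      (laplace_beta v a b - laplace_beta w a b + (v - w) * laplace_beta w (a + 1) b) / (v - w)"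
      using v by (simp add: field_simps)
    hence "norm ((laplace_beta v a b - laplace_beta w a b) / (v - w) - - laplace_beta w (a + 1) b) =
        norm (laplace_beta v a b - laplace_beta w a b + (v - w) * laplace_beta w (a + 1) b) / norm (v - w)"
      by (simp add: norm_divide)
    also have "\<dots> \<le> (norm (v - w))\<^sup>2 * K / norm (v - w)" using * nz by (intro divide_right_mono) auto
    also have "\<dots> = norm (v - w) * K" using nz by (simp add: power2_eq_square)
    finally show ?thesis .
  qed
  show ?thesis
    unfolding has_field_derivative_iff
  proof (rule LIM_zero_cancel, rule Lim_null_comparison)
    show "\<forall>\<^sub>F v in at w. norm ((laplace_beta v a b - laplace_beta w a b) / (v - w) - - laplace_beta w (a + 1) b) \<le> norm (v - w) * K"
      unfolding eventually_at using c bound by (auto simp: dist_norm intro!: exI[of _ c])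
    show "((\<lambda>v. norm (v - w) * K) \<longlongrightarrow> 0) (at w)"
      by (intro tendsto_mult_left_zero tendsto_norm_zero LIM_zero tendsto_ident_at)
  qed
qed

text \<open>Integrate the derivative of \<open>exp (- (w * t)) * t powr a * (1 + t) powr b\<close>.
  It vanishes at 0 because of \<open>Re a > 0\<close> and at infinity because of
  \<open>Re w > 0\<close>.\<close>

lemma laplace_beta_parts:
  assumes w: "Re w > 0" and a: "Re a > 0"
  shows "w * laplace_beta w (a + 1) (b + 1) = a * laplace_beta w a (b + 1) + of_real b * laplace_beta w (a + 1) b"
proof -
  let ?g = "\<lambda>a b t. exp (- (w * complex_of_real t)) * of_real t powr (a - 1) * of_real ((1 + t) powr (b - 1))"
  define G where "G = (\<lambda>t::real. exp (- (w * of_real t)) * of_real t powr a * of_real ((1 + t) powr b))"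
  define G' where "G' = (\<lambda>t. a * ?g a (b + 1) t + of_real b * ?g (a + 1) b t - w * ?g (a + 1) (b + 1) t)"
  have a1: "Re (a + 1) > 0" using a by simp
  have i: "set_integrable lborel {0<..} (?g a (b + 1))" "set_integrable lborel {0<..} (?g (a + 1) b)" "set_integrable lborel {0<..} (?g (a + 1) (b + 1))"
    by (intro laplace_beta_integrable w a a1)+
  have iG: "set_integrable lborel {0<..} G'"
    unfolding G'_def by (intro set_integral_diff(1) set_integral_add(1) set_integrable_mult_right impI i)
  have IG: "(LINT t:{0<..}|lborel. G' t) = a * laplace_beta w a (b + 1) + of_real b * laplace_beta w (a + 1) b - w * laplace_beta w (a + 1) (b + 1)"
    unfolding G'_def laplace_beta_def
    by (subst set_integral_diff(2), intro set_integral_add(1) set_integrable_mult_right impI i, rule set_integrable_mult_right, rule i(3),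
        subst set_integral_add(2), (rule set_integrable_mult_right, rule i)+, (subst set_integral_mult_right)+, rule refl)
  have iL: "set_integrable lborel {0<..L} G'" for L
    by (rule set_integrable_subset[OF iG]) auto
  have ftc: "(LINT t:{0<..L}|lborel. G' t) = G L" if L: "L > 0" for L
  proof -
    have "(G' has_integral G L - G 0) {0..L}"
    proof (rule fundamental_theorem_of_calculus_interior)
      show "continuous_on {0..L} G"
        unfolding G_def using a by (intro continuous_intros continuous_on_powr_complex) auto
      fix t assume "t \<in> {0<..<L}"
      hence t: "t > 0" by simp
      have d1: "((\<lambda>t. exp (- (w * of_real t))) has_vector_derivative - w * exp (- (w * of_real t))) (at t)"
        by (rule has_vector_derivative_real_field) (auto intro!: derivative_eq_intros)
      have d2: "((\<lambda>t. of_real t powr a) has_vector_derivative a * of_real t powr (a - 1)) (at t)"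
        using t by (intro has_vector_derivative_real_field has_field_derivative_powr) (auto simp: complex_nonpos_Reals_iff)
      have "((\<lambda>t. (1 + t) powr b) has_real_derivative b * (1 + t) powr (b - 1)) (at t)"
        using t by (auto intro!: derivative_eq_intros)
      hence d3: "((\<lambda>t. complex_of_real ((1 + t) powr b)) has_vector_derivative of_real (b * (1 + t) powr (b - 1))) (at t)"
        by (rule has_vector_derivative_of_real)
      have "(G has_vector_derivative exp (- (w * of_real t)) * of_real t powr a * of_real (b * (1 + t) powr (b - 1)) +
          (exp (- (w * of_real t)) * (a * of_real t powr (a - 1)) + - w * exp (- (w * of_real t)) * of_real t powr a) * of_real ((1 + t) powr b)) (at t)"
        unfolding G_def by (intro has_vector_derivative_mult d1 d2 d3)
      also have "exp (- (w * of_real t)) * of_real t powr a * of_real (b * (1 + t) powr (b - 1)) +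
          (exp (- (w * of_real t)) * (a * of_real t powr (a - 1)) + - w * exp (- (w * of_real t)) * of_real t powr a) * of_real ((1 + t) powr b) = G' t"
        unfolding G'_def by (simp add: algebra_simps)
      finally show "(G has_vector_derivative G' t) (at t)" .
    qed (use L in auto)
    moreover have "G 0 = 0" by (simp add: G_def)
    moreover have "(LINT t:{0<..L}|lborel. G' t) = integral {0<..L} G'"
      by (rule set_borel_integral_eq_integral(2)) (rule set_integrable_subset[OF iG], auto)
    moreover have "integral {0<..L} G' = integral {0..L} G'"
      by (rule integral_spike_set) (auto intro: negligible_subset[of "{0}"])
    ultimately show ?thesis by (simp add: integral_unique)
  qed
  have "((\<lambda>L. LINT t:{0<..L}|lborel. G' t) \<longlongrightarrow> (LINT t:{0<..}|lborel. G' t)) at_top"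
    unfolding set_lebesgue_integral_def
  proof (rule integral_dominated_convergence_at_top[where w = "\<lambda>t. norm (indicat_real {0<..} t *\<^sub>R G' t)"])
    show m: "(\<lambda>t. indicat_real {0<..} t *\<^sub>R G' t) \<in> borel_measurable lborel"
      using iG unfolding set_integrable_def by (rule borel_measurable_integrable)
    show "(\<lambda>t. indicat_real {0<..L} t *\<^sub>R G' t) \<in> borel_measurable lborel" for L
      using iL[of L] unfolding set_integrable_def by (rule borel_measurable_integrable)
    show "integrable lborel (\<lambda>t. norm (indicat_real {0<..} t *\<^sub>R G' t))"
      using iG unfolding set_integrable_def by (rule integrable_norm)
    show "AE t in lborel. ((\<lambda>L. indicat_real {0<..L} t *\<^sub>R G' t) \<longlongrightarrow> indicat_real {0<..} t *\<^sub>R G' t) at_top"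
    proof (rule AE_I2, rule tendsto_eventually)
      fix t
      show "\<forall>\<^sub>F L in at_top. indicat_real {0<..L} t *\<^sub>R G' t = indicat_real {0<..} t *\<^sub>R G' t"
        using eventually_ge_at_top[of t] by eventually_elim (auto simp: indicator_def)
    qed
    show "\<forall>\<^sub>F L in at_top. AE t in lborel. norm (indicat_real {0<..L} t *\<^sub>R G' t) \<le> norm (indicat_real {0<..} t *\<^sub>R G' t)"
      by (intro always_eventually allI AE_I2) (auto simp: indicator_def)
  qed
  moreover have "((\<lambda>L. LINT t:{0<..L}|lborel. G' t) \<longlongrightarrow> 0) at_top"
  proof (rule Lim_null_comparison)
    show "\<forall>\<^sub>F L in at_top. norm (LINT t:{0<..L}|lborel. G' t) \<le> exp (- (Re w * L)) * L powr Re a * (1 + L) powr b"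
      using eventually_gt_at_top[of 0]
    proof eventually_elim
      case (elim L)
      show ?case using laplace_beta_integrand_norm[OF elim, of w "a + 1" "b + 1"] by (simp add: ftc[OF elim] G_def)
    qed
    show "((\<lambda>L. exp (- (Re w * L)) * L powr Re a * (1 + L) powr b) \<longlongrightarrow> 0) at_top"
      using w by real_asymp
  qed
  ultimately have "(LINT t:{0<..}|lborel. G' t) = 0" using tendsto_unique trivial_limit_at_top_linorder by blast
  thus ?thesis unfolding IG by (simp add: algebra_simps)
qed

text \<open>One factor of \<open>(1 + t) powr b\<close> is expanded as \<open>1 + t\<close>.\<close>

lemma laplace_beta_contiguous:
  assumes w: "Re w > 0" and a: "Re a > 0"
  shows "laplace_beta w a (b + 1) = laplace_beta w a b + laplace_beta w (a + 1) b"
proof -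
  let ?g = "\<lambda>a b t. exp (- (w * complex_of_real t)) * of_real t powr (a - 1) * of_real ((1 + t) powr (b - 1))"
  have a1: "Re (a + 1) > 0" using a by simp
  have "laplace_beta w a b + laplace_beta w (a + 1) b = (LINT t:{0<..}|lborel. ?g a b t + ?g (a + 1) b t)"
    unfolding laplace_beta_def by (subst set_integral_add(2)) (intro laplace_beta_integrable w a a1 refl)+
  also have "\<dots> = laplace_beta w a (b + 1)"
    unfolding laplace_beta_def
  proof (intro set_lebesgue_integral_cong ballI allI impI)
    fix t :: real assume "t \<in> {0<..}"
    hence t: "t > 0" by simp
    have "(1 + t) powr (b + 1 - 1) = (1 + t) * (1 + t) powr (b - 1)"
      using powr_add[of "1 + t" 1 "b - 1"] t by simp
    thus "?g a b t + ?g (a + 1) b t = ?g a (b + 1) t"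
      unfolding powr_add_one_minus_one[OF t] by (simp add: algebra_simps)
  qed simp
  finally show ?thesis by simp
qed

text \<open>Gamma's integral with a complex rate, obtained without rotating the ray:
  \<open>w powr a * laplace_beta w a 1\<close> has derivative zero on the right half-plane, and its
  value at 1 is \<open>Gamma a\<close>.\<close>

lemma laplace_beta_one:
  assumes w: "Re w > 0" and a: "Re a > 0"
  shows "laplace_beta w a 1 = Gamma a * w powr (- a)"
proof -
  define q where "q = (\<lambda>w. w powr a * laplace_beta w a 1)"
  have nz: "w \<notin> \<real>\<^sub>\<le>\<^sub>0" if "Re w > 0" for w using that by (auto simp: complex_nonpos_Reals_iff)
  have "(q has_field_derivative 0) (at w within {w. Re w > 0})" if "w \<in> {w. Re w > 0}" for w
  proof -
    have w: "Re w > 0" using that by simp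
    have w0: "w \<noteq> 0" using w by auto
    have "(q has_field_derivative w powr a * (- laplace_beta w (a + 1) 1) + (a * w powr (a - 1)) * laplace_beta w a 1) (at w)"
      unfolding q_def using DERIV_mult'[OF has_field_derivative_powr[OF nz[OF w], of a] laplace_beta_has_derivative[OF w a, of 1]]
      by (simp add: mult_ac)
    also have "w powr a * (- laplace_beta w (a + 1) 1) + (a * w powr (a - 1)) * laplace_beta w a 1 = 0"
    proof -
      have "w powr a = w * w powr (a - 1)" using powr_add[of w 1 "a - 1"] w0 by simp
      moreover have "w * laplace_beta w (a + 1) 1 = a * laplace_beta w a 1"
        using laplace_beta_parts[OF w a, of 0] by simp
      ultimately show ?thesis by (simp add: algebra_simps)
    qed
    finally show ?thesis by (rule has_field_derivative_at_within)
  qed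
  hence "\<exists>c. \<forall>w\<in>{w. Re w > 0}. q w = c"
    by (intro has_field_derivative_zero_constant convex_halfspace_Re_gt) auto
  hence "q w = q 1" using w by auto
  also have "q 1 = Gamma a"
  proof -
    have "laplace_beta 1 a 1 = (LINT t:{0<..}|lborel. of_real t powr (a - 1) * exp (- complex_of_real t))"
      unfolding laplace_beta_def by (intro set_lebesgue_integral_cong) (auto simp: mult_ac)
    thus ?thesis using Gamma_set_integral(2)[OF a] by (simp add: q_def)
  qed
  finally have "w powr a * laplace_beta w a 1 = Gamma a" by (simp add: q_def)
  moreover have "w powr a \<noteq> 0" using w by auto
  ultimately show ?thesis by (simp add: powr_minus field_simps)
qed

text \<open>The contour passes through 1/2, so \<open>Re (1 - z) \<ge> 1 / 2\<close> on it and
  \<open>(1 - z) powr (- a)\<close> is a Gamma integral over \<open>t\<close>. After interchanging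
  the integrations, the exponentials combine to the rate \<open>x + t\<close>, and the inner
  integral is Hankel's.\<close>

lemma hankel_line_laplace_beta:
  assumes a: "Re a > 0" and b: "b \<ge> 0" and x: "x > 0"
  shows "hankel_line (1 / 2) 1 (\<lambda>z. exp (of_real x * z) * ((1 - z) powr (- a) * z powr (- of_real b))) =
    2 * of_real pi * \<i> * of_real x powr (a + of_real b - 1) * (rGamma a * of_real (rGamma b) * laplace_beta (of_real x) a b)"
proof -
  define F where "F = (\<lambda>z t. exp (of_real x * z) * z powr (- of_real b) * (exp (- ((1 - z) * of_real t)) * of_real t powr (a - 1)))"
  have Ga: "rGamma a * Gamma a = 1"
  proof -
    have "a \<notin> \<int>\<^sub>\<le>\<^sub>0" using a by (auto elim!: nonpos_Ints_cases)
    thus ?thesis by (simp add: Gamma_def rGamma_eq_zero_iff)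
  qed
  have pts: "z \<noteq> 0" "norm z \<ge> 1 / 2" "Re z \<le> 1 / 2" if "z \<in> hankel_points (1 / 2) 1" for z
    using that abs_Re_le_cmod[of z] abs_Im_le_cmod[of z] by (auto simp: hankel_points_def)
  have "hankel_line (1 / 2) 1 (\<lambda>z. exp (of_real x * z) * ((1 - z) powr (- a) * z powr (- of_real b))) =
      hankel_line (1 / 2) 1 (\<lambda>z. rGamma a * (LINT t:{0<..}|lborel. F z t))"
  proof (rule hankel_line_cong)
    fix z assume z: "z \<in> hankel_points (1 / 2) 1"
    have "Gamma a * (1 - z) powr (- a) = laplace_beta (1 - z) a 1"
      using laplace_beta_one[of "1 - z" a] a pts(3)[OF z] by simp
    also have "\<dots> = (LINT t:{0<..}|lborel. exp (- ((1 - z) * of_real t)) * of_real t powr (a - 1))"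
      unfolding laplace_beta_def by (intro set_lebesgue_integral_cong) auto
    finally have "rGamma a * (exp (of_real x * z) * z powr (- of_real b) * (Gamma a * (1 - z) powr (- a))) =
        rGamma a * (LINT t:{0<..}|lborel. F z t)"
      unfolding F_def by (simp only: set_integral_mult_right)
    moreover have "rGamma a * (exp (of_real x * z) * z powr (- of_real b) * (Gamma a * (1 - z) powr (- a))) =
        (rGamma a * Gamma a) * (exp (of_real x * z) * ((1 - z) powr (- a) * z powr (- of_real b)))"
      by simp
    ultimately show "exp (of_real x * z) * ((1 - z) powr (- a) * z powr (- of_real b)) = rGamma a * (LINT t:{0<..}|lborel. F z t)"
      by (simp add: Ga)
  qed simp
  also have "\<dots> = rGamma a * (LINT t:{0<..}|lborel. hankel_line (1 / 2) 1 (\<lambda>z. F z t))"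
    unfolding hankel_line_cmult
  \<comment> \<open>In \<open>Q\<close>, the rate 1/2 is the lower bound of
    \<open>Re (1 - z)\<close>, and \<open>2 powr b\<close> bounds the power of \<open>z\<close>, as
    \<open>norm z \<ge> 1 / 2\<close>; the trivial factor \<open>(1 + t) powr 0\<close> gives it the
    shape of the known majorant.\<close>
  proof (subst hankel_line_swap[where T = "{0<..}" and x = x and Q = "\<lambda>t. 2 powr b * (exp (- (1 / 2 * t)) * t powr (Re a - 1) * (1 + t) powr 0)"])
    show "continuous_on (slit {0<..} \<times> {0<..}) (\<lambda>(z, t). F z t)"
      unfolding F_def case_prod_beta'
      by (intro continuous_intros) (auto simp: slit_def complex_nonpos_Reals_iff)
    show "set_integrable lborel {0<..} (\<lambda>t. 2 powr b * (exp (- (1 / 2 * t)) * t powr (Re a - 1) * (1 + t) powr 0))"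
      using a by (intro set_integrable_mult_right impI set_integrable_laplace_beta_majorant) auto
    fix z and t :: real assume z: "z \<in> hankel_points (1 / 2) 1" and t: "t > 0"
    have "norm (z powr (- of_real b)) \<le> norm z powr (- b)" using norm_powr_le[OF pts(1)[OF z], of "- of_real b"] by simp
    also have "\<dots> \<le> (1 / 2) powr (- b)" using pts(2)[OF z] b by (intro powr_mono2') auto
    also have "\<dots> = 2 powr b" by (simp add: powr_minus powr_divide)
    finally have 1: "norm (z powr (- of_real b)) \<le> 2 powr b" .
    have 2: "norm (exp (- ((1 - z) * of_real t))) \<le> exp (- (1 / 2 * t))"
      using mult_right_mono[OF pts(3)[OF z], of t] t by (simp add: algebra_simps)
    have "norm (F z t) = exp (x * Re z) * (norm (z powr (- of_real b)) * (norm (exp (- ((1 - z) * of_real t))) * t powr (Re a - 1)))"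
      using t by (simp add: F_def norm_mult norm_powr_real_powr del: norm_exp_eq_Re) (simp add: mult_ac)
    also have "\<dots> \<le> exp (x * Re z) * (2 powr b * (exp (- (1 / 2 * t)) * t powr (Re a - 1)))"
      by (intro mult_left_mono mult_mono 1 2 mult_right_mono) auto
    finally show "norm (F z t) \<le> exp (x * Re z) * (2 powr b * (exp (- (1 / 2 * t)) * t powr (Re a - 1) * (1 + t) powr 0))"
      using t by simp
  qed (use x in auto)
  also have "(LINT t:{0<..}|lborel. hankel_line (1 / 2) 1 (\<lambda>z. F z t)) =
      (LINT t:{0<..}|lborel. 2 * of_real pi * \<i> * of_real (rGamma b) * (gamma_kernel a t * of_real ((x + t) powr (b - 1))))"
  proof (intro set_lebesgue_integral_cong allI impI)
    fix t :: real assume "t \<in> {0<..}"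
    hence t: "t > 0" by simp
    have "F z t = gamma_kernel a t * (exp (of_real (x + t) * z) * z powr (- of_real b))" for z
    proof -
      have "exp (of_real x * z) * exp (- ((1 - z) * of_real t)) = exp (- complex_of_real t) * exp (of_real (x + t) * z)"
        unfolding exp_add[symmetric] by (simp add: algebra_simps)
      thus ?thesis unfolding F_def by (simp add: mult_ac)
    qed
    hence "hankel_line (1 / 2) 1 (\<lambda>z. F z t) = gamma_kernel a t *
        (2 * of_real pi * \<i> * rGamma (of_real b) * of_real (x + t) powr (of_real b - 1))"
      using x t b hankel_gamma[of "x + t" "of_real b" "1 / 2" 1] by (simp add: hankel_line_cmult)
    also have "of_real (x + t) powr (of_real b - 1) = complex_of_real ((x + t) powr (b - 1))"
      using x t powr_of_real[of "x + t" "b - 1"] by simp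
    also have "rGamma (complex_of_real b) = of_real (rGamma b)" by (rule rGamma_complex_of_real)
    finally show "hankel_line (1 / 2) 1 (\<lambda>z. F z t) = 2 * of_real pi * \<i> * of_real (rGamma b) * (gamma_kernel a t * of_real ((x + t) powr (b - 1)))"
      by (simp only: mult_ac)
  qed simp
  also have "\<dots> = 2 * of_real pi * \<i> * of_real (rGamma b) * (LINT t:{0<..}|lborel. gamma_kernel a t * of_real ((x + t) powr (b - 1)))"
    by (rule set_integral_mult_right)
  also have "(LINT t:{0<..}|lborel. gamma_kernel a t * of_real ((x + t) powr (b - 1))) =
      of_real x powr (a + of_real b - 1) * laplace_beta (of_real x) a b"
    using x by (rule laplace_beta_scale)
  finally show ?thesis by (simp add: mult_ac)
qed

section \<open>The Wronskian of the two kinds\<close>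

lemma kummer_wronskian_limit:
  assumes a: "Re a > 0" and b: "b > 0"
    and e: "\<And>n. e n > 0" "\<And>n. e n \<le> (1::real)" and e0: "e \<longlonglongrightarrow> 0"
  shows "(\<lambda>n. of_real (e n) powr (a + of_real b) * laplace_beta (of_real (e n)) a (b + 1)) \<longlonglongrightarrow> Gamma (a + of_real b)"
    and "(\<lambda>n. of_real (e n) powr (a + of_real b) * laplace_beta (of_real (e n)) a b) \<longlonglongrightarrow> 0"
proof -
  have w: "set_integrable lborel {0<..} (\<lambda>t::real. exp (- (1 * t)) * t powr (Re a - 1) * (1 + t) powr b)"
    using a by (intro set_integrable_laplace_beta_majorant) auto
  have nrm: "norm (gamma_kernel a t * of_real u) = exp (- (1 * t)) * t powr (Re a - 1) * \<bar>u\<bar>" if "t > 0" for t u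
    using that by (simp add: norm_mult norm_powr_real_powr)
  have cont: "continuous_on {0<..} (\<lambda>t. gamma_kernel a t * of_real (u t))"
    if "continuous_on {0<..} u" for u
    using that by (intro continuous_intros) (auto simp: complex_nonpos_Reals_iff)
  have le: "(y + t) powr b \<le> (1 + t) powr b" if "0 < t" "0 < y" "y \<le> 1" for t y :: real
    using that b by (intro powr_mono2) auto

  have "(\<lambda>n. LINT t:{0<..}|lborel. gamma_kernel a t * of_real ((e n + t) powr b)) \<longlonglongrightarrow>
    (LINT t:{0<..}|lborel. gamma_kernel a t * of_real (t powr b))"
  proof (rule set_integral_dominated_convergence[OF _ _ _ w])
    show "continuous_on {0<..} (\<lambda>t. gamma_kernel a t * of_real ((e n + t) powr b))" for n
      using e(1)[of n] by (intro cont continuous_intros) auto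
    show "continuous_on {0<..} (\<lambda>t. gamma_kernel a t * of_real (t powr b))"
      by (intro cont continuous_intros) auto
    fix t :: real assume "t \<in> {0<..}"
    hence t: "t > 0" by simp
    have "(\<lambda>n. (e n + t) powr b) \<longlonglongrightarrow> (0 + t) powr b"
      using t by (intro tendsto_intros e0) auto
    hence "(\<lambda>n. (e n + t) powr b) \<longlonglongrightarrow> t powr b" by simp
    thus "(\<lambda>n. gamma_kernel a t * of_real ((e n + t) powr b)) \<longlonglongrightarrow>
        gamma_kernel a t * of_real (t powr b)"
      by (intro tendsto_mult tendsto_const tendsto_of_real)
    show "norm (gamma_kernel a t * of_real ((e n + t) powr b)) \<le> exp (- (1 * t)) * t powr (Re a - 1) * (1 + t) powr b" for n
      unfolding nrm[OF t] using le[OF t e] by (intro mult_left_mono) auto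
  qed simp
  also have "(LINT t:{0<..}|lborel. gamma_kernel a t * of_real (t powr b)) =
      (LINT t:{0<..}|lborel. of_real t powr (a + of_real b - 1) * exp (- complex_of_real t))"
  proof (intro set_lebesgue_integral_cong allI impI)
    fix t :: real assume "t \<in> {0<..}"
    hence t: "t > 0" by simp
    have "of_real t powr (a + of_real b - 1) = of_real t powr (a - 1 + of_real b)" by (simp add: algebra_simps)
    also have "\<dots> = of_real t powr (a - 1) * of_real (t powr b)"
      unfolding powr_add using t powr_of_real[of t b] by simp
    finally show "gamma_kernel a t * of_real (t powr b) = of_real t powr (a + of_real b - 1) * exp (- complex_of_real t)"
      by (simp add: mult_ac)
  qed simp
  also have "\<dots> = Gamma (a + of_real b)" using a b by (intro Gamma_set_integral(2)) auto
  finally show "(\<lambda>n. of_real (e n) powr (a + of_real b) * laplace_beta (of_real (e n)) a (b + 1)) \<longlonglongrightarrow> Gamma (a + of_real b)"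
    using laplace_beta_scale[OF e(1), where a = a and b = "b + 1"] by simp

  \<comment> \<open>With \<open>b\<close> in place of \<open>b + 1\<close>, the scaled power
    \<open>a + b\<close> exceeds the one of \<open>laplace_beta_scale\<close> by 1; this is the
    extra factor \<open>e n\<close>, which drives the integrand to zero.\<close>
  have "(\<lambda>n. LINT t:{0<..}|lborel. gamma_kernel a t * of_real (e n * (e n + t) powr (b - 1))) \<longlonglongrightarrow>
    (LINT t:{0<..}|lborel. gamma_kernel a t * of_real 0)"
  proof (rule set_integral_dominated_convergence[OF _ _ _ w])
    show "continuous_on {0<..} (\<lambda>t. gamma_kernel a t * of_real (e n * (e n + t) powr (b - 1)))" for n
      using e(1)[of n] by (intro cont continuous_intros) auto
    show "continuous_on {0<..} (\<lambda>t. gamma_kernel a t * of_real 0)"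
      by (intro cont continuous_intros)
    fix t :: real assume "t \<in> {0<..}"
    hence t: "t > 0" by simp
    have "(\<lambda>n. e n * (e n + t) powr (b - 1)) \<longlonglongrightarrow> 0 * (0 + t) powr (b - 1)"
      using t by (intro tendsto_intros e0) auto
    hence "(\<lambda>n. e n * (e n + t) powr (b - 1)) \<longlonglongrightarrow> 0" by simp
    thus "(\<lambda>n. gamma_kernel a t * of_real (e n * (e n + t) powr (b - 1))) \<longlonglongrightarrow>
        gamma_kernel a t * of_real 0"
      by (intro tendsto_mult tendsto_const tendsto_of_real)
    show "norm (gamma_kernel a t * of_real (e n * (e n + t) powr (b - 1))) \<le> exp (- (1 * t)) * t powr (Re a - 1) * (1 + t) powr b" for n
    proof -
      \<comment> \<open>For \<open>b < 1\<close> the power alone has no useful bound near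
        \<open>t = 0\<close>; replacing the factor \<open>e n\<close> by \<open>e n + t\<close>
        raises the exponent to \<open>b\<close>.\<close>
      have "\<bar>e n * (e n + t) powr (b - 1)\<bar> \<le> (e n + t) * (e n + t) powr (b - 1)"
        using e(1)[of n] t by (simp add: abs_mult)
      also have "\<dots> = (e n + t) powr b"
        using e(1)[of n] t powr_add[of "e n + t" 1 "b - 1"] by simp
      also have "\<dots> \<le> (1 + t) powr b" by (rule le[OF t e])
      finally show ?thesis unfolding nrm[OF t] by (intro mult_left_mono) auto
    qed
  qed simp
  also have "(\<lambda>n. LINT t:{0<..}|lborel. gamma_kernel a t * of_real (e n * (e n + t) powr (b - 1))) =
    (\<lambda>n. of_real (e n) powr (a + of_real b) * laplace_beta (of_real (e n)) a b)"
  proof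
    fix n
    have "(LINT t:{0<..}|lborel. gamma_kernel a t * of_real (e n * (e n + t) powr (b - 1))) =
      (LINT t:{0<..}|lborel. of_real (e n) * (gamma_kernel a t * of_real ((e n + t) powr (b - 1))))"
      by (intro set_lebesgue_integral_cong) auto
    also have "\<dots> = of_real (e n) * (of_real (e n) powr (a + of_real b - 1) * laplace_beta (of_real (e n)) a b)"
      unfolding set_integral_mult_right laplace_beta_scale[OF e(1)] ..
    finally have E: "(LINT t:{0<..}|lborel. gamma_kernel a t * of_real (e n * (e n + t) powr (b - 1))) =
      of_real (e n) * (of_real (e n) powr (a + of_real b - 1) * laplace_beta (of_real (e n)) a b)" .
    have p: "of_real (e n) powr (a + of_real b) = of_real (e n) * of_real (e n) powr (a + of_real b - 1)"
      using e(1)[of n] powr_add[of "of_real (e n)" 1 "a + of_real b - 1"] by simp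
    show "(LINT t:{0<..}|lborel. gamma_kernel a t * of_real (e n * (e n + t) powr (b - 1))) =
      of_real (e n) powr (a + of_real b) * laplace_beta (of_real (e n)) a b"
      unfolding E p by (simp only: mult.assoc)
  qed
  finally show "(\<lambda>n. of_real (e n) powr (a + of_real b) * laplace_beta (of_real (e n)) a b) \<longlonglongrightarrow> 0" by simp
qed

text \<open>
  Abel's formula: \<open>x powr (a + b) * exp (- x)\<close> times the left-hand side has derivative \<open>0\<close>, and
  the constant is read off at \<open>x \<rightarrow> 0\<close>.
\<close>

lemma kummer_wronskian:
  assumes a: "Re a > 0" and b: "b > 0" and x: "Re x > 0"
  shows "kummer_y a b x * laplace_beta x a (b + 1) - of_real b * kummer_y a (b + 1) x * laplace_beta x a b =
    x powr (- (a + of_real b)) * exp x"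
proof -
  define W where "W = (\<lambda>x. kummer_y a b x * laplace_beta x a (b + 1) - of_real b * kummer_y a (b + 1) x * laplace_beta x a b)"
  define Q where "Q = (\<lambda>x. x powr (a + of_real b) * exp (- x) * W x)"
  have b1: "b + 1 \<ge> 0" "b \<ge> 0" "b + 1 + 1 = b + 2" using b by auto
  have "(Q has_field_derivative 0) (at x within {x. Re x > 0})" if "x \<in> {x. Re x > 0}" for x
  proof -
    have x: "Re x > 0" using that by simp
    have nz: "x \<notin> \<real>\<^sub>\<le>\<^sub>0" using x by (auto simp: complex_nonpos_Reals_iff)
    have x0: "x \<noteq> 0" using x by auto
    define Y1 Y2 Y3 where "Y1 = kummer_y a b x" and "Y2 = kummer_y a (b + 1) x" and "Y3 = kummer_y a (b + 2) x"
    define L1 L2 M1 M2 where "L1 = laplace_beta x a b" and "L2 = laplace_beta x a (b + 1)"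
      and "M1 = laplace_beta x (a + 1) b" and "M2 = laplace_beta x (a + 1) (b + 1)"
    note d1 = kummer_y_derivative[OF a b1(2), of x, folded Y1_def Y2_def]
    note d2 = kummer_y_derivative[OF a b1(1), of x, unfolded b1(3), folded Y2_def Y3_def]
    note e1 = laplace_beta_has_derivative[OF x a, of b, folded M1_def]
    note e2 = laplace_beta_has_derivative[OF x a, of "b + 1", folded M2_def]
    have r1: "x * (Y2 - of_real (b + 1) * Y3) = Y1 - (a + of_real b) * Y2"
      using kummer_y_contiguous[OF a b1(2), of x] by (simp add: Y1_def Y2_def Y3_def)
    have r2: "x * M2 = a * L2 + of_real b * M1"
      using laplace_beta_parts[OF x a, of b] by (simp add: M1_def M2_def L2_def)
    have r3: "L2 = L1 + M1"
      using laplace_beta_contiguous[OF x a, of b] by (simp add: M1_def L1_def L2_def)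
    define W' where "W' = Y1 * (- M2) + (Y1 - of_real b * Y2) * L2 - of_real b * (Y2 * (- M1) + (Y2 - of_real (b + 1) * Y3) * L1)"
    have dW: "(W has_field_derivative W') (at x)"
    proof -
      have "((\<lambda>x. kummer_y a b x * laplace_beta x a (b + 1) - of_real b * (kummer_y a (b + 1) x * laplace_beta x a b)) has_field_derivative W') (at x)"
        unfolding W'_def
        using DERIV_diff[OF DERIV_mult'[OF d1 e2] DERIV_cmult[OF DERIV_mult'[OF d2 e1], of "of_real b"]]
        by (simp add: Y1_def Y2_def L1_def L2_def)
      thus ?thesis by (simp add: W_def[abs_def] mult.assoc)
    qed
    \<comment> \<open>Abel's first-order equation. Multiplication by \<open>x\<close> makes
      \<open>r1\<close> and \<open>r2\<close> applicable to the values at \<open>b + 2\<close> and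
      \<open>a + 1\<close>, and \<open>r3\<close> removes what is left over.\<close>
    have xW: "x * W' = x * W x - (a + of_real b) * W x"
    proof -
      have "x * W' = Y1 * (- (x * M2)) + x * (Y1 - of_real b * Y2) * L2 - of_real b * (x * Y2 * (- M1) + (x * (Y2 - of_real (b + 1) * Y3)) * L1)"
        unfolding W'_def by (simp add: algebra_simps)
      also have "\<dots> = x * (Y1 * L2 - of_real b * Y2 * L1) - (a + of_real b) * (Y1 * L2 - of_real b * Y2 * L1)"
        unfolding r1 r2 r3 by (simp add: algebra_simps)
      finally show ?thesis by (simp add: W_def Y1_def Y2_def L1_def L2_def)
    qed
    have d3: "((\<lambda>x. x powr (a + of_real b)) has_field_derivative (a + of_real b) * x powr (a + of_real b - 1)) (at x)"
      by (rule has_field_derivative_powr[OF nz])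
    have d4: "((\<lambda>x. exp (- x)) has_field_derivative - exp (- x)) (at x)" by (auto intro!: derivative_eq_intros)
    have "(Q has_field_derivative (x powr (a + of_real b) * exp (- x)) * W' +
        (x powr (a + of_real b) * (- exp (- x)) + (a + of_real b) * x powr (a + of_real b - 1) * exp (- x)) * W x) (at x)"
      unfolding Q_def by (rule DERIV_mult'[OF DERIV_mult'[OF d3 d4] dW])
    also have "(x powr (a + of_real b) * exp (- x)) * W' +
        (x powr (a + of_real b) * (- exp (- x)) + (a + of_real b) * x powr (a + of_real b - 1) * exp (- x)) * W x =
        x powr (a + of_real b - 1) * exp (- x) * (x * W' - x * W x + (a + of_real b) * W x)"
    proof -
      have "x powr (a + of_real b) = x * x powr (a + of_real b - 1)"
        using powr_add[of x 1 "a + of_real b - 1"] x0 by simp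
      thus ?thesis by (simp add: algebra_simps)
    qed
    also have "\<dots> = 0" unfolding xW by simp
    finally show ?thesis by (rule has_field_derivative_at_within)
  qed
  hence "\<exists>c. \<forall>x\<in>{x. Re x > 0}. Q x = c"
    by (intro has_field_derivative_zero_constant convex_halfspace_Re_gt) auto
  then obtain C where C: "\<And>x. Re x > 0 \<Longrightarrow> Q x = C" by auto
  \<comment> \<open>Along this sequence the series tends to its constant term
    \<open>rGamma (a + b)\<close>, one scaled integral to \<open>Gamma (a + b)\<close> and the other
    to 0, so the constant is 1.\<close>
  define e where "e = (\<lambda>n. inverse (real (Suc n)))"
  have e: "e n > 0" "e n \<le> 1" for n by (auto simp: e_def field_simps)
  have e1: "e \<longlonglongrightarrow> 0" unfolding e_def by (rule LIMSEQ_inverse_real_of_nat)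
  hence e0: "(\<lambda>n. complex_of_real (e n)) \<longlonglongrightarrow> of_real 0" by (rule tendsto_of_real)
  have yl: "(\<lambda>n. kummer_y a b' (of_real (e n))) \<longlonglongrightarrow> rGamma (a + of_real b')" if "b' \<ge> 0" for b'
  proof -
    have "isCont (kummer_y a b') 0" by (rule DERIV_isCont[OF kummer_y_derivative[OF a that]])
    hence "(\<lambda>n. kummer_y a b' (of_real (e n))) \<longlonglongrightarrow> kummer_y a b' 0"
      by (rule isCont_tendsto_compose) (use e0 in simp)
    also have "kummer_y a b' 0 = kummer_coeff a b' 0"
      unfolding kummer_y_def by simp
    finally show ?thesis by (simp add: kummer_coeff_def)
  qed
  have "(\<lambda>n. exp (- complex_of_real (e n)) *
      (kummer_y a b (of_real (e n)) * (of_real (e n) powr (a + of_real b) * laplace_beta (of_real (e n)) a (b + 1)) -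
       of_real b * kummer_y a (b + 1) (of_real (e n)) * (of_real (e n) powr (a + of_real b) * laplace_beta (of_real (e n)) a b)))
    \<longlonglongrightarrow> exp (- of_real 0) * (rGamma (a + of_real b) * Gamma (a + of_real b) - of_real b * rGamma (a + of_real (b + 1)) * 0)"
    by (intro tendsto_mult tendsto_diff tendsto_const tendsto_exp tendsto_minus e0 yl b1
        kummer_wronskian_limit[where e = e, OF a b e e1])
  also have "(\<lambda>n. exp (- complex_of_real (e n)) *
      (kummer_y a b (of_real (e n)) * (of_real (e n) powr (a + of_real b) * laplace_beta (of_real (e n)) a (b + 1)) -
       of_real b * kummer_y a (b + 1) (of_real (e n)) * (of_real (e n) powr (a + of_real b) * laplace_beta (of_real (e n)) a b))) = (\<lambda>n. C)"
  proof
    fix n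
    have "C = Q (of_real (e n))" using C[of "of_real (e n)"] e(1)[of n] by simp
    thus "exp (- complex_of_real (e n)) *
      (kummer_y a b (of_real (e n)) * (of_real (e n) powr (a + of_real b) * laplace_beta (of_real (e n)) a (b + 1)) -
       of_real b * kummer_y a (b + 1) (of_real (e n)) * (of_real (e n) powr (a + of_real b) * laplace_beta (of_real (e n)) a b)) = C"
      by (simp add: Q_def W_def algebra_simps)
  qed
  finally have "C = rGamma (a + of_real b) * Gamma (a + of_real b)" by (simp add: LIMSEQ_const_iff)
  also have "\<dots> = 1"
  proof -
    have "a + of_real b \<notin> \<int>\<^sub>\<le>\<^sub>0"
    proof
      assume "a + of_real b \<in> \<int>\<^sub>\<le>\<^sub>0"
      then obtain n where n: "a + of_real b = of_int n" "n \<le> 0" by (elim nonpos_Ints_cases)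
      have "Re a + b = of_int n" using arg_cong[OF n(1), of Re] by simp
      thus False using n(2) a b by linarith
    qed
    thus ?thesis by (simp add: Gamma_def rGamma_eq_zero_iff)
  qed
  finally have "Q x = 1" using C[OF x] by simp
  moreover have "x powr (a + of_real b) \<noteq> 0" using x by auto
  ultimately have "W x = x powr (- (a + of_real b)) * exp x"
    unfolding powr_minus by (simp add: Q_def exp_minus field_simps)
  thus ?thesis by (simp only: W_def)
qed

section \<open>The special functions of the Erlang A model\<close>

lemma hankel_integral_cong:
  assumes "\<And>z. z \<in> slit T \<Longrightarrow> f z = h z" "path_image g \<subseteq> slit T"
    and "Im (pathstart g) < 0" "pathfinish g = cnj (pathstart g)"
  shows "hankel_integral g f = hankel_integral g h"
proof -
  have "contour_integral g f = contour_integral g h"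
    using assms by (intro contour_integral_cong) auto
  moreover have "(LINT x:{..u}|lborel. f (Complex x y)) = (LINT x:{..u}|lborel. h (Complex x y))" if "y \<noteq> 0" for u y
    using that by (intro set_lebesgue_integral_cong) (auto intro!: assms(1) simp: slit_def)
  ultimately show ?thesis using assms(3,4) by (simp add: hankel_integral_def)
qed

lemma powr_of_int_add:
  fixes z :: complex
  assumes "z \<noteq> 0" shows "z powi k * z powr of_real c = z powr of_real (of_int k + c)"
proof -
  have "z powr of_real (of_int k + c) = z powr of_int k * z powr of_real c"
    by (simp add: powr_add)
  thus ?thesis using assms by (simp add: complex_powr_of_int)
qed

text \<open>The integer power of \<open>z\<close> and the principal power with exponent
  \<open>m / \<eta>\<close> merge into one principal power with exponent \<open>b\<close>. The
  contour can then be replaced by the one with corners \<open>2 - 2 * \<i>\<close> and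
  \<open>2 + 2 * \<i>\<close>.\<close>

lemma erlang_H_eq:
  assumes g: "contour_C1 g" and pos: "\<rho> > 0" "\<eta> > 0" "Re \<theta> > 0"
    and b: "b = of_int n + 1 - real m + real m / \<eta>" "b \<ge> 0"
  defines "a \<equiv> \<theta> / of_real \<eta>" and "x \<equiv> \<rho> / \<eta>"
  shows "erlang_H g \<rho> \<eta> m n \<theta> = of_real x powr (a + of_real b - 1) * kummer_y a b (of_real x)"
proof -
  let ?T = "{1::real<..}"
  have a: "Re a > 0" and x: "x > 0" using pos by (simp_all add: a_def x_def)
  have slit: "slit ?T = - {z. Im z = 0 \<and> Re z \<le> 1}" by (auto simp: slit_def)
  have g': "valid_path g" "path_image g \<subseteq> slit ?T" "Im (pathstart g) < 0" "pathfinish g = cnj (pathstart g)"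
    using g unfolding contour_C1_def hankel_contour_def slit by auto
  define f where "f = (\<lambda>z. exp (of_real x * z) * ((z - 1) powr (- a) * z powr (- of_real b)))"
  have "erlang_H g \<rho> \<eta> m n \<theta> = 1 / (2 * of_real pi * \<i>) * hankel_integral g f"
    unfolding erlang_H_def
  proof (intro arg_cong2[where f = "(*)"] refl hankel_integral_cong[OF _ g'(2-4)])
    fix z assume z: "z \<in> slit ?T"
    have z0: "z \<noteq> 0" using z by (auto simp: slit_def)
    have "z powi (n + 1 - int m) * z powr of_real (real m / \<eta>) = z powr of_real b"
      unfolding powr_of_int_add[OF z0] b by simp
    hence e: "(z - 1) powr a * z powi (n + 1 - int m) * z powr of_real (real m / \<eta>) = (z - 1) powr a * z powr of_real b"
      by (simp only: mult.assoc)
    show "exp (of_real \<rho> * z / of_real \<eta>) / ((z - 1) powr (\<theta> / of_real \<eta>) * z powi (n + 1 - int m) * z powr of_real (real m / \<eta>)) = f z"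
      unfolding a_def[symmetric] e by (simp add: f_def x_def powr_minus divide_inverse mult_ac)
  qed
  also have "hankel_integral g f = hankel_line 2 2 f"
  proof (rule hankel_integral_eq_line[OF _ _ _ _ _ _ g'])
    show "f holomorphic_on slit ?T"
      unfolding f_def by (intro holomorphic_intros) (auto simp: slit_def complex_nonpos_Reals_iff)
    show "hankel_decay f"
      unfolding f_def
      by (intro hankel_decay_exp_mult x subexponential_mult subexponential_powr_id subexponential_powr)
         (auto intro: order_trans[OF norm_triangle_ineq4])
  qed auto
  also have "\<dots> = 2 * of_real pi * \<i> * of_real x powr (a + of_real b - 1) * kummer_y a b (of_real x)"
    unfolding f_def by (rule hankel_line_kummer[OF a b(2) x])
  finally show ?thesis by simp
qed

text \<open>As for \<open>erlang_H_eq\<close>, but the contour now has to cross the real axis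
  between 0 and 1; the corners are \<open>1 / 2 - \<i>\<close> and
  \<open>1 / 2 + \<i>\<close>.\<close>

lemma erlang_I_eq:
  assumes g: "contour_C2 g" and pos: "\<rho> > 0" "\<eta> > 0" "Re \<theta> > 0"
    and b: "b = of_int n + 1 - real m + real m / \<eta>" "b \<ge> 0"
  defines "a \<equiv> \<theta> / of_real \<eta>" and "x \<equiv> \<rho> / \<eta>"
  shows "erlang_I g \<rho> \<eta> m n \<theta> =
    of_real x powr (a + of_real b - 1) * (rGamma a * of_real (rGamma b) * laplace_beta (of_real x) a b)"
proof -
  let ?T = "{0::real<..<1}"
  have a: "Re a > 0" and x: "x > 0" using pos by (simp_all add: a_def x_def)
  have slit: "slit ?T = - ({z. Im z = 0 \<and> Re z \<le> 0} \<union> {z. Im z = 0 \<and> Re z \<ge> 1})" by (auto simp: slit_def)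
  have g': "valid_path g" "path_image g \<subseteq> slit ?T" "Im (pathstart g) < 0" "pathfinish g = cnj (pathstart g)"
    using g unfolding contour_C2_def hankel_contour_def slit by auto
  define f where "f = (\<lambda>z. exp (of_real x * z) * ((1 - z) powr (- a) * z powr (- of_real b)))"
  have "erlang_I g \<rho> \<eta> m n \<theta> = 1 / (2 * of_real pi * \<i>) * hankel_integral g f"
    unfolding erlang_I_def
  proof (intro arg_cong2[where f = "(*)"] refl hankel_integral_cong[OF _ g'(2-4)])
    fix z assume z: "z \<in> slit ?T"
    have z0: "z \<noteq> 0" using z by (auto simp: slit_def)
    have "z powi (n + 1 - int m) * z powr of_real (real m / \<eta>) = z powr of_real b"
      unfolding powr_of_int_add[OF z0] b by simp
    hence e: "(1 - z) powr a * z powi (n + 1 - int m) * z powr of_real (real m / \<eta>) = (1 - z) powr a * z powr of_real b"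
      by (simp only: mult.assoc)
    show "exp (of_real \<rho> * z / of_real \<eta>) / ((1 - z) powr (\<theta> / of_real \<eta>) * z powi (n + 1 - int m) * z powr of_real (real m / \<eta>)) = f z"
      unfolding a_def[symmetric] e by (simp add: f_def x_def powr_minus divide_inverse mult_ac)
  qed
  also have "hankel_integral g f = hankel_line (1 / 2) 1 f"
  proof (rule hankel_integral_eq_line[OF _ _ _ _ _ _ g'])
    show "f holomorphic_on slit ?T"
      unfolding f_def by (intro holomorphic_intros) (auto simp: slit_def complex_nonpos_Reals_iff)
    show "hankel_decay f"
      unfolding f_def
      by (intro hankel_decay_exp_mult x subexponential_mult subexponential_powr_id subexponential_powr)
         (auto intro: order_trans[OF norm_triangle_ineq4])
  qed auto
  also have "\<dots> = 2 * of_real pi * \<i> * of_real x powr (a + of_real b - 1) * (rGamma a * of_real (rGamma b) * laplace_beta (of_real x) a b)"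
    unfolding f_def by (rule hankel_line_laplace_beta[OF a b(2) x])
  finally show ?thesis by simp
qed

text \<open>The contiguous relation at \<open>b - 1\<close>, with powers of \<open>x\<close>
  distributed over its terms; this is the forward recurrence above \<open>m\<close> after division
  by \<open>\<eta>\<close>.\<close>

lemma kummer_recurrence:
  assumes a: "Re a > 0" and b: "b \<ge> 1" and x: "x > 0"
  shows "(a + of_real (b - 1) + of_real x) * (of_real x powr (a + of_real b - 1) * kummer_y a b (of_real x)) =
    of_real x * (of_real x powr (a + of_real (b - 1) - 1) * kummer_y a (b - 1) (of_real x)) +
    of_real b * (of_real x powr (a + of_real (b + 1) - 1) * kummer_y a (b + 1) (of_real x))"
proof -
  define p where "p = of_real x powr (a + of_real b - 1 :: complex)"
  have p1: "of_real x * of_real x powr (a + of_real (b - 1) - 1) = p"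
    using x powr_add[of "of_real x" 1 "a + of_real (b - 1) - 1"] by (simp add: p_def algebra_simps)
  have p2: "of_real x powr (a + of_real (b + 1) - 1) = of_real x * p"
    using x powr_add[of "of_real x" 1 "a + of_real b - 1"] by (simp add: p_def algebra_simps)
  have "of_real x * (kummer_y a b (of_real x) - of_real b * kummer_y a (b + 1) (of_real x)) =
      kummer_y a (b - 1) (of_real x) - (a + of_real (b - 1)) * kummer_y a b (of_real x)"
    using kummer_y_contiguous[OF a, of "b - 1" "of_real x"] b by (simp add: add.commute)
  hence c: "kummer_y a (b - 1) (of_real x) = (a + of_real (b - 1) + of_real x) * kummer_y a b (of_real x) - of_real x * of_real b * kummer_y a (b + 1) (of_real x)"
    by (simp add: algebra_simps)
  show ?thesis
    unfolding mult.assoc[symmetric] p1 p2 c p_def[symmetric] by (simp add: algebra_simps)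
qed

text \<open>Integration by parts and two contiguous relations eliminate the integrals with
  \<open>a + 1\<close>; the factors \<open>rGamma b\<close> bring the coefficients into the form
  obeyed by the functions of the first kind.\<close>

lemma laplace_beta_recurrence:
  assumes a: "Re a > 0" and b: "b > 1" and x: "x > 0"
  defines "I \<equiv> \<lambda>b. of_real x powr (a + of_real b - 1) * (rGamma a * of_real (rGamma b) * laplace_beta (of_real x) a b)"
  shows "(a + of_real (b - 1) + of_real x) * I b = of_real x * I (b - 1) + of_real b * I (b + 1)"
proof -
  define p where "p = of_real x powr (a + of_real b - 1 :: complex)"
  have x': "Re (complex_of_real x) > 0" using x by simp
  have p1: "of_real x * of_real x powr (a + of_real (b - 1) - 1) = p"
    using x powr_add[of "of_real x" 1 "a + of_real (b - 1) - 1"] by (simp add: p_def algebra_simps)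
  have p2: "of_real x powr (a + of_real (b + 1) - 1) = of_real x * p"
    using x powr_add[of "of_real x" 1 "a + of_real b - 1"] by (simp add: p_def algebra_simps)
  have g1: "rGamma (b - 1) = (b - 1) * rGamma b" using rGamma_plus1[of "b - 1"] by simp
  have g2: "b * rGamma (b + 1) = rGamma b" by (rule rGamma_plus1)
  define L0 L1 L2 M0 M1 where "L0 = laplace_beta (of_real x) a (b - 1)" and "L1 = laplace_beta (of_real x) a b"
    and "L2 = laplace_beta (of_real x) a (b + 1)" and "M0 = laplace_beta (of_real x) (a + 1) (b - 1)" and "M1 = laplace_beta (of_real x) (a + 1) b"
  have r: "of_real x * M1 = a * L1 + of_real (b - 1) * M0" "L1 = L0 + M0" "L2 = L1 + M1"
    using laplace_beta_parts[OF x' a, of "b - 1"] laplace_beta_contiguous[OF x' a, of "b - 1"] laplace_beta_contiguous[OF x' a, of b]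
    by (simp_all add: L0_def L1_def L2_def M0_def M1_def)
  have key: "(a + of_real (b - 1) + of_real x) * L1 = of_real (b - 1) * L0 + of_real x * L2"
    unfolding r(3) distrib_left[of "of_real x"] r(1) using r(2) by (simp add: algebra_simps)
  have "of_real x * I (b - 1) = (of_real x * of_real x powr (a + of_real (b - 1) - 1)) * (rGamma a * of_real (rGamma (b - 1)) * L0)"
    by (simp add: I_def L0_def)
  also have "\<dots> = p * rGamma a * of_real (rGamma b) * (of_real (b - 1) * L0)"
    unfolding p1 g1 by simp
  finally have i0: "of_real x * I (b - 1) = p * rGamma a * of_real (rGamma b) * (of_real (b - 1) * L0)" .
  have "of_real b * I (b + 1) = of_real x * p * rGamma a * (of_real (b * rGamma (b + 1))) * L2"
    unfolding I_def p2 L2_def by simp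
  also have "\<dots> = p * rGamma a * of_real (rGamma b) * (of_real x * L2)" unfolding g2 by simp
  finally have i2: "of_real b * I (b + 1) = p * rGamma a * of_real (rGamma b) * (of_real x * L2)" .
  have "(a + of_real (b - 1) + of_real x) * I b = p * rGamma a * of_real (rGamma b) * ((a + of_real (b - 1) + of_real x) * L1)"
    by (simp add: I_def p_def L1_def)
  thus ?thesis unfolding i0 i2 key by (simp add: distrib_left)
qed

text \<open>Since \<open>rGamma b = b * rGamma (b + 1)\<close>, both products share the factor
  \<open>rGamma (b + 1)\<close>, and the remaining bracket is the Wronskian expression; a step in
  \<open>b\<close> acts like a derivative in \<open>x\<close>.\<close>

lemma erlang_casoratian:
  assumes a: "Re a > 0" and b: "b > 0" and x: "x > 0"
  defines "I \<equiv> \<lambda>b. of_real x powr (a + of_real b - 1) * (rGamma a * of_real (rGamma b) * laplace_beta (of_real x) a b)"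
    and "H \<equiv> \<lambda>b. of_real x powr (a + of_real b - 1) * kummer_y a b (of_real x)"
  shows "H b * I (b + 1) - H (b + 1) * I b =
    of_real x powr (a + of_real b - 1) * of_real (exp x) * (rGamma a * of_real (rGamma (b + 1)))"
proof -
  define p where "p = of_real x powr (a + of_real b - 1 :: complex)"
  have p2: "of_real x powr (a + of_real (b + 1) - 1) = of_real x * p"
    using x powr_add[of "of_real x" 1 "a + of_real b - 1"] by (simp add: p_def algebra_simps)
  have p3: "of_real x * p * of_real x powr (- (a + of_real b)) = 1"
  proof -
    have "of_real x * p = of_real x powr (a + of_real b)" using p2 by (simp add: algebra_simps)
    thus ?thesis using x by (simp only: powr_add[symmetric]) simp
  qed
  have g: "rGamma b = b * rGamma (b + 1)" by (rule rGamma_plus1[symmetric])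
  have "H b * I (b + 1) - H (b + 1) * I b = of_real x * p * p * (rGamma a * of_real (rGamma (b + 1))) *
    (kummer_y a b (of_real x) * laplace_beta (of_real x) a (b + 1) - of_real b * kummer_y a (b + 1) (of_real x) * laplace_beta (of_real x) a b)"
    unfolding H_def I_def p2 p_def[symmetric] g by (simp add: algebra_simps)
  also have "\<dots> = (of_real x * p * of_real x powr (- (a + of_real b))) * p * of_real (exp x) * (rGamma a * of_real (rGamma (b + 1)))"
    using kummer_wronskian[OF a b, of "of_real x"] x by (simp add: exp_of_real[symmetric])
  also have "\<dots> = p * of_real (exp x) * (rGamma a * of_real (rGamma (b + 1)))" unfolding p3 by simp
  finally show ?thesis by (simp add: p_def)
qed

section \<open>The functions \<open>F\<close> below level \<open>m\<close>\<close>

lemma powr_int_Suc: "(z::complex) \<noteq> 0 \<Longrightarrow> z powi (k + 1) = z * z powi k"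
  by (simp add: power_int_add)

text \<open>A total derivative integrates to zero over the closed circle, and for a suitable
  \<open>\<Phi>\<close> this derivative is the required combination of three integrands.\<close>

lemma erlang_F_recurrence:
  assumes r: "0 < r" "r < 1"
  shows "(\<theta> + of_real \<rho> + of_int n) * erlang_F r \<rho> n \<theta> =
    of_real \<rho> * erlang_F r \<rho> (n - 1) \<theta> + of_int (n + 1) * erlang_F r \<rho> (n + 1) \<theta>"
proof -
  define k where "k = (\<lambda>n z. exp (of_real \<rho> * z) / (z powi (n + 1) * (1 - z) powr \<theta>))"
  define S where "S = ball (0::complex) 1 - {0}"
  have S: "z \<noteq> 0" "1 - z \<notin> \<real>\<^sub>\<le>\<^sub>0" "Re z < 1" if "z \<in> S" for z
    using that abs_Re_le_cmod[of z] by (auto simp: S_def complex_nonpos_Reals_iff)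
  have pS: "path_image (circlepath 0 r) \<subseteq> S" using r by (auto simp: S_def path_image_circlepath)
  have cont: "continuous_on S (k n)" for n
    unfolding k_def by (intro continuous_intros) (auto dest: S(1,3))
  have ci: "(k n has_contour_integral (2 * of_real pi * \<i>) * erlang_F r \<rho> n \<theta>) (circlepath 0 r)" for n
  proof -
    have "k n contour_integrable_on circlepath 0 r"
      by (rule contour_integrable_continuous_circlepath) (rule continuous_on_subset[OF cont pS])
    from has_contour_integral_integral[OF this] show ?thesis by (simp add: erlang_F_def k_def)
  qed
  \<comment> \<open>The integrand of \<open>F\<close> with an extra factor \<open>1 - z\<close>, so
    that differentiation yields exactly the powers \<open>- n\<close>, \<open>- (n + 1)\<close> and
    \<open>- (n + 2)\<close> of \<open>z\<close>.\<close>
  define \<Phi> where "\<Phi> = (\<lambda>z. exp (of_real \<rho> * z) * (1 - z) powr (1 - \<theta>) * z powi (- (n + 1)))"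
  define \<Phi>' where "\<Phi>' = (\<lambda>z. (\<theta> + of_real \<rho> + of_int n) * k n z - of_real \<rho> * k (n - 1) z - of_int (n + 1) * k (n + 1) z)"
  have d: "(\<Phi> has_field_derivative \<Phi>' z) (at z within S)" if "z \<in> S" for z
  proof -
    note z = S[OF that]
    define E where "E = exp (of_real \<rho> * z) * (1 - z) powr (- \<theta>)"
    define Q where "Q = z powi (- (n + 2))"
    have i: "- (n + 1) = - (n + 2) + 1" "- n = - (n + 1) + 1" by simp_all
    have q1: "z powi (- (n + 1)) = z * Q" unfolding i(1) powr_int_Suc[OF z(1)] Q_def ..
    have q2: "z powi (- n) = z * (z * Q)" unfolding i(2) powr_int_Suc[OF z(1)] q1 ..
    note q = q1 q2
    have one: "(1 - z) powr (1 - \<theta>) = (1 - z) * (1 - z) powr (- \<theta>)"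
    proof -
      have "1 - z \<noteq> 0" using z(2) by auto
      thus ?thesis using powr_add[of "1 - z" 1 "- \<theta>"] by simp
    qed
    have kk: "k j z = E * z powi (- (j + 1))" for j
      using power_int_minus[of z "j + 1"] by (simp add: k_def E_def powr_minus divide_inverse)
    have k1: "k n z = E * (z * Q)" using kk[of n] unfolding q .
    have k2: "k (n - 1) z = E * (z * (z * Q))" using kk[of "n - 1"] q2 by simp
    have k3: "k (n + 1) z = E * Q" using kk[of "n + 1"] unfolding Q_def add.assoc one_add_one .
    note k = k1 k2 k3
    have "(\<Phi> has_field_derivative
       (exp (of_real \<rho> * z) * (1 - z) powr (1 - \<theta>)) * (of_int (- (n + 1)) * z powi (- (n + 1) - 1)) +
       (exp (of_real \<rho> * z) * (- ((1 - \<theta>) * (1 - z) powr (1 - \<theta> - 1))) + of_real \<rho> * exp (of_real \<rho> * z) * (1 - z) powr (1 - \<theta>)) * z powi (- (n + 1))) (at z)"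
      unfolding \<Phi>_def
    proof (intro DERIV_mult')
      show "((\<lambda>z. exp (of_real \<rho> * z)) has_field_derivative of_real \<rho> * exp (of_real \<rho> * z)) (at z)"
        by (auto intro!: derivative_eq_intros)
      show "((\<lambda>z. (1 - z) powr (1 - \<theta>)) has_field_derivative - ((1 - \<theta>) * (1 - z) powr (1 - \<theta> - 1))) (at z)"
        using z(2) by (auto intro!: derivative_eq_intros)
      show "((\<lambda>z. z powi (- (n + 1))) has_field_derivative of_int (- (n + 1)) * z powi (- (n + 1) - 1)) (at z)"
        using z(1) by (auto intro!: derivative_eq_intros)
    qed
    also have "(exp (of_real \<rho> * z) * (1 - z) powr (1 - \<theta>)) * (of_int (- (n + 1)) * z powi (- (n + 1) - 1)) +
       (exp (of_real \<rho> * z) * (- ((1 - \<theta>) * (1 - z) powr (1 - \<theta> - 1))) + of_real \<rho> * exp (of_real \<rho> * z) * (1 - z) powr (1 - \<theta>)) * z powi (- (n + 1)) =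
       E * (1 - z) * (of_int (- (n + 1)) * Q) + (- ((1 - \<theta>) * E) + of_real \<rho> * E * (1 - z)) * (z * Q)"
    proof -
      have i: "- (n + 1) - 1 = - (n + 2)" "1 - \<theta> - 1 = - \<theta>" by simp_all
      show ?thesis unfolding i q one Q_def[symmetric] E_def by (simp add: mult_ac distrib_left right_diff_distrib)
    qed
    also have "\<dots> = \<Phi>' z" unfolding \<Phi>'_def k by (simp add: algebra_simps)
    finally show ?thesis by (rule has_field_derivative_at_within)
  qed
  have "(\<Phi>' has_contour_integral 0) (circlepath 0 r)"
    using contour_integral_primitive[OF d, of "circlepath 0 r"] pS by simp
  moreover have "(\<Phi>' has_contour_integral ((\<theta> + of_real \<rho> + of_int n) * ((2 * of_real pi * \<i>) * erlang_F r \<rho> n \<theta>)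
      - of_real \<rho> * ((2 * of_real pi * \<i>) * erlang_F r \<rho> (n - 1) \<theta>)
      - of_int (n + 1) * ((2 * of_real pi * \<i>) * erlang_F r \<rho> (n + 1) \<theta>))) (circlepath 0 r)"
    unfolding \<Phi>'_def by (intro has_contour_integral_diff has_contour_integral_lmul ci)
  ultimately have "(\<theta> + of_real \<rho> + of_int n) * ((2 * of_real pi * \<i>) * erlang_F r \<rho> n \<theta>)
      - of_real \<rho> * ((2 * of_real pi * \<i>) * erlang_F r \<rho> (n - 1) \<theta>)
      - of_int (n + 1) * ((2 * of_real pi * \<i>) * erlang_F r \<rho> (n + 1) \<theta>) = 0"
    by (rule has_contour_integral_unique[symmetric])
  hence "(2 * of_real pi * \<i>) * ((\<theta> + of_real \<rho> + of_int n) * erlang_F r \<rho> n \<theta>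
      - of_real \<rho> * erlang_F r \<rho> (n - 1) \<theta> - of_int (n + 1) * erlang_F r \<rho> (n + 1) \<theta>) = 0"
    by (simp add: algebra_simps)
  hence "(\<theta> + of_real \<rho> + of_int n) * erlang_F r \<rho> n \<theta>
      - of_real \<rho> * erlang_F r \<rho> (n - 1) \<theta> - of_int (n + 1) * erlang_F r \<rho> (n + 1) \<theta> = 0"
    by simp
  thus ?thesis by (simp only: diff_diff_eq right_minus_eq)
qed

text \<open>At index 0 Cauchy's formula picks the value of the holomorphic factor at the origin; at
  index -1 there is no pole. The second value expresses that no birth leads into state 0.\<close>

lemma erlang_F_0:
  assumes r: "0 < r" "r < 1"
  shows "erlang_F r \<rho> 0 \<theta> = 1" and "erlang_F r \<rho> (-1) \<theta> = 0"
proof -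
  define h where "h = (\<lambda>z::complex. exp (of_real \<rho> * z) * (1 - z) powr (- \<theta>))"
  have h: "h holomorphic_on cball 0 r"
  proof -
    have "1 - z \<notin> \<real>\<^sub>\<le>\<^sub>0" if "z \<in> cball 0 r" for z :: complex
      using that abs_Re_le_cmod[of z] r by (auto simp: complex_nonpos_Reals_iff)
    thus ?thesis unfolding h_def by (intro holomorphic_intros) auto
  qed
  have "((\<lambda>u. h u / (u - 0)) has_contour_integral (2 * of_real pi * \<i>) * h 0) (circlepath 0 r)"
    by (rule Cauchy_integral_circlepath_simple[OF h]) (use r in auto)
  hence "contour_integral (circlepath 0 r) (\<lambda>u. h u / (u - 0)) = 2 * of_real pi * \<i>"
    by (simp add: contour_integral_unique h_def)
  moreover have "(\<lambda>u. h u / (u - 0)) = (\<lambda>z. exp (of_real \<rho> * z) / (z powi (0 + 1) * (1 - z) powr \<theta>))"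
    by (simp add: h_def powr_minus divide_inverse mult_ac fun_eq_iff)
  ultimately show "erlang_F r \<rho> 0 \<theta> = 1" by (simp add: erlang_F_def)
  have "(h has_contour_integral 0) (circlepath 0 r)"
    by (rule Cauchy_theorem_convex_simple[OF h]) (use r in \<open>auto simp: path_image_circlepath\<close>)
  hence "contour_integral (circlepath 0 r) h = 0" by (rule contour_integral_unique)
  moreover have "h = (\<lambda>z. exp (of_real \<rho> * z) / (z powi (- 1 + 1) * (1 - z) powr \<theta>))"
    by (simp add: h_def powr_minus divide_inverse fun_eq_iff)
  ultimately show "erlang_F r \<rho> (-1) \<theta> = 0" by (simp add: erlang_F_def)
qed

section \<open>Decay of the weights and assembly of the three formulas\<close>

lemma erlang_weight_tendsto_0:
  assumes "bd_resolvent \<rho> (erlang_A_death_rate m \<eta>) \<theta>" and \<eta>: "\<eta> > 0"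
  shows "bd_resolvent.weight \<rho> (erlang_A_death_rate m \<eta>) \<longlonglongrightarrow> 0"
proof -
  interpret bd_resolvent \<rho> "erlang_A_death_rate m \<eta>" \<theta> by fact
  \<comment> \<open>Beyond this state the death rate is at least \<open>2 * \<rho>\<close>, so the
    weights decrease at least by the factor 1/2.\<close>
  define N where "N = m + nat \<lceil>2 * \<rho> / \<eta>\<rceil>"
  have "summable weight"
  proof (rule summable_ratio_test[of "1 / 2" N])
    fix n assume n: "n \<ge> N"
    have "2 * \<rho> / \<eta> \<le> real (Suc n) - real m" using n unfolding N_def by linarith
    hence "2 * \<rho> \<le> (real (Suc n) - real m) * \<eta>" using \<eta> by (simp add: field_simps)
    hence d: "2 * \<rho> \<le> erlang_A_death_rate m \<eta> (Suc n)"
      using n unfolding erlang_A_death_rate_def N_def by simp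
    have "2 * \<rho> * weight (Suc n) \<le> erlang_A_death_rate m \<eta> (Suc n) * weight (Suc n)"
      using d by (intro mult_right_mono) (auto simp: less_imp_le)
    hence "2 * \<rho> * weight (Suc n) \<le> \<rho> * weight n" by (simp only: weight_Suc)
    thus "norm (weight (Suc n)) \<le> 1 / 2 * norm (weight n)" using rho_pos by simp
  qed simp
  thus ?thesis by (rule summable_LIMSEQ_zero)
qed

theorem theorem2:
  fixes m n\<^sub>0 :: nat and \<rho> \<eta> r :: real and \<theta> :: complex
    and M :: "'a measure" and N :: "real \<Rightarrow> 'a \<Rightarrow> nat"
    and C1 C2 :: "real \<Rightarrow> complex"
  assumes "m \<ge> 1" and "\<rho> > 0" and "\<eta> > 0" and "n\<^sub>0 \<ge> m"
    and "erlang_A_process m \<rho> \<eta> M N"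
    and "AE \<omega> in M. N 0 \<omega> = n\<^sub>0"
    and "Re \<theta> > 0"
    and "0 < r" and "r < 1"
    and "contour_C1 C1"
    and "contour_C2 C2"
  shows "let
      F = (\<lambda>n::int. erlang_F r \<rho> n \<theta>);
      H = (\<lambda>n::int. erlang_H C1 \<rho> \<eta> m n \<theta>);
      I = (\<lambda>n::int. erlang_I C2 \<rho> \<eta> m n \<theta>);
      k = int m;
      P = (\<lambda>n::nat. laplace_transform (transition_prob M N n\<^sub>0 n) \<theta>);
      A = complex_of_real (1 / \<rho> * exp (- \<rho> / \<eta>))
            * complex_of_real (\<eta> / \<rho>)
                powr (of_nat n\<^sub>0 - of_nat m - 1 + (\<theta> + of_nat m) / of_real \<eta>)
            * Gamma (\<theta> / of_real \<eta>)
            * complex_of_real (Gamma (real n\<^sub>0 - real m + 1 + real m / \<eta>));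
      B = (I k * F (k - 1) - I (k - 1) * F k) / (F k * H (k - 1) - H k * F (k - 1))
    in
      (\<forall>n\<ge>n\<^sub>0. P n = A * (I (int n\<^sub>0) + B * H (int n\<^sub>0)) * H (int n)) \<and>
      (\<forall>n. m \<le> n \<and> n \<le> n\<^sub>0 \<longrightarrow> P n = A * (I (int n) + B * H (int n)) * H (int n\<^sub>0)) \<and>
      (\<forall>n\<le>m. P n =
          complex_of_real (1 / \<rho> * (\<rho> / \<eta>) powi (int m - int n\<^sub>0)
            * (Gamma (real n\<^sub>0 - real m + 1 + real m / \<eta>) / Gamma (1 + real m / \<eta>)))
          * (H (int n\<^sub>0) * F (int n) / (F k * H (k - 1) - H k * F (k - 1))))"
proof -
  note m = assms(1) and \<rho> = assms(2) and \<eta> = assms(3) and n0 = assms(4) and \<theta> = assms(7)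
  define \<delta> where "\<delta> = erlang_A_death_rate m \<eta>"
  have d0: "\<delta> 0 = 0" by (simp add: \<delta>_def erlang_A_death_rate_def)
  have dS: "\<delta> (Suc i) > 0" for i
    using \<eta> m by (auto simp: \<delta>_def erlang_A_death_rate_def intro!: add_pos_nonneg)
  interpret bd_resolvent \<rho> \<delta> \<theta> by unfold_locales (use \<rho> \<theta> d0 dS in auto)
  have weight0: "weight \<longlonglongrightarrow> 0"
    using erlang_weight_tendsto_0[of \<rho> m \<eta> \<theta>] bd_resolvent_axioms \<eta> unfolding \<delta>_def by blast
  obtain R C where R_bound: "\<And>i j. norm (R i j) \<le> C"
    and R_rec: "\<And>i j. (\<theta> + of_real (\<rho> + \<delta> i)) * R i j =
      of_real \<rho> * R (Suc i) j + of_real (\<delta> i) * R (i - 1) j + (if i = j then 1 else 0 :: complex)"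
    and P_eq: "\<And>n. laplace_transform (transition_prob M N n\<^sub>0 n) \<theta> = R n\<^sub>0 n"
    using birth_death_laplace_backward[of "\<lambda>_. \<rho>" \<delta> M N n\<^sub>0 \<theta>] assms(5,6) \<rho> \<theta> dS
    unfolding erlang_A_process_def \<delta>_def by blast
  have R: "backward (\<lambda>i. if i = j then 1 else 0) (\<lambda>i. R i j)" for j
    unfolding backward_def using R_rec by blast

  define a where "a = \<theta> / of_real \<eta>"
  define x where "x = \<rho> / \<eta>"
  have a: "Re a > 0" and x: "x > 0" using \<rho> \<eta> \<theta> by (simp_all add: a_def x_def)
  have \<theta>a: "\<theta> = of_real \<eta> * a" and \<rho>x: "\<rho> = \<eta> * x" using \<eta> by (simp_all add: a_def x_def)
  \<comment> \<open>The exponent of \<open>z\<close> in the integrands of \<open>H\<close> and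
    \<open>I\<close>; it is still positive at \<open>n = m - 1\<close>, where it equals
    \<open>m / \<eta>\<close>.\<close>
  define b where "b = (\<lambda>n::nat. real n - real m + 1 + real m / \<eta>)"
  have mu: "real m / \<eta> > 0" using m \<eta> by simp
  have b_pos: "b n > 0" if "n \<ge> m - 1" for n
    using that mu m by (simp add: b_def)
  have b_gt_1: "b n > 1" if "n \<ge> m" for n
    using that mu by (simp add: b_def)
  have b_Suc: "b (Suc n) = b n + 1" for n by (simp add: b_def)
  have b_pred: "b (n - 1) = b n - 1" if "n \<ge> m" for n
    using that m by (simp add: b_def of_nat_diff)
  \<comment> \<open>The range includes \<open>m - 1\<close>: in state \<open>m\<close> both formulas
    for the death rate give \<open>m\<close>. So the functions above \<open>m\<close> obey the
    recurrence at \<open>m\<close> itself, whose left neighbour is \<open>m - 1\<close>.\<close>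
  have \<delta>_Suc: "\<delta> (Suc n) = \<eta> * b n" if "n \<ge> m - 1" for n
  proof (cases "Suc n = m")
    case True
    hence "\<delta> (Suc n) = real m" by (simp add: \<delta>_def erlang_A_death_rate_def)
    moreover have "b n = real m / \<eta>" using True by (simp add: b_def flip: of_nat_Suc)
    ultimately show ?thesis using \<eta> by simp
  next
    case False
    hence "\<not> Suc n \<le> m" using that by linarith
    thus ?thesis using \<eta> by (simp add: \<delta>_def erlang_A_death_rate_def b_def field_simps)
  qed
  have \<delta>_eq: "\<delta> n = \<eta> * (b n - 1)" if "n \<ge> m" for n
    using \<delta>_Suc[of "n - 1"] b_pred[OF that] that m by simp

  define hf where "hf = (\<lambda>b. of_real x powr (a + of_real b - 1) * kummer_y a b (of_real x))"
  define jf where "jf = (\<lambda>b. of_real x powr (a + of_real b - 1) * (rGamma a * of_real (rGamma b) * laplace_beta (of_real x) a b))"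
  define h where "h = (\<lambda>n. erlang_H C1 \<rho> \<eta> m (int n) \<theta>)"
  define i where "i = (\<lambda>n. erlang_I C2 \<rho> \<eta> m (int n) \<theta>)"
  define f where "f = (\<lambda>n. erlang_F r \<rho> (int n) \<theta>)"
  have h_eq: "h n = hf (b n)" if "n \<ge> m - 1" for n
    unfolding h_def hf_def a_def x_def
    by (rule erlang_H_eq[OF assms(10) \<rho> \<eta> \<theta>]) (use b_pos[OF that] in \<open>auto simp: b_def\<close>)
  have i_eq: "i n = jf (b n)" if "n \<ge> m - 1" for n
    unfolding i_def jf_def a_def x_def
    by (rule erlang_I_eq[OF assms(11) \<rho> \<eta> \<theta>]) (use b_pos[OF that] in \<open>auto simp: b_def\<close>)
  have rescale: "(\<theta> + of_real (\<rho> + \<delta> n)) * u (b n) = of_real \<rho> * u (b (n - 1)) + of_real (\<delta> (Suc n)) * u (b (Suc n))"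
    if "n \<ge> m" and "(a + of_real (b n - 1) + of_real x) * u (b n) = of_real x * u (b n - 1) + of_real (b n) * u (b n + 1)"
    for u :: "real \<Rightarrow> complex" and n
  proof -
    have "\<theta> + of_real (\<rho> + \<delta> n) = of_real \<eta> * (a + of_real (b n - 1) + of_real x)"
      unfolding \<theta>a \<rho>x \<delta>_eq[OF that(1)] by (simp add: algebra_simps)
    hence "(\<theta> + of_real (\<rho> + \<delta> n)) * u (b n) = of_real \<eta> * (of_real x * u (b n - 1) + of_real (b n) * u (b n + 1))"
      using that(2) by (simp only: mult.assoc)
    also have "\<dots> = of_real \<rho> * u (b (n - 1)) + of_real (\<delta> (Suc n)) * u (b (Suc n))"
      using \<delta>_Suc[of n] that(1) unfolding b_pred[OF that(1)] b_Suc \<rho>x by (simp add: algebra_simps)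
    finally show ?thesis .
  qed
  have h_rec: "(\<theta> + of_real (\<rho> + \<delta> n)) * h n = of_real \<rho> * h (n - 1) + of_real (\<delta> (Suc n)) * h (Suc n)" if "n \<ge> m" for n
    using rescale[OF that, of hf] kummer_recurrence[OF a _ x, of "b n"] b_gt_1[OF that] that
    by (simp add: h_eq hf_def)
  have i_rec: "(\<theta> + of_real (\<rho> + \<delta> n)) * i n = of_real \<rho> * i (n - 1) + of_real (\<delta> (Suc n)) * i (Suc n)" if "n \<ge> m" for n
    using rescale[OF that, of jf] laplace_beta_recurrence[OF a b_gt_1[OF that] x] that
    by (simp add: i_eq jf_def)
  have f_rec: "(\<theta> + of_real (\<rho> + \<delta> n)) * f n = (if n = 0 then 0 else of_real \<rho> * f (n - 1)) + of_real (\<delta> (Suc n)) * f (Suc n)"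
    if "n < m" for n
  proof -
    have "\<delta> n = real n" "\<delta> (Suc n) = real (Suc n)" using that by (auto simp: \<delta>_def erlang_A_death_rate_def)
    \<comment> \<open>At \<open>n = 0\<close> the missing birth term matches the value zero of
      \<open>F\<close> at index -1.\<close>
    moreover have "(if n = 0 then 0 else of_real \<rho> * f (n - 1)) = of_real \<rho> * erlang_F r \<rho> (int n - 1) \<theta>"
      using erlang_F_0(2)[OF assms(8,9), of \<rho> \<theta>] by (auto simp: f_def of_nat_diff)
    ultimately show ?thesis
      using erlang_F_recurrence[OF assms(8,9), of \<theta> \<rho> "int n"] by (simp add: f_def add_ac)
  qed
  have f_0: "f 0 = 1" using erlang_F_0(1)[OF assms(8,9)] by (simp add: f_def)
  define w where "w = (\<lambda>n. of_real x powr (a + of_real (b n) - 1) * of_real (exp x) * (rGamma a * of_real (rGamma (b n + 1))))"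
  have cas: "h n * i (Suc n) - h (Suc n) * i n = w n" if "n \<ge> m - 1" for n
    using erlang_casoratian[OF a b_pos[OF that] x] that by (simp add: h_eq i_eq hf_def jf_def w_def b_Suc)
  have Ga: "a \<notin> \<int>\<^sub>\<le>\<^sub>0" using a by (auto elim!: nonpos_Ints_cases)
  have w_nz: "w n \<noteq> 0" if "n \<ge> m - 1" for n
  proof -
    have "b n + 1 \<notin> \<int>\<^sub>\<le>\<^sub>0" using b_pos[OF that] by (auto elim!: nonpos_Ints_cases)
    thus ?thesis using x Ga by (simp add: w_def rGamma_eq_zero_iff)
  qed
  \<comment> \<open>The bound for \<open>h n\<close> without the factor \<open>exp x\<close>. Its
    successive ratios are at most \<open>x / b n = \<rho> / \<delta> (Suc n)\<close>, the ratios of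
    the weights.\<close>
  define U where "U = (\<lambda>n. x powr (Re a + b n - 1) * norm (rGamma (a + of_real (b n))))"
  have U_Suc: "U (Suc n) \<le> U n * (x / b n)" if "n \<ge> m" for n
  proof -
    define G where "G = norm (rGamma (a + of_real (b n) + 1))"
    have bn: "b n > 0" using b_gt_1[OF that] by simp
    have "b n \<le> norm (a + of_real (b n))"
      using complex_Re_le_cmod[of "a + of_real (b n)"] a by simp
    hence "b n * G \<le> norm (a + of_real (b n)) * G" by (intro mult_right_mono) (simp_all add: G_def)
    also have "\<dots> = norm (rGamma (a + of_real (b n)))"
      unfolding G_def norm_mult[symmetric] rGamma_plus1 ..
    finally have G: "G \<le> norm (rGamma (a + of_real (b n))) / b n" using bn by (simp add: field_simps)
    have "U (Suc n) = x powr (1 + (Re a + b n - 1)) * G"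
      by (simp add: U_def G_def b_Suc add_ac)
    also have "\<dots> = x * x powr (Re a + b n - 1) * G" using x unfolding powr_add by simp
    also have "\<dots> \<le> x * x powr (Re a + b n - 1) * (norm (rGamma (a + of_real (b n))) / b n)"
      using G x by (intro mult_left_mono) auto
    finally show ?thesis by (simp add: U_def mult_ac)
  qed
  have U_weight: "U n \<le> U m / weight m * weight n" if "n \<ge> m" for n
    using that
  proof (induction n rule: dec_induct)
    case (step n)
    have bn: "b n > 0" using b_gt_1 step by force
    have w: "weight (Suc n) = weight n * (x / b n)"
      using weight_Suc[of n] \<delta>_Suc[of n] step bn \<eta> by (simp add: \<rho>x field_simps)
    have "U (Suc n) \<le> U n * (x / b n)" using step by (intro U_Suc)
    also have "\<dots> \<le> U m / weight m * weight n * (x / b n)" using step bn x by (intro mult_right_mono) auto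
    finally show ?case unfolding w by (simp only: mult.assoc)
  qed simp
  have h_bound: "norm (h n) \<le> exp x * (U m / weight m) * weight n" if "n \<ge> m" for n
  proof -
    have "norm (h n) = x powr (Re a + b n - 1) * norm (kummer_y a (b n) (of_real x))"
      using that x by (simp add: h_eq hf_def norm_mult norm_powr_real_powr)
    also have "\<dots> \<le> x powr (Re a + b n - 1) * (norm (rGamma (a + of_real (b n))) * exp (norm (complex_of_real x)))"
      using b_gt_1[OF that] by (intro mult_left_mono kummer_y_sums(2) a) auto
    also have "\<dots> = exp x * U n" using x by (simp add: U_def)
    also have "\<dots> \<le> exp x * (U m / weight m * weight n)" using U_weight[OF that] by (intro mult_left_mono) auto
    finally show ?thesis by (simp only: mult.assoc)
  qed

  define A where "A = complex_of_real (1 / \<rho> * exp (- \<rho> / \<eta>))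
            * complex_of_real (\<eta> / \<rho>)
                powr (of_nat n\<^sub>0 - of_nat m - 1 + (\<theta> + of_nat m) / of_real \<eta>)
            * Gamma (\<theta> / of_real \<eta>)
            * complex_of_real (Gamma (real n\<^sub>0 - real m + 1 + real m / \<eta>))"
  define b0 where "b0 = b n\<^sub>0"
  have b0: "b0 > 0" using b_pos[of n\<^sub>0] n0 by (simp add: b0_def)
  have A_eq: "A = of_real (1 / \<rho>) * of_real (exp (- x)) * of_real x powr (2 - a - of_real b0) * Gamma a * of_real (Gamma b0)"
  proof -
    have "of_nat n\<^sub>0 - of_nat m - 1 + (\<theta> + of_nat m) / of_real \<eta> = a + of_real b0 - 2"
      by (simp add: a_def b0_def b_def add_divide_distrib)
    moreover have "complex_of_real (\<eta> / \<rho>) powr (a + of_real b0 - 2) = of_real x powr (- (a + of_real b0 - 2))"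
    proof -
      have "complex_of_real (\<eta> / \<rho>) = of_real (inverse x)" using \<rho> \<eta> by (simp add: x_def)
      moreover have "Ln (complex_of_real (inverse x)) = - Ln (of_real x)"
        using x by (simp add: Ln_of_real ln_inverse del: of_real_inverse)
      ultimately show ?thesis using x by (simp add: powr_def algebra_simps del: of_real_inverse of_real_divide)
    qed
    moreover have "- (a + of_real b0 - 2) = 2 - a - of_real b0" by simp
    moreover have "real n\<^sub>0 - real m + 1 + real m / \<eta> = b0" by (simp add: b0_def b_def)
    ultimately show ?thesis
      unfolding A_def by (simp only: a_def[symmetric] x_def of_real_mult minus_divide_left)
  qed
  have GG: "Gamma a * rGamma a = 1" using Ga by (simp add: Gamma_def rGamma_eq_zero_iff)
  have G0: "b0 * rGamma (b0 + 1) * Gamma b0 = 1"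
  proof -
    have "b0 \<notin> \<int>\<^sub>\<le>\<^sub>0" using b0 by (auto elim!: nonpos_Ints_cases)
    thus ?thesis by (simp add: rGamma_plus1 Gamma_def rGamma_eq_zero_iff)
  qed
  have ee: "complex_of_real (exp (- x)) * of_real (exp x) = 1"
    by (simp add: exp_minus flip: of_real_mult)
  \<comment> \<open>All factors containing \<open>a\<close> cancel, so products of \<open>A\<close>
    with Casoratians involve only real Gamma values and a power of \<open>x\<close>.\<close>
  have Aw: "A * w n = of_real (1 / \<rho>) * of_real x powr (1 - of_real b0 + of_real (b n)) * of_real (Gamma b0 * rGamma (b n + 1))" for n
  proof -
    have "A * w n = of_real (1 / \<rho>) * (complex_of_real (exp (- x)) * of_real (exp x)) *
        (of_real x powr (2 - a - of_real b0) * of_real x powr (a + of_real (b n) - 1)) * (Gamma a * rGamma a) *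
        of_real (Gamma b0 * rGamma (b n + 1))"
      unfolding A_eq w_def by (simp only: of_real_mult mult_ac)
    also have "of_real x powr (2 - a - of_real b0) * of_real x powr (a + of_real (b n) - 1) = of_real x powr (1 - of_real b0 + of_real (b n))"
      unfolding powr_add[symmetric] by (simp add: algebra_simps)
    finally show ?thesis unfolding ee GG by simp
  qed
  \<comment> \<open>With \<open>\<delta> (Suc n\<^sub>0) = \<eta> * b0\<close> and
    \<open>\<eta> * x = \<rho>\<close>, the normalisation reduces to
    \<open>b0 * rGamma (b0 + 1) * Gamma b0 = 1\<close>.\<close>
  have A1: "A * (of_real (\<delta> (Suc n\<^sub>0)) * w n\<^sub>0) = 1"
  proof -
    have "A * (of_real (\<delta> (Suc n\<^sub>0)) * w n\<^sub>0) = of_real (\<eta> * b0) * (A * w n\<^sub>0)"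
      using \<delta>_Suc[of n\<^sub>0] n0 by (simp add: b0_def)
    also have "\<dots> = of_real (\<eta> * x / \<rho> * (b0 * rGamma (b0 + 1) * Gamma b0))"
      unfolding Aw b0_def[symmetric] using x by simp
    finally show ?thesis unfolding G0 using \<eta> x \<rho>x by simp
  qed
  have A2: "A * w (m - 1) = complex_of_real (1 / \<rho> * (\<rho> / \<eta>) powi (int m - int n\<^sub>0) * (Gamma b0 / Gamma (1 + real m / \<eta>)))"
  proof -
    have bm: "b (m - 1) = real m / \<eta>" using m by (simp add: b_def of_nat_diff)
    have e: "1 - complex_of_real b0 + of_real (b (m - 1)) = of_int (int m - int n\<^sub>0)"
      unfolding bm b0_def by (simp add: b_def)
    \<comment> \<open>The summands \<open>m / \<eta>\<close> have cancelled in the exponent, which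
      is now an integer; this accounts for \<open>powi\<close> in the third formula.\<close>
    have p: "complex_of_real x powr of_int (int m - int n\<^sub>0) = complex_of_real x powi (int m - int n\<^sub>0)"
      using x by (intro complex_powr_of_int) simp
    show ?thesis unfolding Aw e p unfolding bm by (simp add: x_def Gamma_def add_ac divide_inverse)
  qed

  define B where "B = (i m * f (m - 1) - i (m - 1) * f m) / (f m * h (m - 1) - h m * f (m - 1))"
  note green = green_function[OF m f_rec f_0 h_rec i_rec cas w_nz h_bound R R_bound weight0 n0 A1 B_def]
  have g1: "R n\<^sub>0 n = A * (i n\<^sub>0 + B * h n\<^sub>0) * h n" if "n \<ge> n\<^sub>0" for n
    by (rule green(1)) (use that in auto)
  have g2: "R n\<^sub>0 n = A * (i n + B * h n) * h n\<^sub>0" if "m \<le> n" "n \<le> n\<^sub>0" for n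
    by (rule green(2)) (use that in auto)
  have g3': "R n\<^sub>0 n = A * w (m - 1) * (h n\<^sub>0 * f n / (f m * h (m - 1) - h m * f (m - 1)))" if "n \<le> m" for n
    by (rule green(3)) (use that in auto)
  have g3: "R n\<^sub>0 n = complex_of_real (1 / \<rho> * (\<rho> / \<eta>) powi (int m - int n\<^sub>0)
            * (Gamma (real n\<^sub>0 - real m + 1 + real m / \<eta>) / Gamma (1 + real m / \<eta>)))
          * (h n\<^sub>0 * f n / (f m * h (m - 1) - h m * f (m - 1)))" if "n \<le> m" for n
    using g3'[OF that] unfolding A2 b0_def b_def .
  have km: "int m - 1 = int (m - 1)" using m by simp
  show ?thesis
    using g1 g2 g3
    unfolding Let_def km P_eq A_def[symmetric] B_def h_def i_def f_def by blast
qed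

end
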